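(* For each positive integer $n$, let $M_n$ be a random $n \times n$ matrix whose entries are independent random variables, each equal to $+1$ or $-1$ with probability $1/2$, and let $P_n := \mathbf{P}(\det(M_n) = 0)$ (determinant over the reals) be the probability that $M_n$ is singular. Then $$ P_n \le \left(\tfrac{3}{4} + o(1)\right)^n, $$ where $o(1)$ denotes a quantity that tends to $0$ as $n \to \infty$. *)

theory Defs
  imports "HOL-Probability.Probability" "Jordan_Normal_Form.Determinant"
begin

text \<open>
  \<open>M\<close> is a random \<open>n \<times> n\<close> matrix on the probability space \<open>\<Omega>\<close> with independent
  uniform signs as entries. Matrices are those of the Jordan normal form library, whose
  dimension is not part of the type, so that \<open>n\<close> can tend to infinity; indices start at 0.
  Measurability of the entries is part of \<open>indep_vars\<close>.
\<close>

definition random_sign_matrix :: "'a measure \<Rightarrow> nat \<Rightarrow> ('a \<Rightarrow> real mat) \<Rightarrow> bool" where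
  "random_sign_matrix \<Omega> n M \<longleftrightarrow>
     prob_space \<Omega> \<and>
     (\<forall>\<omega>\<in>space \<Omega>. M \<omega> \<in> carrier_mat n n) \<and>
     prob_space.indep_vars \<Omega> (\<lambda>_. borel) (\<lambda>(i, j) \<omega>. M \<omega> $$ (i, j)) ({..<n} \<times> {..<n}) \<and>
     (\<forall>i<n. \<forall>j<n. \<P>(\<omega> in \<Omega>. M \<omega> $$ (i, j) = 1) = 1 / 2 \<and>
                 \<P>(\<omega> in \<Omega>. M \<omega> $$ (i, j) = -1) = 1 / 2)"

end

theory Submission
  imports Defs "HOL-Real_Asymp.Real_Asymp"
begin

text \<open>
  If \<open>M\<close> is singular, some row is orthogonal to a normal vector \<open>v\<close> of the other \<open>n - 1\<close> rows.
  This has probability at most \<open>\<tau> = (3/4 + \<epsilon>)^n\<close> unless \<open>\<P>(x \<bullet> v = 0) \<ge> \<tau>\<close> for a random sign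
  vector \<open>x\<close>, so it suffices that such structured normal vectors are unlikely. Following
  Tikhomirov, \<open>v\<close> (of norm \<open>\<surd>n\<close>) is scaled by the first \<open>N\<close> at which \<open>x \<bullet> N v\<close> is much more concentrated
  than \<open>1/N\<close>, and rounded at random to an integer vector \<open>w\<close>: all \<open>n - 1\<close> products with the rows stay
  small and the concentration changes by a constant factor only. A union bound over \<open>w\<close> remains;
  vectors with few large coordinates are treated in the same way with a coarser scale.

  The number of concentrated \<open>w\<close> is bounded by a moment method. Up to a main term, the concentration of
  \<open>w\<close> is a sum over frequencies \<open>\<xi>\<close> of \<open>\<Prod>\<^sub>i \<bar>cos (\<alpha> \<xi> w\<^sub>i)\<bar>\<close>, where \<open>\<bar>cos t\<bar> \<le> 3/4 + cos (2 t) / 4\<close>, the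
  characteristic function of a lazy step. Averaging the \<open>r\<close>-th power over \<open>w\<close> exchanges the roles of \<open>w\<close>
  and \<open>\<xi>\<close>: there appears the probability that the lazy walk with steps \<open>\<xi>\<^sub>1, ..., \<xi>\<^sub>r\<close> ends near 0. It is at
  most \<open>(3/4)^k\<close> if \<open>k\<close> of the frequencies are not determined by the previous ones, and always
  \<open>O(1/\<surd>r)\<close> by Littlewood--Offord. As \<open>N\<close> is less than \<open>(4/3 - \<epsilon>')^n\<close>, the first bound pays for the choice of
  the \<open>k\<close> free frequencies when \<open>k\<close> is large and the second one when \<open>k\<close> is small, so with \<open>r\<close> a power of
  \<open>n\<close> the count gains more than every power of \<open>(log n)^n\<close>, which covers all losses.
\<close>

text \<open>Taken alone, the union bound almost breaks even: there are about \<open>N ^ n\<close>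
  candidates \<open>w\<close>, and each survives the \<open>n - 1\<close> row tests with probability
  about \<open>(1 / N) ^ (n - 1)\<close>. What remains is two factors \<open>K\<close> (the largest
  \<open>N\<close>), exponential in n, and a power of log n per coordinate, in all exp (O(n log log
  n)). An exponential gain in the count of \<open>w\<close> would not pay for this, hence moments of
  growing order \<open>r\<close>. In the end \<open>G\<close> is about (log n)^2, \<open>m\<close>
  about n^(1/2) and \<open>r\<close> about n^(1/4). The two bounds for \<open>k\<close> free
  frequencies are exchanged at \<open>k0\<close>, about (log n)^(1/2): from there on the gain is
  \<open>(K * (3/4) ^ n) ^ k0\<close>, about exp (- c n (log n)^(1/2)); below,
  \<open>K ^ k0\<close>, which is exp (O(n (log n)^(1/2))), meets \<open>r\<close> to the power
  -n/2, about exp (- n (log n) / 8). The number of pivot patterns is at most 5^(r (r + 1)), only exp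
  (O(n^(1/2))) for this \<open>r\<close>. Compressible vectors have so few approximants that any
  fixed bound below 3/4 per row suffices.\<close>

definition ip :: "nat \<Rightarrow> (nat \<Rightarrow> real) \<Rightarrow> (nat \<Rightarrow> real) \<Rightarrow> real" where
  "ip n x v = (\<Sum>i<n. x i * v i)"

definition signs :: "nat \<Rightarrow> (nat \<Rightarrow> real) set" where
  "signs n = PiE {..<n} (\<lambda>_. {-1, 1})"

abbreviation sign_rows :: "'a set \<Rightarrow> nat \<Rightarrow> ('a \<Rightarrow> nat \<Rightarrow> real) set" where
  "sign_rows I n \<equiv> PiE I (\<lambda>_. signs n)"

text \<open>A smoothed concentration probability at scale \<open>s\<close>. With the exponential kernel a perturbation \<open>y\<close>
  of \<open>x \<bullet> v\<close> costs at most a factor \<open>exp (\<bar>y\<bar> / s)\<close>, so no tail events have to be cut off under rounding.\<close>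

definition conc :: "nat \<Rightarrow> real \<Rightarrow> (nat \<Rightarrow> real) \<Rightarrow> real" where
  "conc n s v = (\<Sum>x\<in>signs n. exp (- \<bar>ip n x v\<bar> / s)) / 2 ^ n"

section \<open>Sign vectors and the smoothed concentration\<close>

lemma finite_signs [simp]: "finite (signs n)"
  by (simp add: signs_def finite_PiE)

lemma card_signs: "card (signs n) = 2 ^ n"
  by (simp add: signs_def card_PiE numeral_2_eq_2)

lemma signs_nonempty: "signs n \<noteq> {}"
  using card_signs[of n] by (metis card.empty power_not_zero zero_neq_numeral)

lemma signsD: "x \<in> signs n \<Longrightarrow> i < n \<Longrightarrow> x i = -1 \<or> x i = 1"
  by (auto simp: signs_def PiE_iff)

lemma ip_diff_right: "ip n x (\<lambda>i. v i - w i) = ip n x v - ip n x w"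
  by (simp add: ip_def right_diff_distrib sum_subtractf)

lemma ip_scale_right: "ip n x (\<lambda>i. c * v i) = c * ip n x v"
  by (simp add: ip_def sum_distrib_left mult_ac)

lemma conc_pos: "conc n s v > 0"
  unfolding conc_def using signs_nonempty by (intro divide_pos_pos sum_pos) auto

lemma conc_le_1: assumes "s > 0" shows "conc n s v \<le> 1"
proof -
  have "(\<Sum>x\<in>signs n. exp (- \<bar>ip n x v\<bar> / s)) \<le> (\<Sum>x\<in>signs n. 1)"
    using assms by (intro sum_mono) auto
  then show ?thesis by (simp add: conc_def card_signs)
qed

lemma conc_antimono_scale:
  assumes "s > 0" "0 \<le> a" "a \<le> b"
  shows "conc n s (\<lambda>i. b * v i) \<le> conc n s (\<lambda>i. a * v i)"
  unfolding conc_def ip_scale_right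
proof (intro divide_right_mono sum_mono)
  fix x
  have "\<bar>a * ip n x v\<bar> \<le> \<bar>b * ip n x v\<bar>"
    using assms by (simp add: abs_mult mult_right_mono)
  then show "exp (- \<bar>b * ip n x v\<bar> / s) \<le> exp (- \<bar>a * ip n x v\<bar> / s)"
    using assms by (simp add: divide_right_mono)
qed auto

lemma card_signs_le_conc:
  assumes "s > 0"
  shows "card {x \<in> signs n. \<bar>ip n x v\<bar> \<le> s} \<le> exp 1 * conc n s v * 2 ^ n"
proof -
  let ?A = "{x \<in> signs n. \<bar>ip n x v\<bar> \<le> s}"
  have "real (card ?A) = (\<Sum>x\<in>?A. 1)" by simp
  also have "... \<le> (\<Sum>x\<in>?A. exp 1 * exp (- \<bar>ip n x v\<bar> / s))"
    using assms by (intro sum_mono) (auto simp: exp_add[symmetric])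
  also have "... \<le> (\<Sum>x\<in>signs n. exp 1 * exp (- \<bar>ip n x v\<bar> / s))"
    by (intro sum_mono2) auto
  finally show ?thesis by (simp add: conc_def sum_distrib_left)
qed

lemma card_signs_zero_le_conc:
  "card {x \<in> signs n. ip n x v = 0} \<le> conc n s v * 2 ^ n"
proof -
  let ?A = "{x \<in> signs n. ip n x v = 0}"
  have "real (card ?A) = (\<Sum>x\<in>?A. exp (- \<bar>ip n x v\<bar> / s))" by simp
  also have "... \<le> (\<Sum>x\<in>signs n. exp (- \<bar>ip n x v\<bar> / s))"
    by (intro sum_mono2) auto
  finally show ?thesis by (simp add: conc_def)
qed

subsection \<open>Randomised rounding\<close>

lemma exp_le_quadratic:
  fixes z :: real assumes "\<bar>z\<bar> \<le> 1" shows "exp z \<le> 1 + z + z\<^sup>2"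
proof (cases "z \<ge> 0")
  case True then show ?thesis using assms exp_bound[of z] by simp
next
  case False
  define y where "y = - z"
  have y: "0 < y" using False by (simp add: y_def)
  \<comment> \<open>The claim \<open>exp (- y) \<le> 1 - y + y^2\<close> is multiplied by
    \<open>exp y\<close>, which is then replaced by its quadratic Taylor polynomial.\<close>
  have "1 \<le> 1 + y^2/2 + y^3/2 + y^4/2" using y by simp
  also have "... = (1 - y + y^2) * (1 + y + y^2/2)"
    by (simp add: field_simps power2_eq_square power3_eq_cube power4_eq_xxxx)
  also have "... \<le> (1 - y + y^2) * exp y"
  proof (intro mult_left_mono)
    show "1 + y + y\<^sup>2 / 2 \<le> exp y" using y exp_lower_Taylor_quadratic[of y] by simp
    have "0 \<le> (1 - y)^2" by simp
    moreover have "(1 - y)^2 = 1 - 2*y + y^2" by (simp add: power2_eq_square algebra_simps)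
    ultimately show "0 \<le> 1 - y + y\<^sup>2" using y by simp
  qed
  finally have "exp (-y) \<le> 1 - y + y^2"
    by (simp add: exp_minus field_simps)
  then show ?thesis by (simp add: y_def)
qed

text \<open>\<open>u i\<close> is rounded to \<open>\<lfloor>u i\<rfloor> + b i\<close> with independent Bernoulli bits \<open>b i\<close> of mean \<open>frac (u i)\<close>.\<close>

definition bern_wt :: "real \<Rightarrow> int \<Rightarrow> real" where
  "bern_wt u b = (if b = 1 then frac u else 1 - frac u)"

definition round_exp :: "nat \<Rightarrow> (nat \<Rightarrow> real) \<Rightarrow> ((nat \<Rightarrow> int) \<Rightarrow> real) \<Rightarrow> real" where
  "round_exp n u F = (\<Sum>b\<in>PiE {..<n} (\<lambda>_. {0, 1}). (\<Prod>i<n. bern_wt (u i) (b i)) * F b)"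

lemma bern_wt_nonneg: "bern_wt u b \<ge> 0"
  by (simp add: bern_wt_def frac_lt_1 less_imp_le)

lemma round_exp_prod:
  "round_exp n u (\<lambda>b. \<Prod>i<n. f i (b i)) = (\<Prod>i<n. \<Sum>b\<in>{0,1}. bern_wt (u i) b * f i b)"
  by (subst prod_sum_PiE) (auto simp: round_exp_def prod.distrib)

lemma round_exp_add: "round_exp n u (\<lambda>b. F b + G b) = round_exp n u F + round_exp n u G"
  by (simp add: round_exp_def distrib_left sum.distrib)

lemma round_exp_sum: "round_exp n u (\<lambda>b. \<Sum>k\<in>K. F k b) = (\<Sum>k\<in>K. round_exp n u (F k))"
  unfolding round_exp_def by (subst sum.swap) (simp add: sum_distrib_left)

lemma round_exp_cmult: "round_exp n u (\<lambda>b. c * F b) = c * round_exp n u F"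
  by (simp add: round_exp_def sum_distrib_left mult_ac)

lemma round_exp_mono:
  assumes "\<And>b. b \<in> PiE {..<n} (\<lambda>_. {0, 1}) \<Longrightarrow> F b \<le> G b"
  shows "round_exp n u F \<le> round_exp n u G"
  unfolding round_exp_def using assms
  by (intro sum_mono mult_left_mono) (auto intro!: prod_nonneg bern_wt_nonneg)

lemma round_exp_1: "round_exp n u (\<lambda>_. 1) = 1"
  using round_exp_prod[of n u "\<lambda>_ _. 1"] by (simp add: bern_wt_def)

lemma round_exp_exists:
  assumes "round_exp n u F < 1"
  shows "\<exists>b\<in>PiE {..<n} (\<lambda>_. {0, 1}). F b < 1"
proof (rule ccontr)
  assume "\<not> ?thesis"
  then have "round_exp n u (\<lambda>_. 1) \<le> round_exp n u F"
    by (intro round_exp_mono) (auto simp: not_less)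
  then show False using assms by (simp add: round_exp_1)
qed

text \<open>The bits are centred, so the linear terms of \<open>exp z \<le> 1 + z + z^2\<close>
  cancel in the mean and each factor is at most \<open>1 + d^2\<close>; independence multiplies the
  factors.\<close>

lemma round_exp_mgf:
  assumes "\<And>i. i < n \<Longrightarrow> \<bar>c i\<bar> \<le> d" "d \<le> 1"
  shows "round_exp n u (\<lambda>b. exp (\<Sum>i<n. c i * (of_int (b i) - frac (u i)))) \<le> exp (n * d\<^sup>2)"
proof -
  have one: "(\<Sum>b\<in>{0,1}. bern_wt (u i) b * exp (c i * (of_int b - frac (u i)))) \<le> exp (d\<^sup>2)"
    if "i < n" for i
  proof -
    define p where "p = frac (u i)"
    have p: "0 \<le> p" "p < 1" by (simp_all add: p_def frac_lt_1)
    have c: "\<bar>c i\<bar> \<le> 1" using assms that by force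
    have b: "exp (c i * z) \<le> 1 + c i * z + (c i * z)\<^sup>2" if "\<bar>z\<bar> \<le> 1" for z
      using that c by (intro exp_le_quadratic) (auto simp: abs_mult intro: mult_le_one)
    have "(\<Sum>b\<in>{0,1}. bern_wt (u i) b * exp (c i * (of_int b - frac (u i)))) =
        (1 - p) * exp (c i * (- p)) + p * exp (c i * (1 - p))"
      by (simp add: bern_wt_def p_def)
    also have "... \<le> (1 - p) * (1 + c i * (-p) + (c i * (-p))\<^sup>2) + p * (1 + c i * (1-p) + (c i * (1-p))\<^sup>2)"
      using p by (intro add_mono mult_left_mono b) auto
    also have "... = 1 + (c i)\<^sup>2 * (p * (1 - p))" by (simp add: power2_eq_square algebra_simps)
    also have "... \<le> 1 + (c i)\<^sup>2 * 1"
      using p by (intro add_mono mult_left_mono mult_le_one) auto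
    also have "... \<le> 1 + d\<^sup>2"
      using assms(1)[OF that] by (simp add: abs_le_square_iff[symmetric])
    also have "... \<le> exp (d\<^sup>2)" by simp
    finally show ?thesis .
  qed
  have "round_exp n u (\<lambda>b. exp (\<Sum>i<n. c i * (of_int (b i) - frac (u i)))) =
      (\<Prod>i<n. \<Sum>b\<in>{0,1}. bern_wt (u i) b * exp (c i * (of_int b - frac (u i))))"
    by (subst round_exp_prod[symmetric]) (simp add: exp_sum)
  also have "... \<le> (\<Prod>i<n. exp (d\<^sup>2))"
    using one by (intro prod_mono) (auto intro!: add_nonneg_nonneg mult_nonneg_nonneg bern_wt_nonneg)
  finally show ?thesis by (simp add: exp_of_nat_mult)
qed

text \<open>The two possible roundings never lie strictly on opposite sides of 0, so the absolute
  value is linear between them and unbiasedness carries over. The factors 1 at the other coordinates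
  give the product form that \<open>round_exp_prod\<close> expects.\<close>

lemma round_exp_abs:
  assumes "i < n"
  shows "round_exp n u (\<lambda>b. \<bar>of_int (\<lfloor>u i\<rfloor> + b i)\<bar>) = \<bar>u i\<bar>"
proof -
  let ?f = "\<lambda>j b. if j = i then \<bar>real_of_int (\<lfloor>u i\<rfloor> + b)\<bar> else 1"
  have "round_exp n u (\<lambda>b. \<bar>of_int (\<lfloor>u i\<rfloor> + b i)\<bar>) = round_exp n u (\<lambda>b. \<Prod>j<n. ?f j (b j))"
    using assms by (simp add: prod.delta)
  also have "... = (\<Prod>j<n. \<Sum>b\<in>{0,1}. bern_wt (u j) b * ?f j b)" by (rule round_exp_prod)
  also have "... = (\<Prod>j<n. if j = i then \<bar>u i\<bar> else 1)"
  proof (intro prod.cong refl)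
    fix j
    have "(1 - frac (u i)) * \<bar>real_of_int \<lfloor>u i\<rfloor>\<bar> + frac (u i) * \<bar>real_of_int \<lfloor>u i\<rfloor> + 1\<bar> = \<bar>u i\<bar>"
    proof (cases "u i \<ge> 0")
      case True
      then have "real_of_int \<lfloor>u i\<rfloor> \<ge> 0" by simp
      then show ?thesis using True by (simp add: frac_def algebra_simps)
    next
      case False
      then have "\<lfloor>u i\<rfloor> + 1 \<le> 0" by linarith
      then have "real_of_int \<lfloor>u i\<rfloor> + 1 \<le> 0" by linarith
      then show ?thesis using False by (simp add: frac_def algebra_simps)
    qed
    then show "(\<Sum>b\<in>{0,1}. bern_wt (u j) b * ?f j b) = (if j = i then \<bar>u i\<bar> else 1)"
      by (simp add: bern_wt_def)
  qed
  also have "... = \<bar>u i\<bar>" using assms by (simp add: prod.delta)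
  finally show ?thesis .
qed

lemma exp_abs_le: "exp \<bar>x::real\<bar> \<le> exp x + exp (- x)"
  by (cases "x \<ge> 0") auto

text \<open>The rounding error of each row product has bounded exponential moments at scale
  \<open>m\<close>, as \<open>n \<le> m^2\<close>. So a random rounding changes the exponential
  kernel by a bounded factor on average, and Markov's inequality handles all rows at once because
  \<open>s / m\<close> exceeds the logarithm of their number. The set \<open>T\<close> serves
  compressible vectors: the l1 norm of the rounded small coordinates bounds how many of them are
  nonzero.\<close>

lemma rounding:
  fixes u :: "nat \<Rightarrow> real" and m :: nat and s :: real
  assumes m: "n \<le> m\<^sup>2" "m \<ge> 1" and s: "s \<ge> m"
    and R: "finite R" "R \<subseteq> signs n" "card R * exp (- s / m) * 24 \<le> 1"
    and T: "T \<subseteq> {..<n}"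
  obtains w :: "nat \<Rightarrow> int" where
    "\<And>i. i < n \<Longrightarrow> \<bar>w i - u i\<bar> \<le> 1"
    "\<And>x. x \<in> R \<Longrightarrow> \<bar>ip n x (\<lambda>i. w i - u i)\<bar> \<le> s"
    "conc n s w \<le> 18 * conc n s u" "conc n s u \<le> 18 * conc n s w"
    "(\<Sum>i\<in>T. \<bar>w i\<bar>) \<le> 4 * (\<Sum>i\<in>T. \<bar>u i\<bar>) + 1"
proof -
  have m0: "real m > 0" and s0: "s > 0" using m s by auto
  define Y where "Y = (\<lambda>x b. ip n x (\<lambda>i. of_int (b i) - frac (u i)))"
  define a where "a = (\<lambda>x. exp (- \<bar>ip n x u\<bar> / s))"
  define D where "D = (\<lambda>b::nat\<Rightarrow>int. (\<Sum>x\<in>signs n. a x * exp (\<bar>Y x b\<bar> / m)) / 2 ^ n)"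
  define U where "U = (\<Sum>i\<in>T. \<bar>u i\<bar>)"
  have U0: "U \<ge> 0" by (simp add: U_def sum_nonneg)
  have mgf1: "round_exp n u (\<lambda>b. exp (\<sigma> * Y x b / m)) \<le> exp 1"
    if "x \<in> signs n" "\<sigma> = 1 \<or> \<sigma> = -1" for x \<sigma>
  proof -
    have "round_exp n u (\<lambda>b. exp (\<sigma> * Y x b / m)) =
        round_exp n u (\<lambda>b. exp (\<Sum>i<n. (\<sigma> * x i / m) * (of_int (b i) - frac (u i))))"
      by (simp add: Y_def ip_def sum_distrib_left sum_divide_distrib mult_ac)
    also have "... \<le> exp (n * (1 / m)\<^sup>2)"
      using that m by (intro round_exp_mgf) (auto simp: abs_mult dest: signsD)
    also have "... \<le> exp 1"
      using m m0 by (simp add: power_divide)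
    finally show ?thesis .
  qed
  have mgf: "round_exp n u (\<lambda>b. exp (Y x b / m) + exp (- Y x b / m)) \<le> 6" if "x \<in> signs n" for x
    using mgf1[OF that, of 1] mgf1[OF that, of "-1"] exp_le
    by (simp add: round_exp_add)
  have a0: "a x > 0" for x by (simp add: a_def)
  have c_a: "conc n s u = (\<Sum>x\<in>signs n. a x) / 2^n" by (simp add: conc_def a_def)
  have D: "round_exp n u D \<le> 6 * conc n s u"
  proof -
    have "round_exp n u D = round_exp n u (\<lambda>b. (1/2^n) * (\<Sum>x\<in>signs n. a x * exp (\<bar>Y x b\<bar> / m)))"
      by (simp add: D_def)
    also have "... = (1/2^n) * (\<Sum>x\<in>signs n. a x * round_exp n u (\<lambda>b. exp (\<bar>Y x b\<bar> / m)))"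
      by (simp only: round_exp_cmult round_exp_sum)
    also have "... \<le> (1/2^n) * (\<Sum>x\<in>signs n. a x * 6)"
    proof (intro mult_left_mono sum_mono)
      fix x assume "x \<in> signs n"
      have "round_exp n u (\<lambda>b. exp (\<bar>Y x b\<bar> / m)) \<le> round_exp n u (\<lambda>b. exp (Y x b / m) + exp (- Y x b / m))"
        using exp_abs_le[of "Y x _ / m"] m0 by (intro round_exp_mono) (simp add: abs_divide)
      also have "... \<le> 6" by (rule mgf) fact
      finally show "round_exp n u (\<lambda>b. exp (\<bar>Y x b\<bar> / m)) \<le> 6" .
    qed (use a0 in \<open>auto intro: less_imp_le\<close>)
    finally show ?thesis by (simp add: c_a sum_distrib_right[symmetric] mult_ac)
  qed
  \<comment> \<open>A row with error beyond \<open>s\<close> makes its own summand at least 1, so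
    \<open>P b < 1\<close> controls all rows. Each bracket has mean at most 2 e \<le> 6, and 24 = 4
    * 6 makes the total mean at most 1/4.\<close>
  define P where "P = (\<lambda>b. \<Sum>x\<in>R. exp (- s / m) * (exp (Y x b / m) + exp (- Y x b / m)))"
  have P: "round_exp n u P \<le> 1/4"
  proof -
    have "round_exp n u P = (\<Sum>x\<in>R. exp (- s / m) * round_exp n u (\<lambda>b. exp (Y x b / m) + exp (- Y x b / m)))"
      by (simp only: P_def round_exp_cmult round_exp_sum)
    also have "... \<le> (\<Sum>x\<in>R. exp (- s / m) * 6)"
      using R by (intro sum_mono mult_left_mono mgf) auto
    also have "... = (card R * exp (- s / m) * 24) / 4" by simp
    also have "... \<le> 1/4" using R by simp
    finally show ?thesis .
  qed
  define S where "S = (\<lambda>b. \<Sum>i\<in>T. \<bar>real_of_int (\<lfloor>u i\<rfloor> + b i)\<bar>)"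
  have S: "round_exp n u S = U"
    unfolding S_def round_exp_sum U_def using T by (intro sum.cong refl round_exp_abs) auto
  \<comment> \<open>All demands are added into one quantity of mean at most 1/3 + 1/4 + 1/4 < 1, so
    a single outcome meets them together. The 1 in \<open>4 * U + 1\<close> covers the case
    \<open>U = 0\<close>.\<close>
  define F where "F = (\<lambda>b. (1 / (18 * conc n s u)) * D b + (P b + (1 / (4 * U + 1)) * S b))"
  have "round_exp n u F = (1 / (18 * conc n s u)) * round_exp n u D + (round_exp n u P + (1 / (4 * U + 1)) * round_exp n u S)"
    by (simp only: F_def round_exp_add round_exp_cmult)
  also have "... \<le> (1 / (18 * conc n s u)) * (6 * conc n s u) + (1/4 + 1/4)"
  proof (intro add_mono mult_left_mono D P)
    show "1 / (4 * U + 1) * round_exp n u S \<le> 1/4" using S U0 by (simp add: field_simps)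
    show "0 \<le> 1 / (18 * conc n s u)" using conc_pos[of n s u] by simp
  qed
  also have "... < 1" using conc_pos[of n s u] by simp
  finally obtain b where b: "b \<in> PiE {..<n} (\<lambda>_. {0, 1})" and F: "F b < 1"
    using round_exp_exists by blast
  define w where "w = (\<lambda>i. \<lfloor>u i\<rfloor> + b i)"
  have wu: "w i - u i = of_int (b i) - frac (u i)" for i by (simp add: w_def frac_def)
  have nn: "0 \<le> (1 / (18 * conc n s u)) * D b" "0 \<le> P b" "0 \<le> (1 / (4 * U + 1)) * S b"
  proof -
    show "0 \<le> (1 / (18 * conc n s u)) * D b" using conc_pos[of n s u]
      unfolding D_def a_def by (intro mult_nonneg_nonneg divide_nonneg_nonneg sum_nonneg) auto
    show "0 \<le> P b" unfolding P_def by (intro sum_nonneg mult_nonneg_nonneg add_nonneg_nonneg) auto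
    show "0 \<le> (1 / (4 * U + 1)) * S b" using U0 unfolding S_def
      by (intro mult_nonneg_nonneg sum_nonneg) auto
  qed
  have D1: "D b \<le> 18 * conc n s u" and P1: "P b < 1" and S1: "S b \<le> 4 * U + 1"
  proof -
    have "(1 / (18 * conc n s u)) * D b < 1" using F nn unfolding F_def by linarith
    then show "D b \<le> 18 * conc n s u" using conc_pos[of n s u] by (simp add: field_simps)
    show "P b < 1" using F nn unfolding F_def by linarith
    have "(1 / (4 * U + 1)) * S b < 1" using F nn unfolding F_def by linarith
    then show "S b \<le> 4 * U + 1" using U0 by (simp add: field_simps)
  qed
  have ipw: "ip n x w = ip n x u + Y x b" for x
  proof -
    have "Y x b = ip n x (\<lambda>i. w i - u i)" by (simp add: Y_def wu)
    then show ?thesis by (simp add: ip_diff_right)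
  qed
  have ms: "\<bar>Y x b\<bar> / s \<le> \<bar>Y x b\<bar> / m" for x using s m0 by (intro divide_left_mono) auto
  have up: "exp (- \<bar>ip n x w\<bar> / s) \<le> a x * exp (\<bar>Y x b\<bar> / m)" for x
  proof -
    have "- \<bar>ip n x w\<bar> \<le> - \<bar>ip n x u\<bar> + \<bar>Y x b\<bar>" unfolding ipw by linarith
    then have "- \<bar>ip n x w\<bar> / s \<le> (- \<bar>ip n x u\<bar> + \<bar>Y x b\<bar>) / s" using s0 by (intro divide_right_mono) auto
    also have "... \<le> - \<bar>ip n x u\<bar> / s + \<bar>Y x b\<bar> / m" using ms[of x] by (simp add: diff_divide_distrib)
    finally show ?thesis by (simp add: a_def exp_add[symmetric])
  qed
  have lo: "a x * exp (- \<bar>Y x b\<bar> / m) \<le> exp (- \<bar>ip n x w\<bar> / s)" for x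
  proof -
    have "- \<bar>ip n x u\<bar> - \<bar>Y x b\<bar> \<le> - \<bar>ip n x w\<bar>" unfolding ipw by linarith
    then have "(- \<bar>ip n x u\<bar> - \<bar>Y x b\<bar>) / s \<le> - \<bar>ip n x w\<bar> / s" using s0 by (intro divide_right_mono) auto
    moreover have "- \<bar>ip n x u\<bar> / s - \<bar>Y x b\<bar> / m \<le> (- \<bar>ip n x u\<bar> - \<bar>Y x b\<bar>) / s"
      using ms[of x] by (simp add: diff_divide_distrib)
    ultimately show ?thesis by (simp add: a_def exp_add[symmetric])
  qed
  have cw: "conc n s w \<le> D b"
    unfolding conc_def D_def using up by (intro divide_right_mono sum_mono) auto
  show thesis
  proof (rule that[of w])
    show "\<bar>w i - u i\<bar> \<le> 1" if "i < n" for i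
    proof -
      have "b i = 0 \<or> b i = 1" using b that by (auto simp: PiE_iff)
      then show ?thesis unfolding wu using frac_lt_1[of "u i"] frac_ge_0[of "u i"] by auto
    qed
    show "\<bar>ip n x (\<lambda>i. w i - u i)\<bar> \<le> s" if "x \<in> R" for x
    proof (rule ccontr)
      assume "\<not> ?thesis"
      then have "s / m \<le> \<bar>Y x b\<bar> / m" unfolding wu Y_def using m0 by (intro divide_right_mono) auto
      then have "1 \<le> exp (- s / m) * exp (\<bar>Y x b / m\<bar>)" using m0 by (simp add: exp_add[symmetric])
      also have "... \<le> exp (- s / m) * (exp (Y x b / m) + exp (- Y x b / m))"
        using exp_abs_le[of "Y x b / m"] by (intro mult_left_mono) auto
      also have "... \<le> P b" unfolding P_def using R that
        by (intro member_le_sum) (auto intro!: add_nonneg_nonneg)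
      finally show False using P1 by simp
    qed
    show "conc n s w \<le> 18 * conc n s u" using cw D1 by simp
    show "conc n s u \<le> 18 * conc n s w"
    proof -
      \<comment> \<open>The reverse comparison follows from the first by Cauchy-Schwarz: if the mass
        of \<open>a\<close> stays bounded under the factors
        \<open>exp (\<bar>Y x b\<bar> / m)\<close>, it cannot be lost under their inverses.\<close>
      have "(\<Sum>x\<in>signs n. a x)\<^sup>2 = (\<Sum>x\<in>signs n. sqrt (a x * exp (\<bar>Y x b\<bar> / m)) * sqrt (a x * exp (- \<bar>Y x b\<bar> / m)))\<^sup>2"
        using a0 by (simp add: real_sqrt_mult[symmetric] mult_ac exp_minus less_imp_le)
      also have "... \<le> (\<Sum>x\<in>signs n. (sqrt (a x * exp (\<bar>Y x b\<bar> / m)))\<^sup>2) * (\<Sum>x\<in>signs n. (sqrt (a x * exp (- \<bar>Y x b\<bar> / m)))\<^sup>2)"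
        by (rule Cauchy_Schwarz_ineq_sum)
      also have "... = (\<Sum>x\<in>signs n. a x * exp (\<bar>Y x b\<bar> / m)) * (\<Sum>x\<in>signs n. a x * exp (- \<bar>Y x b\<bar> / m))"
        using a0 by (simp add: less_imp_le)
      also have "... \<le> (2^n * (18 * conc n s u)) * (2^n * conc n s w)"
      proof (intro mult_mono)
        show "(\<Sum>x\<in>signs n. a x * exp (\<bar>Y x b\<bar> / m)) \<le> 2 ^ n * (18 * conc n s u)"
          using D1 by (simp add: D_def field_simps)
        show "(\<Sum>x\<in>signs n. a x * exp (- \<bar>Y x b\<bar> / m)) \<le> 2 ^ n * conc n s w"
          using lo by (simp add: conc_def sum_mono)
      qed (use a0 conc_pos[of n s u] in \<open>auto intro!: sum_nonneg mult_nonneg_nonneg intro: less_imp_le\<close>)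
      finally have "(2^n * conc n s u)\<^sup>2 \<le> (2^n * (18 * conc n s u)) * (2^n * conc n s w)"
        by (simp add: c_a)
      then have "(2^n)\<^sup>2 * conc n s u * conc n s u \<le> (2^n)\<^sup>2 * conc n s u * (18 * conc n s w)"
        by (simp add: power2_eq_square mult_ac)
      then show ?thesis using conc_pos[of n s u] by (simp add: mult_le_cancel_left)
    qed
    show "(\<Sum>i\<in>T. \<bar>w i\<bar>) \<le> 4 * (\<Sum>i\<in>T. \<bar>u i\<bar>) + 1"
      using S1 by (simp add: S_def w_def U_def)
  qed
qed

subsection \<open>Fourier bound for the concentration\<close>

lemma cos_ge_quadratic: "cos x \<ge> 1 - x\<^sup>2 / 2" for x :: real
proof -
  have "cos x = 1 - 2 * (sin (x/2))\<^sup>2" using cos_double_sin[of "x/2"] by simp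
  moreover have "(sin (x/2))\<^sup>2 \<le> (x/2)\<^sup>2"
    using abs_sin_x_le_abs_x[of "x/2"] abs_le_square_iff by blast
  ultimately show ?thesis by (simp add: power_divide)
qed

lemma cos_ge_half: "\<bar>x\<bar> \<le> 1 \<Longrightarrow> cos x \<ge> 1/2" for x :: real
  using cos_ge_quadratic[of x] abs_le_square_iff[of x 1] by simp

lemma sum_signs_cis:
  "(\<Sum>x\<in>signs n. cis (t * ip n x w)) = (\<Prod>i<n. complex_of_real (2 * cos (t * w i)))"
proof -
  have "(\<Sum>x\<in>signs n. cis (t * ip n x w)) = (\<Sum>x\<in>signs n. \<Prod>i<n. cis (t * (x i * w i)))"
    by (simp add: ip_def sum_distrib_left cis_conv_exp exp_sum)
  also have "... = (\<Prod>i<n. \<Sum>b\<in>{-1,1}. cis (t * (b * w i)))"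
    unfolding signs_def by (subst prod_sum_PiE) auto
  also have "... = (\<Prod>i<n. complex_of_real (2 * cos (t * w i)))"
    by (intro prod.cong refl) (auto simp: complex_eq_iff)
  finally show ?thesis .
qed

lemma norm_sum_cis_ge:
  assumes "\<bar>z\<bar> * Q \<le> 1"
  shows "norm (\<Sum>b<Q. cis (of_nat b * z)) \<ge> Q / 2"
proof -
  have "real Q / 2 = (\<Sum>b<Q. 1/2)" by simp
  also have "... \<le> (\<Sum>b<Q. cos (of_nat b * z))"
  proof (intro sum_mono cos_ge_half)
    fix b assume "b \<in> {..<Q}"
    then have "\<bar>real b * z\<bar> \<le> real Q * \<bar>z\<bar>" by (simp add: abs_mult mult_right_mono)
    then show "\<bar>real b * z\<bar> \<le> 1" using assms by (simp add: mult.commute)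
  qed
  also have "... = Re (\<Sum>b<Q. cis (of_nat b * z))" by simp
  also have "... \<le> norm (\<Sum>b<Q. cis (of_nat b * z))" by (rule complex_Re_le_cmod)
  finally show ?thesis .
qed

lemma norm_sum_cis_square:
  "complex_of_real ((norm (\<Sum>b<Q. cis (of_nat b * z)))\<^sup>2) = (\<Sum>b<Q. \<Sum>b'<Q. cis (of_int (int b - int b') * z))"
  by (simp only: complex_norm_square cnj_sum sum_product cis_cnj cis_mult)
     (simp add: left_diff_distrib)

lemma sum_diff_le:
  fixes h :: "int \<Rightarrow> real"
  assumes "\<And>k. h k \<ge> 0"
  shows "(\<Sum>b<Q. \<Sum>b'<Q. h (int b - int b')) \<le> Q * (\<Sum>k\<in>{-int Q<..<int Q}. h k)"
proof -
  have "(\<Sum>b'<Q. h (int b - int b')) \<le> (\<Sum>k\<in>{-int Q<..<int Q}. h k)" if "b < Q" for b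
  proof -
    have "(\<Sum>b'<Q. h (int b - int b')) = sum h ((\<lambda>b'. int b - int b') ` {..<Q})"
      by (subst sum.reindex) (auto simp: inj_on_def)
    also have "... \<le> (\<Sum>k\<in>{-int Q<..<int Q}. h k)"
      using that assms by (intro sum_mono2) auto
    finally show ?thesis .
  qed
  then have "(\<Sum>b<Q. \<Sum>b'<Q. h (int b - int b')) \<le> (\<Sum>b<Q. \<Sum>k\<in>{-int Q<..<int Q}. h k)"
    by (intro sum_mono) auto
  then show ?thesis by simp
qed

text \<open>Esseen's inequality in discrete form: on the window the squared exponential sum is at
  least \<open>(Q / 2)^2\<close>, and expanding it produces only integer multiples of
  \<open>a\<close> as frequencies. That these form a finite set is what allows frequency tuples to
  be counted later. The shift \<open>y\<close> contributes a phase of modulus 1.\<close>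

lemma levy_fourier:
  fixes w :: "nat \<Rightarrow> real" and a s y :: real and Q :: nat
  assumes Q: "Q \<ge> 1" and a: "a \<ge> 0" "a * Q * s \<le> 1"
  shows "card {x \<in> signs n. \<bar>ip n x w - y\<bar> \<le> s} \<le>
    2 ^ n * ((4 / Q) * (\<Sum>k\<in>{-int Q<..<int Q}. \<Prod>i<n. \<bar>cos (a * k * w i)\<bar>))"
proof -
  let ?A = "{x \<in> signs n. \<bar>ip n x w - y\<bar> \<le> s}"
  define N where "N = (\<lambda>x. (norm (\<Sum>b<Q. cis (of_nat b * (a * (ip n x w - y)))))\<^sup>2)"
  define h where "h = (\<lambda>k::int. \<Prod>i<n. \<bar>cos (a * k * w i)\<bar>)"
  have h0: "h k \<ge> 0" for k by (simp add: h_def prod_nonneg)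
  have "(\<Sum>x\<in>?A. (real Q / 2)\<^sup>2) \<le> (\<Sum>x\<in>?A. N x)"
    unfolding N_def
  proof (intro sum_mono power_mono norm_sum_cis_ge)
    fix x assume "x \<in> ?A"
    then have "\<bar>a * (ip n x w - y)\<bar> * real Q \<le> a * s * real Q"
      using a by (simp add: abs_mult mult_left_mono mult_right_mono)
    also have "... \<le> 1" using a by (simp add: mult_ac)
    finally show "\<bar>a * (ip n x w - y)\<bar> * real Q \<le> 1" .
  qed auto
  also have "... \<le> (\<Sum>x\<in>signs n. N x)" by (intro sum_mono2) (auto simp: N_def)
  also have "... = Re (\<Sum>x\<in>signs n. complex_of_real (N x))" by simp
  also have "(\<Sum>x\<in>signs n. complex_of_real (N x)) =
      (\<Sum>x\<in>signs n. \<Sum>b<Q. \<Sum>b'<Q. cis (of_int (int b - int b') * (a * (ip n x w - y))))"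
    by (simp only: N_def norm_sum_cis_square)
  also have "... = (\<Sum>b<Q. \<Sum>b'<Q. \<Sum>x\<in>signs n. cis (of_int (int b - int b') * (a * (ip n x w - y))))"
    by (subst sum.swap, intro sum.cong refl, subst sum.swap) auto
  also have "Re ... \<le> norm ..." by (rule complex_Re_le_cmod)
  also have "... \<le> (\<Sum>b<Q. \<Sum>b'<Q. 2 ^ n * h (int b - int b'))"
  proof (intro sum_norm_le)
    fix b b'
    define k where "k = int b - int b'"
    have "(\<Sum>x\<in>signs n. cis (k * (a * (ip n x w - y)))) =
        cis (- k * a * y) * (\<Sum>x\<in>signs n. cis (a * k * ip n x w))"
      by (simp add: sum_distrib_left cis_mult algebra_simps)
    also have "norm ... = 2 ^ n * h k"
      unfolding sum_signs_cis norm_mult norm_cis prod_norm[symmetric] norm_of_real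
      by (simp add: h_def abs_mult prod.distrib)
    finally show "norm (\<Sum>x\<in>signs n. cis (of_int (int b - int b') * (a * (ip n x w - y)))) \<le> 2 ^ n * h (int b - int b')"
      by (simp add: k_def)
  qed
  also have "... = 2 ^ n * (\<Sum>b<Q. \<Sum>b'<Q. h (int b - int b'))" by (simp add: sum_distrib_left)
  also have "... \<le> 2 ^ n * (Q * (\<Sum>k\<in>{-int Q<..<int Q}. h k))"
    by (intro mult_left_mono sum_diff_le h0) auto
  finally have "card ?A * (real Q)\<^sup>2 \<le> Q * (4 * 2 ^ n * (\<Sum>k\<in>{-int Q<..<int Q}. h k))"
    by (simp add: power_divide mult_ac)
  then have "card ?A * real Q \<le> 4 * 2 ^ n * (\<Sum>k\<in>{-int Q<..<int Q}. h k)"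
    using Q by (simp add: power2_eq_square mult_le_cancel_left)
  then have "card ?A \<le> (4 * 2 ^ n * (\<Sum>k\<in>{-int Q<..<int Q}. h k)) / Q"
    using Q by (simp add: pos_le_divide_eq)
  then show ?thesis by (simp add: h_def mult_ac)
qed

text \<open>The exponential kernel is dominated by a geometric sum of windows centred at the
  multiples of \<open>s\<close>, and \<open>levy_fourier\<close> is uniform in the centre. The
  constant 16 is 4 times 2 for the geometric series times 2 for the sign of the centre.\<close>

lemma conc_fourier:
  fixes w :: "nat \<Rightarrow> real" and a s :: real and Q :: nat
  assumes Q: "Q \<ge> 1" and a: "a \<ge> 0" "a * Q * s \<le> 1" and s: "s > 0"
  shows "conc n s w \<le> (16 / Q) * (\<Sum>k\<in>{-int Q<..<int Q}. \<Prod>i<n. \<bar>cos (a * k * w i)\<bar>)"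
proof -
  define X where "X = 2 ^ n * ((4 / Q) * (\<Sum>k\<in>{-int Q<..<int Q}. \<Prod>i<n. \<bar>cos (a * k * w i)\<bar>))"
  define L where "L = (\<lambda>y. {x \<in> signs n. \<bar>ip n x w - y\<bar> \<le> s})"
  have L: "real (card (L y)) \<le> X" for y
    unfolding L_def X_def by (rule levy_fourier[OF Q a])
  define J where "J = Suc (Max ((\<lambda>x. nat \<lfloor>\<bar>ip n x w\<bar> / s\<rfloor>) ` signs n))"
  have J: "nat \<lfloor>\<bar>ip n x w\<bar> / s\<rfloor> < J" if "x \<in> signs n" for x
    using that by (simp add: J_def le_imp_less_Suc)
  have e2: "exp (-1::real) \<le> 1/2"
    using exp_ge_add_one_self[of 1] by (simp add: exp_minus field_simps)
  have pt: "exp (- \<bar>ip n x w\<bar> / s) \<le>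
      (\<Sum>j<J. (1/2) ^ j * (of_bool (x \<in> L (j * s)) + of_bool (x \<in> L (- (j * s)))))"
    if x: "x \<in> signs n" for x
  proof -
    define j where "j = nat \<lfloor>\<bar>ip n x w\<bar> / s\<rfloor>"
    have j: "j < J" using J x by (simp add: j_def)
    have t1: "real j \<le> \<bar>ip n x w\<bar> / s" using s by (simp add: j_def)
    have "real j = of_int \<lfloor>\<bar>ip n x w\<bar> / s\<rfloor>" using s by (simp add: j_def)
    then have t2: "\<bar>ip n x w\<bar> / s < j + 1" by linarith
    note t = t1 t2
    then have t': "j * s \<le> \<bar>ip n x w\<bar>" "\<bar>ip n x w\<bar> \<le> j * s + s" using s by (auto simp: field_simps)
    have "exp (- \<bar>ip n x w\<bar> / s) \<le> exp (- real j)" using t by simp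
    also have "... = exp (-1) ^ j" by (simp add: exp_of_nat_mult[symmetric])
    also have "... \<le> (1/2) ^ j" using e2 by (intro power_mono) auto
    also have "... \<le> (1/2) ^ j * (of_bool (x \<in> L (j * s)) + of_bool (x \<in> L (- (j * s))))"
    proof -
      have "x \<in> L (j * s) \<or> x \<in> L (- (j * s))"
        using t' x by (cases "ip n x w \<ge> 0") (auto simp: L_def)
      then show ?thesis by auto
    qed
    also have "... \<le> (\<Sum>j<J. (1/2) ^ j * (of_bool (x \<in> L (j * s)) + of_bool (x \<in> L (- (j * s)))))"
      using j by (intro member_le_sum) auto
    finally show ?thesis .
  qed
  have cardL: "(\<Sum>x\<in>signs n. of_bool (x \<in> L y)) = real (card (L y))" for y
    by (simp add: L_def Int_def)
  have "(\<Sum>x\<in>signs n. exp (- \<bar>ip n x w\<bar> / s)) \<le>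
      (\<Sum>x\<in>signs n. \<Sum>j<J. (1/2) ^ j * (of_bool (x \<in> L (j * s)) + of_bool (x \<in> L (- (j * s)))))"
    by (intro sum_mono pt)
  also have "... = (\<Sum>j<J. (1/2) ^ j * (real (card (L (j * s))) + real (card (L (- (j * s))))))"
    by (subst sum.swap) (simp add: sum_distrib_left[symmetric] sum.distrib cardL)
  also have "... \<le> (\<Sum>j<J. (1/2) ^ j * (X + X))"
    by (intro sum_mono mult_left_mono add_mono L) auto
  also have "... = (\<Sum>j<J. (1/2) ^ j) * (2 * X)" by (simp add: sum_distrib_right)
  also have "... \<le> 2 * (2 * X)"
  proof (intro mult_right_mono)
    show "(\<Sum>j<J. (1/2) ^ j) \<le> (2::real)" by (simp add: sum_gp_strict)
    show "0 \<le> 2 * X" unfolding X_def by (intro mult_nonneg_nonneg sum_nonneg prod_nonneg) auto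
  qed
  finally have "conc n s w \<le> 2 * (2 * X) / 2 ^ n"
    unfolding conc_def by (intro divide_right_mono) auto
  also have "... = (16 / Q) * (\<Sum>k\<in>{-int Q<..<int Q}. \<Prod>i<n. \<bar>cos (a * k * w i)\<bar>)"
    by (simp add: X_def)
  finally show ?thesis .
qed

section \<open>Decay of cosine products at low frequencies\<close>

lemma sin_ge_half:
  fixes x :: real assumes "0 \<le> x" "x \<le> 1" shows "sin x \<ge> x / 2"
proof -
  have "sin 0 - 0 / 2 \<le> sin x - x / 2"
    using assms
  proof (intro DERIV_nonneg_imp_nondecreasing[of 0 x "\<lambda>x. sin x - x / 2"])
    fix y assume "0 \<le> y" "y \<le> x"
    then have "cos y \<ge> 1/2" using assms by (intro cos_ge_half) auto
    moreover have "((\<lambda>x. sin x - x / 2) has_real_derivative cos y - 1/2) (at y)"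
      by (auto intro!: derivative_eq_intros)
    ultimately show "\<exists>D. ((\<lambda>x. sin x - x / 2) has_real_derivative D) (at y) \<and> 0 \<le> D" by force
  qed auto
  then show ?thesis by simp
qed

lemma abs_cos_le_exp:
  fixes x \<delta> :: real
  assumes "\<delta> \<le> \<bar>x\<bar>" "\<bar>x\<bar> \<le> 1" "\<delta> \<ge> 0"
  shows "\<bar>cos x\<bar> \<le> exp (- \<delta>\<^sup>2 / 8)"
proof -
  have "\<delta> / 2 \<le> sin \<bar>x\<bar>" using sin_ge_half[of "\<bar>x\<bar>"] assms by simp
  then have "(\<delta> / 2)\<^sup>2 \<le> (sin \<bar>x\<bar>)\<^sup>2" using assms by (intro power_mono) auto
  also have "... = 1 - (cos x)\<^sup>2" by (simp add: sin_squared_eq)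
  finally have "(cos x)\<^sup>2 \<le> 1 - \<delta>\<^sup>2 / 4" by (simp add: power_divide)
  also have "... \<le> exp (- \<delta>\<^sup>2 / 4)" using exp_ge_add_one_self[of "- \<delta>\<^sup>2 / 4"] by simp
  also have "... = (exp (- \<delta>\<^sup>2 / 8))\<^sup>2" by (simp add: power2_eq_square flip: exp_add)
  finally have "\<bar>cos x\<bar> \<le> \<bar>exp (- \<delta>\<^sup>2 / 8)\<bar>" using abs_le_square_iff by blast
  then show ?thesis by simp
qed

lemma prod_cos_near:
  fixes n :: nat and x :: "nat \<Rightarrow> real" and \<delta> :: real
  assumes I: "I \<subseteq> {..<n}" "\<And>i. i \<in> I \<Longrightarrow> \<delta> \<le> \<bar>x i\<bar> \<and> \<bar>x i\<bar> \<le> 1" "\<delta> \<ge> 0"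
  shows "(\<Prod>i<n. \<bar>cos (x i)\<bar>) \<le> exp (- (card I * \<delta>\<^sup>2 / 8))"
proof -
  have "(\<Prod>i<n. \<bar>cos (x i)\<bar>) = (\<Prod>i\<in>I. \<bar>cos (x i)\<bar>) * (\<Prod>i\<in>{..<n}-I. \<bar>cos (x i)\<bar>)"
    using I(1) prod.subset_diff[of I "{..<n}" "\<lambda>i. \<bar>cos (x i)\<bar>"] by (simp add: mult.commute)
  also have "... \<le> (\<Prod>i\<in>I. exp (- \<delta>\<^sup>2 / 8)) * 1"
  proof (rule mult_mono)
    show "(\<Prod>i\<in>I. \<bar>cos (x i)\<bar>) \<le> (\<Prod>i\<in>I. exp (- \<delta>\<^sup>2 / 8))"
    proof (intro prod_mono conjI)
      fix i assume "i \<in> I"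
      then show "\<bar>cos (x i)\<bar> \<le> exp (- \<delta>\<^sup>2 / 8)" using I by (intro abs_cos_le_exp) auto
    qed auto
    show "(\<Prod>i\<in>{..<n} - I. \<bar>cos (x i)\<bar>) \<le> 1" by (intro prod_le_1) auto
  qed (auto intro: prod_nonneg)
  finally show ?thesis by (simp add: exp_of_nat_mult[symmetric])
qed

subsection \<open>A Littlewood--Offord bound\<close>

text \<open>The identity \<open>(n - card A) * (n choose card A) = n * ((n - 1) choose card
  A)\<close> spreads the weight of \<open>A\<close> evenly over the points \<open>t\<close> outside
  \<open>A\<close>. Averaging over \<open>t\<close> reduces the claim to antichains in
  \<open>T - {t}\<close>; an antichain containing \<open>T\<close> has no other member and is set
  apart.\<close>

lemma lym_inequality:
  assumes "finite T" "F \<subseteq> Pow T" "\<And>A B. A \<in> F \<Longrightarrow> B \<in> F \<Longrightarrow> A \<subseteq> B \<Longrightarrow> A = B"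
  shows "(\<Sum>A\<in>F. 1 / real (card T choose card A)) \<le> 1"
  using assms
proof (induction "card T" arbitrary: T F)
  case 0
  then have "T = {}" by simp
  then have "F = {} \<or> F = {{}}" using 0(3) by (auto simp: subset_singleton_iff)
  then show ?case using \<open>T = {}\<close> by auto
next
  case (Suc k)
  have finF: "finite F" using Suc(3,4) finite_subset by blast
  show ?case
  proof (cases "T \<in> F")
    case True
    then have "F = {T}" using Suc(4,5) by blast
    then show ?thesis by simp
  next
    case False
    then have sub: "A \<subset> T" if "A \<in> F" for A using Suc(4) that by blast
    define n where "n = card T"
    have n: "n = Suc k" using Suc(2) by (simp add: n_def)
    have eq: "1 / real (n choose card A) = (1 / n) * (\<Sum>t\<in>T. if t \<notin> A then 1 / real (k choose card A) else 0)"
      if "A \<in> F" for A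
    proof -
      have fA: "finite A" and lt: "card A < n"
        using sub[OF that] Suc(3) by (auto simp: n_def intro: finite_subset psubset_card_mono)
      have "(\<Sum>t\<in>T. if t \<notin> A then 1 / real (k choose card A) else 0) = (\<Sum>t\<in>T - A. 1 / real (k choose card A))"
        using Suc(3) by (simp add: sum.If_cases Diff_eq Collect_neg_eq)
      also have "... = real (n - card A) / real (k choose card A)"
        using sub[OF that] fA Suc(3) by (simp add: n_def card_Diff_subset psubset_imp_subset)
      finally have s: "(\<Sum>t\<in>T. if t \<notin> A then 1 / real (k choose card A) else 0) = real (n - card A) / real (k choose card A)" .
      have "(n - card A) * (n choose card A) = n * (k choose card A)"
        using binomial_absorb_comp[of n "card A"] n by simp
      then have "real (n - card A) * real (n choose card A) = real n * real (k choose card A)"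
        by (metis of_nat_mult)
      moreover have pos: "k choose card A > 0" "n choose card A > 0" using lt n by auto
      ultimately have "real (n - card A) = real n * real (k choose card A) / real (n choose card A)"
        by (subst nonzero_eq_divide_eq) auto
      then show ?thesis unfolding s using n pos by simp
    qed
    have "(\<Sum>A\<in>F. 1 / real (n choose card A)) =
        (1 / n) * (\<Sum>A\<in>F. \<Sum>t\<in>T. if t \<notin> A then 1 / real (k choose card A) else 0)"
      by (simp add: eq sum_distrib_left)
    also have "... = (1 / n) * (\<Sum>t\<in>T. \<Sum>A\<in>F. if t \<notin> A then 1 / real (k choose card A) else 0)"
      by (subst sum.swap) simp
    also have "... \<le> (1 / n) * (\<Sum>t\<in>T. 1)"
    proof (intro mult_left_mono sum_mono)
      fix t assume t: "t \<in> T"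
      have c: "card (T - {t}) = k" using t Suc(2,3) by simp
      have "(\<Sum>A\<in>F. if t \<notin> A then 1 / real (k choose card A) else 0) =
          (\<Sum>A\<in>{A\<in>F. t \<notin> A}. 1 / real (k choose card A))"
        using finF by (simp add: sum.inter_filter)
      also have "... = (\<Sum>A\<in>{A\<in>F. t \<notin> A}. 1 / real (card (T - {t}) choose card A))"
        by (simp add: c)
      also have "... \<le> 1"
      proof (rule Suc(1))
        show "A = B" if "A \<in> {A \<in> F. t \<notin> A}" "B \<in> {A \<in> F. t \<notin> A}" "A \<subseteq> B" for A B
          using Suc(5) that by blast
      qed (use Suc(3,4) c in auto)
      finally show "(\<Sum>A\<in>F. if t \<notin> A then 1 / real (k choose card A) else 0) \<le> 1" .
    qed simp
    also have "... = 1" using n by (simp add: n_def)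
    finally show ?thesis by (simp add: n_def)
  qed
qed

lemma sperner:
  assumes "finite T" "F \<subseteq> Pow T" "\<And>A B. A \<in> F \<Longrightarrow> B \<in> F \<Longrightarrow> A \<subseteq> B \<Longrightarrow> A = B"
  shows "card F \<le> card T choose (card T div 2)"
proof -
  define c where "c = card T choose (card T div 2)"
  have c: "c > 0" by (simp add: c_def)
  have "(\<Sum>A\<in>F. 1 / real c) \<le> (\<Sum>A\<in>F. 1 / real (card T choose card A))"
  proof (intro sum_mono divide_left_mono)
    fix A assume "A \<in> F"
    then have "card A \<le> card T" using assms by (auto intro: card_mono)
    then show "0 < real c * real (card T choose card A)" using c by simp
    show "real (card T choose card A) \<le> real c" by (simp add: c_def binomial_maximum)
  qed simp
  also have "... \<le> 1" by (rule lym_inequality[OF assms])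
  finally have "real (card F) \<le> real c" using c by (simp add: field_simps)
  then show ?thesis by (simp add: c_def)
qed

text \<open>Consecutive central binomials have quotient \<open>2 * (2 * k + 1) / (k + 1)\<close>, so
  after squaring the induction step is
  \<open>(2 * k + 1) * (2 * k + 3) \<le> 4 * (k + 1)^2\<close>.\<close>

lemma central_binomial_le: "real ((2 * k) choose k) * sqrt (2 * k + 1) \<le> 4 ^ k"
proof (induction k)
  case (Suc k)
  define C where "C = real ((2 * k) choose k)"
  have "Suc k * ((2 * Suc k) choose (Suc k)) = 2 * (2 * k + 1) * ((2 * k) choose k)"
  proof -
    have "Suc k * ((2 * Suc k) choose (Suc k)) = (2 * Suc k) * ((2 * k + 1) choose k)"
      using Suc_times_binomial[of k "2 * k + 1"] by simp
    moreover have "(2 * k + 1) choose k = (2 * k + 1) choose (Suc k)"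
      using binomial_symmetric[of k "2 * k + 1"] by simp
    moreover have "Suc k * ((2 * k + 1) choose (Suc k)) = (2 * k + 1) * ((2 * k) choose k)"
      using Suc_times_binomial[of k "2 * k"] by simp
    ultimately show ?thesis by (metis mult.assoc mult.left_commute)
  qed
  then have "real (Suc k) * real ((2 * Suc k) choose (Suc k)) = 2 * (2 * k + 1) * C"
    unfolding C_def by (metis of_nat_mult of_nat_numeral)
  then have e: "real ((2 * Suc k) choose (Suc k)) = 2 * (2 * k + 1) / (k + 1) * C"
    by (simp add: field_simps)
  have r: "2 * (2 * k + 1) / (k + 1) * sqrt (2 * k + 3) \<le> 4 * sqrt (2 * k + 1)"
  proof (rule power2_le_imp_le)
    have "(2 * real k + 1) * (2 * k + 3) \<le> 4 * (k + 1)\<^sup>2"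
      by (simp add: power2_eq_square algebra_simps)
    then have "4 * (2 * real k + 1) * ((2 * real k + 1) * (2 * k + 3)) \<le> 4 * (2 * real k + 1) * (4 * (k + 1)\<^sup>2)"
      by (intro mult_left_mono) auto
    then have "(2 * (2 * real k + 1))\<^sup>2 * (2 * k + 3) / (k + 1)\<^sup>2 \<le> 16 * (2 * k + 1)"
      by (subst pos_divide_le_eq, simp) (simp add: power2_eq_square algebra_simps)
    then show "(2 * (2 * k + 1) / (k + 1) * sqrt (2 * k + 3))\<^sup>2 \<le> (4 * sqrt (2 * k + 1))\<^sup>2"
      by (simp add: power_mult_distrib power_divide add.commute)
  qed simp
  have "real ((2 * Suc k) choose (Suc k)) * sqrt (2 * Suc k + 1) =
      C * (2 * (2 * k + 1) / (k + 1) * sqrt (2 * k + 3))"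
    unfolding e by (simp add: add_ac)
  also have "... \<le> C * (4 * sqrt (2 * k + 1))" by (rule mult_left_mono[OF r]) (simp add: C_def)
  also have "... \<le> 4 * 4 ^ k" using Suc by (simp add: C_def)
  finally show ?case by simp
qed simp

lemma middle_binomial_le: "real (m choose (m div 2)) / 2 ^ m \<le> sqrt (1 / (m + 1))"
proof -
  have ev: "real ((2 * k) choose k) / 2 ^ (2 * k) \<le> sqrt (1 / (2 * k + 1))" for k
  proof -
    have "(2::real) ^ (2 * k) = 4 ^ k" by (simp add: power_mult)
    then show ?thesis using central_binomial_le[of k]
      by (simp add: real_sqrt_divide pos_divide_le_eq pos_le_divide_eq add.commute)
  qed
  show ?thesis
  proof (cases "even m")
    case True
    then obtain k where "m = 2 * k" by (elim evenE)
    then show ?thesis using ev[of k] by simp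
  next
    case False
    then obtain k where m: "m = 2 * k + 1" by (elim oddE)
    \<comment> \<open>By Pascal's rule a middle binomial of odd order is half of the next central
      one, so the two agree after normalisation.\<close>
    have "(2 * k + 1) choose (Suc k) = (2 * k + 1) choose k"
      using binomial_symmetric[of k "2 * k + 1"] by simp
    then have "(2 * Suc k) choose Suc k = 2 * ((2 * k + 1) choose k)" by simp
    then have "real ((2 * k + 1) choose k) / 2 ^ (2 * k + 1) = real ((2 * Suc k) choose Suc k) / 2 ^ (2 * Suc k)"
      by simp
    also have "... \<le> sqrt (1 / (2 * Suc k + 1))" using ev[of "Suc k"] by (simp add: add.commute)
    also have "... \<le> sqrt (1 / (m + 1))" using m by (simp add: field_simps)
    finally show ?thesis using m by simp
  qed
qed

text \<open>The probability that \<open>y\<close> plus \<open>m\<close> independent steps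
  \<open>\<plusminus> z i\<close> ends in [0, L). The recursion consumes the last step, so a lazy
  step found to be nonzero can be appended as step \<open>m\<close>.\<close>

fun sign_window :: "real \<Rightarrow> (nat \<Rightarrow> real) \<Rightarrow> nat \<Rightarrow> real \<Rightarrow> real" where
  "sign_window L z 0 y = of_bool (0 \<le> y \<and> y < L)"
| "sign_window L z (Suc m) y = (sign_window L z m (y + z m) + sign_window L z m (y - z m)) / 2"

lemma sign_window_cong: "(\<And>i. i < m \<Longrightarrow> z i = z' i) \<Longrightarrow> sign_window L z m y = sign_window L z' m y"
  by (induction m arbitrary: y) auto

lemma sign_window_abs: "sign_window L (\<lambda>i. \<bar>z i\<bar>) m y = sign_window L z m y"
  by (induction m arbitrary: y) (auto simp: abs_if)

lemma sign_window_card: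
  "sign_window L z m y = card {A \<in> Pow {..<m}. 0 \<le> y - (\<Sum>i<m. z i) + 2 * (\<Sum>i\<in>A. z i) \<and>
      y - (\<Sum>i<m. z i) + 2 * (\<Sum>i\<in>A. z i) < L} / 2 ^ m"
proof (induction m arbitrary: y)
  case 0
  show ?case by (cases "0 \<le> y \<and> y < L") (auto simp: conj_commute Collect_conv_if)
next
  case (Suc m)
  define P where "P = (\<lambda>m y A. 0 \<le> y - (\<Sum>i<m. z i) + 2 * (\<Sum>i\<in>A. z i) \<and>
      y - (\<Sum>i<m. z i) + 2 * (\<Sum>i\<in>A. z i) < L)"
  have s: "(\<Sum>i\<in>insert m A. z i) = z m + (\<Sum>i\<in>A. z i)" if "A \<subseteq> {..<m}" for A
    using that by (subst sum.insert) (auto intro: finite_subset)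
  have "{A \<in> Pow {..<Suc m}. P (Suc m) y A} =
      {A \<in> Pow {..<m}. P m (y - z m) A} \<union> insert m ` {A \<in> Pow {..<m}. P m (y + z m) A}" (is "_ = ?A \<union> ?B")
  proof -
    have 1: "P (Suc m) y A \<longleftrightarrow> P m (y - z m) A" for A by (simp add: P_def algebra_simps)
    have 2: "P (Suc m) y (insert m A) \<longleftrightarrow> P m (y + z m) A" if "A \<subseteq> {..<m}" for A
      using s[OF that] by (simp add: P_def algebra_simps)
    show ?thesis unfolding lessThan_Suc Pow_insert using 1 2 by auto
  qed
  moreover have "card (?A \<union> ?B) = card ?A + card ?B" by (intro card_Un_disjoint) auto
  moreover have "card ?B = card {A \<in> Pow {..<m}. P m (y + z m) A}"
    by (intro card_image inj_onI) (auto simp: insert_ident)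
  ultimately have "card {A \<in> Pow {..<Suc m}. P (Suc m) y A} =
      card {A \<in> Pow {..<m}. P m (y - z m) A} + card {A \<in> Pow {..<m}. P m (y + z m) A}" by simp
  then show ?case using Suc[of "y + z m"] Suc[of "y - z m"] by (simp add: P_def add_divide_distrib)
qed

text \<open>Erdos' argument: with the steps made nonnegative, enlarging the set of plus signs moves
  the sum by at least \<open>2 * L\<close>, out of the window. So the sets that hit the window form
  an antichain, and Sperner's theorem applies.\<close>

lemma sign_window_le:
  assumes L: "L > 0" and z: "\<And>i. i < m \<Longrightarrow> \<bar>z i\<bar> \<ge> L"
  shows "sign_window L z m y \<le> sqrt (1 / (m + 1))"
proof -
  define t where "t = y - (\<Sum>i<m. \<bar>z i\<bar>)"
  define F where "F = {A \<in> Pow {..<m}. 0 \<le> t + 2 * (\<Sum>i\<in>A. \<bar>z i\<bar>) \<and> t + 2 * (\<Sum>i\<in>A. \<bar>z i\<bar>) < L}"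
  have "card F \<le> card {..<m} choose (card {..<m} div 2)"
  proof (rule sperner)
    fix A B assume AB: "A \<in> F" "B \<in> F" "A \<subseteq> B"
    show "A = B"
    proof (rule ccontr)
      assume "A \<noteq> B"
      then obtain i where i: "i \<in> B" "i \<notin> A" using AB by blast
      have fB: "finite B" using AB by (auto simp: F_def intro: finite_subset)
      have "(\<Sum>j\<in>A. \<bar>z j\<bar>) + L \<le> (\<Sum>j\<in>A. \<bar>z j\<bar>) + \<bar>z i\<bar>"
        using z[of i] AB i by (auto simp: F_def)
      also have "... = (\<Sum>j\<in>insert i A. \<bar>z j\<bar>)" using i AB fB by (subst sum.insert) (auto intro: finite_subset)
      also have "... \<le> (\<Sum>j\<in>B. \<bar>z j\<bar>)" using i AB fB by (intro sum_mono2) auto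
      finally show False using AB L by (auto simp: F_def)
    qed
  qed (auto simp: F_def)
  then have "real (card F) / 2 ^ m \<le> real (m choose (m div 2)) / 2 ^ m" by (simp add: divide_right_mono)
  also have "... \<le> sqrt (1 / (m + 1))" using middle_binomial_le[of m] by (simp add: add.commute)
  also have "real (card F) / 2 ^ m = sign_window L z m y"
    using sign_window_card[of L "\<lambda>i. \<bar>z i\<bar>" m y] by (simp add: sign_window_abs F_def t_def)
  finally show ?thesis by (simp add: add.commute)
qed

text \<open>Expectation over independent steps that are \<open>0\<close> with probability \<open>3/4\<close> and \<open>\<plusminus>1\<close> with probability
  \<open>1/8\<close> each.\<close>

fun lazy_exp :: "nat \<Rightarrow> (int list \<Rightarrow> real) \<Rightarrow> real" where
  "lazy_exp 0 F = F []"
| "lazy_exp (Suc r) F = 3/4 * lazy_exp r (\<lambda>e. F (0 # e)) +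
     1/8 * lazy_exp r (\<lambda>e. F (1 # e)) + 1/8 * lazy_exp r (\<lambda>e. F ((-1) # e))"

fun dot :: "int list \<Rightarrow> int list \<Rightarrow> int" where
  "dot (e # es) (x # xs) = e * x + dot es xs"
| "dot _ _ = 0"

lemma lazy_exp_add: "lazy_exp r (\<lambda>e. F e + G e) = lazy_exp r F + lazy_exp r G"
  by (induction r arbitrary: F G) (auto simp: algebra_simps)

lemma lazy_exp_cmult: "lazy_exp r (\<lambda>e. c * F e) = c * lazy_exp r F"
  by (induction r arbitrary: F) (auto simp: algebra_simps)

lemma lazy_exp_sum: "lazy_exp r (\<lambda>e. \<Sum>a\<in>A. F a e) = (\<Sum>a\<in>A. lazy_exp r (F a))"
  by (induction r arbitrary: F) (auto simp: sum.distrib sum_distrib_left)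

lemma lazy_exp_mono:
  "(\<And>e. length e = r \<Longrightarrow> set e \<subseteq> {-1,0,1} \<Longrightarrow> F e \<le> G e) \<Longrightarrow> lazy_exp r F \<le> lazy_exp r G"
  by (induction r arbitrary: F G) (auto intro!: add_mono mult_left_mono)

lemma lazy_exp_const: "lazy_exp r (\<lambda>e. c) = c"
  by (induction r) (auto simp: algebra_simps)

lemma sqrt_jensen:
  assumes "a \<ge> 0" "b \<ge> 0"
  shows "3/4 * sqrt a + 1/4 * sqrt b \<le> sqrt (3/4 * a + 1/4 * b)"
proof (rule real_le_rsqrt)
  have "0 \<le> 3/16 * (sqrt a - sqrt b)\<^sup>2" by simp
  also have "... = 3/16 * (a + b - 2 * (sqrt a * sqrt b))"
    using assms by (simp add: power2_eq_square algebra_simps)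
  finally have "0 \<le> 3/16 * (a + b - 2 * (sqrt a * sqrt b))" .
  moreover have "(3/4 * sqrt a + 1/4 * sqrt b)\<^sup>2 = 9/16 * a + 1/16 * b + 6/16 * (sqrt a * sqrt b)"
    using assms by (simp add: power2_eq_square algebra_simps)
  ultimately show "(3/4 * sqrt a + 1/4 * sqrt b)\<^sup>2 \<le> 3/4 * a + 1/4 * b" by simp
qed

text \<open>Induction over the lazy steps, some of which have already been revealed as sign steps:
  with probability 3/4 the next step vanishes, otherwise it joins the \<open>m\<close> sign steps.
  In the bound a lazy step counts as an eighth of a sign step, half its expected share; the slack
  pays for the convexity of the reciprocal.\<close>

lemma lazy_littlewood_offord_aux:
  fixes y :: real and z :: "nat \<Rightarrow> real"
  assumes L: "L > 0" and "\<And>x. x \<in> set xs \<Longrightarrow> \<bar>real_of_int x\<bar> \<ge> L"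
    and "\<And>i. i < m \<Longrightarrow> \<bar>z i\<bar> \<ge> L"
  shows "lazy_exp (length xs) (\<lambda>e. sign_window L z m (y + dot e xs)) \<le> sqrt (8 / (8 * m + length xs + 8))"
  using assms(2,3)
proof (induction xs arbitrary: z m y)
  case Nil
  have "8 / (8 * real m + 8) = 1 / (m + 1)" by (simp add: field_simps)
  then show ?case using sign_window_le[where m = m and y = y and z = z, OF L Nil(2)] by (simp add: add.commute)
next
  case (Cons x xs)
  define r where "r = length xs"
  define z' where "z' = z(m := real_of_int x)"
  define W where "W = (\<lambda>y::real. lazy_exp r (\<lambda>e. sign_window L z m (y + dot e xs)))"
  have sw: "sign_window L z' (Suc m) u = (sign_window L z m (u + x) + sign_window L z m (u - x)) / 2" for u :: real
    using sign_window_cong[of m z' z L] by (simp add: z'_def)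
  have "lazy_exp r (\<lambda>e. sign_window L z' (Suc m) (y + dot e xs)) = (W (y + x) + W (y - x)) / 2"
  proof -
    have "lazy_exp r (\<lambda>e. sign_window L z' (Suc m) (y + dot e xs)) =
      lazy_exp r (\<lambda>e. 1/2 * sign_window L z m (y + x + dot e xs) + 1/2 * sign_window L z m (y - x + dot e xs))"
      by (simp only: sw) (simp add: add_divide_distrib algebra_simps)
    also have "... = 1/2 * W (y + x) + 1/2 * W (y - x)"
      by (simp only: lazy_exp_add lazy_exp_cmult W_def)
    finally show ?thesis by simp
  qed
  moreover have "lazy_exp r (\<lambda>e. sign_window L z' (Suc m) (y + dot e xs)) \<le> sqrt (8 / (8 * Suc m + r + 8))"
    unfolding r_def using Cons(2,3) by (intro Cons.IH) (auto simp: z'_def less_Suc_eq)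
  moreover have "W y \<le> sqrt (8 / (8 * m + r + 8))"
    unfolding r_def W_def using Cons(2,3) by (intro Cons.IH) auto
  moreover have "lazy_exp (length (x # xs)) (\<lambda>e. sign_window L z m (y + dot e (x # xs))) =
      3/4 * W y + 1/8 * W (y + x) + 1/8 * W (y - x)"
    by (simp add: W_def r_def algebra_simps)
  ultimately have "lazy_exp (length (x # xs)) (\<lambda>e. sign_window L z m (y + dot e (x # xs))) \<le>
      3/4 * sqrt (8 / (8 * m + r + 8)) + 1/4 * sqrt (8 / (8 * Suc m + r + 8))" by simp
  also have "... \<le> sqrt (3/4 * (8 / (8 * m + r + 8)) + 1/4 * (8 / (8 * Suc m + r + 8)))"
    by (rule sqrt_jensen) auto
  also have "... \<le> sqrt (8 / (8 * m + length (x # xs) + 8))"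
  proof -
    \<comment> \<open>With \<open>t\<close> for the new denominator, those of the two branches are
      \<open>t - 1\<close> and \<open>t + 7\<close>, and the comparison comes down to
      \<open>t \<ge> 7\<close>.\<close>
    define t where "t = 8 * real m + r + 9"
    have t: "t \<ge> 9" by (simp add: t_def)
    have pos: "t * t + 6 * t - 7 > 0" using t by (smt (verit) mult_nonneg_nonneg)
    then have ne: "t * t + t * 6 \<noteq> 7" by simp
    have "3/4 * (8 / (t - 1)) + 1/4 * (8 / (t + 7)) = 8 * (t + 5) / (t * t + 6 * t - 7)"
      using t ne by (simp add: divide_simps) (simp add: algebra_simps)
    also have "... \<le> 8 / t"
      using t pos by (simp add: divide_simps) (simp add: algebra_simps)
    finally show ?thesis by (simp add: t_def r_def algebra_simps)
  qed
  finally show ?case .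
qed

lemma lazy_littlewood_offord:
  assumes c: "c > 0" and K: "K > 0" and xs: "\<And>x. x \<in> set xs \<Longrightarrow> c * \<bar>x\<bar> \<ge> 2 * K"
  shows "lazy_exp (length xs) (\<lambda>e. of_bool (\<bar>c * dot e xs\<bar> < K)) \<le> sqrt (8 / (length xs + 8))"
proof -
  \<comment> \<open>The window of length \<open>2 * K / c\<close> around 0 is moved to [0, L) by
    starting at \<open>L / 2\<close>; the hypothesis on \<open>xs\<close> says that every step is at
    least one window long.\<close>
  define L where "L = 2 * real_of_int K / c"
  have L: "L > 0" using c K by (simp add: L_def)
  have "lazy_exp (length xs) (\<lambda>e. of_bool (\<bar>c * dot e xs\<bar> < K)) \<le>
      lazy_exp (length xs) (\<lambda>e. sign_window L (\<lambda>_. 0) 0 (L / 2 + dot e xs))"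
  proof (intro lazy_exp_mono)
    fix e
    have "0 \<le> L / 2 + dot e xs \<and> L / 2 + dot e xs < L" if h: "\<bar>c * dot e xs\<bar> < K"
    proof -
      have "\<bar>real_of_int c * dot e xs\<bar> < K" using h by (metis of_int_abs of_int_less_iff of_int_mult)
      then have "\<bar>real_of_int (dot e xs)\<bar> < K / c" using c by (simp add: abs_mult field_simps)
      then show ?thesis unfolding L_def by (simp add: abs_less_iff)
    qed
    then show "(of_bool (\<bar>c * dot e xs\<bar> < K) :: real) \<le> sign_window L (\<lambda>_. 0) 0 (L / 2 + dot e xs)" by simp
  qed
  also have "... \<le> sqrt (8 / (length xs + 8))"
  proof -
    have "L \<le> \<bar>real_of_int x\<bar>" if "x \<in> set xs" for x
    proof -
      have "real_of_int (2 * K) \<le> real_of_int (c * \<bar>x\<bar>)" using xs[OF that] of_int_le_iff by blast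
      then show ?thesis using c by (simp add: L_def field_simps)
    qed
    then show ?thesis using lazy_littlewood_offord_aux[OF L, of xs 0 "\<lambda>_. 0" "L / 2"] by simp
  qed
  finally show ?thesis .
qed

subsection \<open>Counting frequency tuples\<close>

text \<open>A lazy step of size \<open>x\<close> has characteristic function
  \<open>3/4 + 1/4 * cos (c * x)\<close>. The phase \<open>y\<close> is carried for the induction;
  the application has \<open>y = 0\<close>.\<close>

lemma lazy_exp_cos:
  fixes y c :: real
  shows
  "lazy_exp (length xs) (\<lambda>e. cos (y + c * dot e xs)) = cos y * (\<Prod>x\<leftarrow>xs. 3/4 + 1/4 * cos (c * real_of_int x))"
proof (induction xs arbitrary: y)
  case (Cons x xs)
  define P where "P = (\<Prod>x\<leftarrow>xs. 3/4 + 1/4 * cos (c * real_of_int x))"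
  have IH: "lazy_exp (length xs) (\<lambda>e. cos (y + c * dot e xs)) = cos y * P" for y :: real
    unfolding P_def by (rule Cons)
  have "lazy_exp (length (x # xs)) (\<lambda>e. cos (y + c * dot e (x # xs))) =
      3/4 * (cos y * P) + 1/8 * (cos (y + c * x) * P) + 1/8 * (cos (y - c * x) * P)"
    unfolding IH[symmetric] by (simp add: algebra_simps)
  also have "... = cos y * ((3/4 + 1/4 * cos (c * x)) * P)"
    by (simp add: cos_add cos_diff algebra_simps)
  finally show ?case by (simp add: P_def)
qed simp

lemma sum_power_lists:
  fixes f :: "'a \<Rightarrow> real"
  assumes "finite X"
  shows "(\<Sum>x\<in>X. f x) ^ r = (\<Sum>xs\<in>{xs. set xs \<subseteq> X \<and> length xs = r}. \<Prod>x\<leftarrow>xs. f x)"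
proof (induction r)
  case 0
  have "{xs. set xs \<subseteq> X \<and> length xs = 0} = {[]}" by auto
  then show ?case by simp
next
  case (Suc r)
  have "(\<Sum>xs\<in>{xs. set xs \<subseteq> X \<and> length xs = Suc r}. \<Prod>x\<leftarrow>xs. f x) =
      (\<Sum>(xs, x)\<in>{xs. set xs \<subseteq> X \<and> length xs = r} \<times> X. f x * (\<Prod>x\<leftarrow>xs. f x))"
    unfolding lists_length_Suc_eq by (subst sum.reindex) (auto simp: inj_on_def case_prod_unfold)
  also have "... = (\<Sum>x\<in>X. f x) * (\<Sum>xs\<in>{xs. set xs \<subseteq> X \<and> length xs = r}. \<Prod>x\<leftarrow>xs. f x)"
    by (simp add: sum.cartesian_product[symmetric] sum_distrib_left sum_distrib_right mult_ac)
  finally show ?case using Suc by simp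
qed

text \<open>Let \<open>E\<close> be the set of sign patterns \<open>e\<close> for which \<open>c * dot e xs\<close> is small. Read from the head, a
  coordinate is a pivot if two elements of \<open>E\<close> agree before it and differ at it; their difference \<open>d\<close>
  confines this entry of \<open>xs\<close> to a short interval once the later entries are known. At a non-pivot
  (\<open>None\<close>) the entry of \<open>xs\<close> is free, but then membership in \<open>E\<close> forces the value of the step, which
  costs a factor \<open>3/4\<close>. This replaces the rank of the linear span of \<open>E\<close>.\<close>

fun pivot_fit :: "int \<Rightarrow> int \<Rightarrow> int list option list \<Rightarrow> int list \<Rightarrow> bool" where
  "pivot_fit c K [] [] \<longleftrightarrow> True"
| "pivot_fit c K (None # ds) (x # xs) \<longleftrightarrow> pivot_fit c K ds xs"
| "pivot_fit c K (Some d # ds) (x # xs) \<longleftrightarrow>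
     d \<noteq> [] \<and> hd d \<noteq> 0 \<and> \<bar>c * dot d (x # xs)\<bar> < 2 * K \<and> pivot_fit c K ds xs"
| "pivot_fit c K _ _ \<longleftrightarrow> False"

text \<open>At a pivot only the tails of two sign patterns from there on are subtracted, so all
  lengths up to \<open>r\<close> occur, with entries between -2 and 2.\<close>

definition pivots :: "nat \<Rightarrow> int list option set" where
  "pivots r = insert None (Some ` {d. set d \<subseteq> {-2..2} \<and> length d \<le> r})"

definition pivot_lists :: "nat \<Rightarrow> int list option list set" where
  "pivot_lists r = {ds. set ds \<subseteq> pivots r \<and> length ds = r}"

definition nones :: "'a option list \<Rightarrow> nat" where
  "nones ds = length (filter (\<lambda>d. d = None) ds)"

lemma nones_simps [simp]:
  "nones [] = 0" "nones (None # ds) = Suc (nones ds)" "nones (Some d # ds) = nones ds"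
  by (simp_all add: nones_def)

lemma nones_le: "nones ds \<le> length ds"
  by (simp add: nones_def)

lemma finite_pivots: "finite (pivots r)"
  unfolding pivots_def using finite_lists_length_le[of "{-2..2::int}" r] by simp

lemma card_pivots: "card (pivots r) \<le> 5 ^ Suc r"
proof -
  have "card (pivots r) \<le> Suc (card {d. set d \<subseteq> {-2..2::int} \<and> length d \<le> r})"
    unfolding pivots_def
    by (intro order_trans[OF card_insert_le_m1] card_image_le finite_lists_length_le
        order_trans[OF card_insert_if[THEN eq_refl]]) (auto intro: card_image_le finite_lists_length_le le_SucI)
  also have "... = Suc (\<Sum>i\<le>r. 5 ^ i)" by (subst card_lists_length_le) auto
  also have "... \<le> 5 ^ Suc r" by (induction r) auto
  finally show ?thesis .
qed

lemma finite_pivot_lists: "finite (pivot_lists r)"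
  unfolding pivot_lists_def using finite_lists_length_eq[OF finite_pivots] by simp

lemma card_pivot_lists: "card (pivot_lists r) \<le> 5 ^ (Suc r * r)"
proof -
  have "card (pivot_lists r) = card (pivots r) ^ r"
    unfolding pivot_lists_def by (rule card_lists_length_eq[OF finite_pivots])
  also have "... \<le> (5 ^ Suc r) ^ r" by (intro power_mono card_pivots) auto
  finally show ?thesis by (simp only: power_mult)
qed

lemma dot_diff:
  "length a = length b \<Longrightarrow> dot (map2 (-) a b) xs = dot a xs - dot b xs"
proof (induction a b arbitrary: xs rule: list_induct2)
  case (Cons x a y b)
  then show ?case by (cases xs) (auto simp: algebra_simps)
qed auto

text \<open>The head is treated and the argument continues with the patterns sharing one head
  \<open>e\<close>; the common head cancels in differences, so the smallness hypothesis passes on.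
  If several heads occur, the most likely branch dominates the average; if only one occurs, that
  value of the lazy step has probability at most 3/4.\<close>

lemma pivot_exists:
  assumes "\<And>x y. E x \<Longrightarrow> E y \<Longrightarrow> \<bar>c * (dot x xs - dot y xs)\<bar> < 2 * K"
    and "\<And>x. E x \<Longrightarrow> length x = length xs \<and> set x \<subseteq> {-1,0,1}" and "length xs \<le> r"
  shows "\<exists>ds. length ds = length xs \<and> set ds \<subseteq> pivots r \<and> pivot_fit c K ds xs \<and>
    lazy_exp (length xs) (\<lambda>x. of_bool (E x)) \<le> (3/4) ^ nones ds"
  using assms
proof (induction xs arbitrary: E)
  case Nil
  then show ?case by (intro exI[of _ "[]"]) auto
next
  case (Cons x xs)
  define p where "p = (\<lambda>a. lazy_exp (length xs) (\<lambda>y. of_bool (E (a # y))))"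
  have "\<exists>ds. length ds = length xs \<and> set ds \<subseteq> pivots r \<and> pivot_fit c K ds xs \<and> p a \<le> (3/4) ^ nones ds" for a
    unfolding p_def
  proof (rule Cons.IH)
    fix y z assume "E (a # y)" "E (a # z)"
    then show "\<bar>c * (dot y xs - dot z xs)\<bar> < 2 * K" using Cons.prems(1)[of "a # y" "a # z"] by simp
  next
    fix y assume "E (a # y)"
    then show "length y = length xs \<and> set y \<subseteq> {-1,0,1}" using Cons.prems(2)[of "a # y"] by simp
  qed (use Cons.prems(3) in simp)
  then obtain D where D: "\<And>a. length (D a) = length xs" "\<And>a. set (D a) \<subseteq> pivots r"
    "\<And>a. pivot_fit c K (D a) xs" "\<And>a. p a \<le> (3/4) ^ nones (D a)" by metis
  have sum: "lazy_exp (length (x # xs)) (\<lambda>x. of_bool (E x)) = 3/4 * p 0 + 1/8 * p 1 + 1/8 * p (-1)"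
    by (simp add: p_def)
  show ?case
  proof (cases "\<exists>a b y z. a \<noteq> b \<and> E (a # y) \<and> E (b # z)")
    case True
    then obtain a b y z where ab: "a \<noteq> b" "E (a # y)" "E (b # z)" by blast
    define d where "d = map2 (-) (a # y) (b # z)"
    have len: "length (a # y) = length (x # xs)" "length (b # z) = length (x # xs)"
      using Cons.prems(2)[OF ab(2)] Cons.prems(2)[OF ab(3)] by auto
    have "set (map2 (-) u v) \<subseteq> {-2..2::int}" if "set u \<subseteq> {-1,0,1}" "set v \<subseteq> {-1,0,1}" for u v
      using that by (fastforce dest: set_zip_leftD set_zip_rightD)
    then have sd: "set d \<subseteq> {-2..2}" using Cons.prems(2) ab unfolding d_def by blast
    have dot: "dot d (x # xs) = dot (a # y) (x # xs) - dot (b # z) (x # xs)"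
      unfolding d_def using len by (intro dot_diff) simp
    obtain e where e: "p 0 \<le> p e" "p 1 \<le> p e" "p (-1) \<le> p e"
      by (metis linorder_le_cases order_trans)
    have "pivot_fit c K (Some d # D e) (x # xs)"
      using ab D(3) Cons.prems(1)[OF ab(2,3)] dot by (simp add: d_def)
    moreover have "Some d \<in> pivots r"
      using sd len Cons.prems(3) by (auto simp: pivots_def d_def)
    moreover have "lazy_exp (length (x # xs)) (\<lambda>x. of_bool (E x)) \<le> (3/4) ^ nones (Some d # D e)"
      using e D(4)[of e] unfolding sum by simp
    ultimately show ?thesis using D(1,2) by (intro exI[of _ "Some d # D e"]) auto
  next
    case False
    have z: "p a = 0" if "\<And>y. \<not> E (a # y)" for a
      unfolding p_def using that lazy_exp_const[of _ 0] by simp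
    obtain e where e: "\<And>a. a \<noteq> e \<Longrightarrow> p a = 0" using False z by metis
    have pnn: "p e \<ge> 0"
      using lazy_exp_mono[of "length xs" "\<lambda>_. 0" "\<lambda>y. of_bool (E (e # y))"]
      by (simp add: p_def lazy_exp_const)
    have "lazy_exp (length (x # xs)) (\<lambda>x. of_bool (E x)) \<le> 3/4 * p e"
      unfolding sum using e[of 0] e[of 1] e[of "-1"] pnn by (cases "e = 0"; cases "e = 1"; cases "e = -1") auto
    also have "... \<le> (3/4) ^ nones (None # D e)" using D(4)[of e] by simp
    finally show ?thesis using D(1-3) by (intro exI[of _ "None # D e"]) (auto simp: pivots_def)
  qed
qed

lemma card_int_interval_le:
  fixes S :: "int set"
  assumes "\<And>x y. x \<in> S \<Longrightarrow> y \<in> S \<Longrightarrow> \<bar>x - y\<bar> < K"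
  shows "finite S \<and> card S \<le> nat K"
proof (cases "S = {}")
  case False
  then obtain x where x: "x \<in> S" by blast
  have "S \<subseteq> {x - K..x + K}" using assms x by force
  then have fin: "finite S" using finite_subset by blast
  define m where "m = Min S"
  have "m \<in> S" unfolding m_def using fin False by simp
  then have "S \<subseteq> {m..<m + K}" using assms[of _ m] Min_le[OF fin] by (fastforce simp: m_def)
  then have "card S \<le> card {m..<m + K}" by (intro card_mono) auto
  then show ?thesis using fin by simp
qed simp

text \<open>Entries are chosen from the last to the first. A pivot condition then puts
  \<open>c * a * x\<close>, where \<open>a\<close> is the head of the difference, into an interval
  of length \<open>4 * K\<close>; as \<open>\<bar>c * a\<bar> \<ge> 2\<close>, at most
  \<open>2 * K\<close> integers \<open>x\<close> remain. Free entries range over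
  \<open>X\<close>.\<close>

lemma card_pivot_fit:
  assumes X: "finite X" and c: "c \<ge> 2" and K: "K \<ge> 1"
  shows "card {xs. set xs \<subseteq> X \<and> length xs = length ds \<and> pivot_fit c K ds xs} \<le>
    nat (2 * K) ^ (length ds - nones ds) * card X ^ nones ds"
proof (induction ds)
  case Nil
  have "{xs. set xs \<subseteq> X \<and> length xs = length [] \<and> pivot_fit c K [] xs} = {[]}" by auto
  then show ?case by simp
next
  case (Cons d ds)
  define S where "S = {xs. set xs \<subseteq> X \<and> length xs = length ds \<and> pivot_fit c K ds xs}"
  have finS: "finite S" unfolding S_def
    by (rule finite_subset[OF _ finite_lists_length_eq[OF X, of "length ds"]]) auto
  show ?case
  proof (cases d)
    case None
    have "{xs. set xs \<subseteq> X \<and> length xs = length (d # ds) \<and> pivot_fit c K (d # ds) xs} \<subseteq>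
        (\<lambda>(x, xs). x # xs) ` (X \<times> S)"
      using None by (auto simp: S_def length_Suc_conv image_iff)
    then have "card {xs. set xs \<subseteq> X \<and> length xs = length (d # ds) \<and> pivot_fit c K (d # ds) xs} \<le> card (X \<times> S)"
      using X finS by (intro surj_card_le) auto
    also have "... \<le> card X * (nat (2 * K) ^ (length ds - nones ds) * card X ^ nones ds)"
      using Cons by (simp add: S_def card_cartesian_product)
    finally show ?thesis using None by (simp add: mult_ac)
  next
    case (Some d')
    define H where "H = (\<lambda>xs. {x. \<bar>c * dot d' (x # xs)\<bar> < 2 * K})"
    have H: "finite (H xs) \<and> card (H xs) \<le> nat (2 * K)" if "d' = a # d''" "a \<noteq> 0" for xs a d''
    proof (rule card_int_interval_le)
      fix x y assume xy: "x \<in> H xs" "y \<in> H xs"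
      have "c * dot d' (x # xs) - c * dot d' (y # xs) = c * a * (x - y)"
        using that by (simp add: algebra_simps)
      then have "\<bar>c * a * (x - y)\<bar> < 4 * K" using xy by (simp add: H_def)
      moreover have "2 * \<bar>x - y\<bar> \<le> \<bar>c * a * (x - y)\<bar>"
      proof -
        have "2 * 1 \<le> \<bar>c\<bar> * \<bar>a\<bar>" using c that by (intro mult_mono) auto
        then show ?thesis by (simp add: abs_mult mult_right_mono)
      qed
      ultimately show "\<bar>x - y\<bar> < 2 * K" by simp
    qed
    show ?thesis
    proof (cases "d' = [] \<or> hd d' = 0")
      case True
      then have e: "{xs. set xs \<subseteq> X \<and> length xs = length (d # ds) \<and> pivot_fit c K (d # ds) xs} = {}"
        using Some by (auto simp: length_Suc_conv)
      show ?thesis unfolding e by simp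
    next
      case False
      then have H': "finite (H xs)" "card (H xs) \<le> nat (2 * K)" for xs
        using H[of "hd d'" "tl d'" xs] by auto
      have "{xs. set xs \<subseteq> X \<and> length xs = length (d # ds) \<and> pivot_fit c K (d # ds) xs} \<subseteq>
          (\<lambda>(xs, x). x # xs) ` (SIGMA xs:S. H xs)"
        using Some by (auto simp: S_def H_def length_Suc_conv image_iff)
      then have "card {xs. set xs \<subseteq> X \<and> length xs = length (d # ds) \<and> pivot_fit c K (d # ds) xs} \<le> card (SIGMA xs:S. H xs)"
        using H' finS by (intro surj_card_le) auto
      also have "... = (\<Sum>xs\<in>S. card (H xs))" using finS H' by simp
      also have "... \<le> (\<Sum>xs\<in>S. nat (2 * K))" by (intro sum_mono H')
      also have "... \<le> nat (2 * K) * (nat (2 * K) ^ (length ds - nones ds) * card X ^ nones ds)"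
        using Cons by (simp add: S_def)
      also have "... = nat (2 * K) ^ (length (d # ds) - nones (d # ds)) * card X ^ nones (d # ds)"
        using Some nones_le[of ds] by (simp add: Suc_diff_le)
      finally show ?thesis .
    qed
  qed
qed

text \<open>Each tuple is charged to a pivot pattern that it fits; the number \<open>k\<close> of
  free entries enters both the count of such tuples and the bound \<open>(3/4) ^ k\<close>.
  \<open>B\<close> covers the worst \<open>k\<close>, and the power of 5 is the number of
  patterns.\<close>

lemma sum_lazy_power_le:
  assumes X: "finite X" and c: "c \<ge> 2" and K: "K \<ge> 1" and far: "\<And>x. x \<in> X \<Longrightarrow> c * \<bar>x\<bar> \<ge> 2 * K"
    and B: "\<And>k. k \<le> r \<Longrightarrow>
      real (nat (2 * K)) ^ (r - k) * real (card X) ^ k * min ((3/4) ^ k) (sqrt (8 / (real r + 8))) ^ n \<le> B"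
  shows "(\<Sum>xs\<in>{xs. set xs \<subseteq> X \<and> length xs = r}. lazy_exp r (\<lambda>e. of_bool (\<bar>c * dot e xs\<bar> < K)) ^ n)
    \<le> 5 ^ (Suc r * r) * B"
proof -
  define L where "L = {xs. set xs \<subseteq> X \<and> length xs = r}"
  define f where "f = (\<lambda>k. min ((3/4) ^ k) (sqrt (8 / (real r + 8))) ^ n)"
  have finL: "finite L" unfolding L_def by (rule finite_lists_length_eq[OF X])
  have f0: "f k \<ge> 0" for k by (simp add: f_def)
  have one: "lazy_exp r (\<lambda>e. of_bool (\<bar>c * dot e xs\<bar> < K)) ^ n \<le>
      (\<Sum>ds\<in>pivot_lists r. of_bool (pivot_fit c K ds xs) * f (nones ds))" if xs: "xs \<in> L" for xs
  proof -
    have len: "length xs = r" using xs by (simp add: L_def)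
    define E where "E = (\<lambda>e. length e = r \<and> set e \<subseteq> {-1,0,1} \<and> \<bar>c * dot e xs\<bar> < K)"
    define P where "P = lazy_exp r (\<lambda>e. of_bool (\<bar>c * dot e xs\<bar> < K))"
    have PE: "P \<le> lazy_exp r (\<lambda>e. of_bool (E e))"
      unfolding P_def by (intro lazy_exp_mono) (auto simp: E_def)
    have P0: "P \<ge> 0" unfolding P_def
      using lazy_exp_mono[of r "\<lambda>_. 0" "\<lambda>e. of_bool (\<bar>c * dot e xs\<bar> < K)"] by (simp add: lazy_exp_const)
    have "\<exists>ds. length ds = length xs \<and> set ds \<subseteq> pivots r \<and> pivot_fit c K ds xs \<and>
      lazy_exp (length xs) (\<lambda>x. of_bool (E x)) \<le> (3/4) ^ nones ds"
    proof (rule pivot_exists)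
      fix x y assume "E x" "E y"
      then show "\<bar>c * (dot x xs - dot y xs)\<bar> < 2 * K" by (auto simp: E_def right_diff_distrib)
    qed (auto simp: E_def len)
    then obtain ds where ds: "length ds = r" "set ds \<subseteq> pivots r" "pivot_fit c K ds xs" "P \<le> (3/4) ^ nones ds"
      using len PE by (auto intro: order_trans)
    have "P \<le> sqrt (8 / (real r + 8))"
      using lazy_littlewood_offord[of c K xs] c K far xs len unfolding P_def L_def by fastforce
    then have "P ^ n \<le> f (nones ds)" unfolding f_def using P0 ds by (intro power_mono) auto
    also have "... = of_bool (pivot_fit c K ds xs) * f (nones ds)" using ds by simp
    also have "... \<le> (\<Sum>ds\<in>pivot_lists r. of_bool (pivot_fit c K ds xs) * f (nones ds))"
      using ds f0 by (intro member_le_sum finite_pivot_lists) (auto simp: pivot_lists_def)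
    finally show ?thesis by (simp add: P_def)
  qed
  have "(\<Sum>xs\<in>L. lazy_exp r (\<lambda>e. of_bool (\<bar>c * dot e xs\<bar> < K)) ^ n) \<le>
      (\<Sum>xs\<in>L. \<Sum>ds\<in>pivot_lists r. of_bool (pivot_fit c K ds xs) * f (nones ds))"
    by (intro sum_mono one)
  also have "... = (\<Sum>ds\<in>pivot_lists r. \<Sum>xs\<in>L. of_bool (pivot_fit c K ds xs) * f (nones ds))"
    by (rule sum.swap)
  also have "... = (\<Sum>ds\<in>pivot_lists r. card {xs\<in>L. pivot_fit c K ds xs} * f (nones ds))"
    using finL by (simp add: sum_distrib_right[symmetric] Int_def)
  also have "... \<le> (\<Sum>ds\<in>pivot_lists r. B)"
  proof (intro sum_mono)
    fix ds assume "ds \<in> pivot_lists r"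
    then have len: "length ds = r" by (simp add: pivot_lists_def)
    have "card {xs\<in>L. pivot_fit c K ds xs} \<le> nat (2 * K) ^ (r - nones ds) * card X ^ nones ds"
      using card_pivot_fit[OF X c K, of ds] len by (simp add: L_def conj_assoc)
    then have "real (card {xs\<in>L. pivot_fit c K ds xs}) \<le> real (nat (2 * K)) ^ (r - nones ds) * real (card X) ^ nones ds"
      by (metis of_nat_le_iff of_nat_mult of_nat_power)
    then have "real (card {xs\<in>L. pivot_fit c K ds xs}) * f (nones ds) \<le>
        real (nat (2 * K)) ^ (r - nones ds) * real (card X) ^ nones ds * f (nones ds)"
      using f0 by (intro mult_right_mono)
    also have "... \<le> B" unfolding f_def using nones_le[of ds] len by (intro B) simp
    finally show "real (card {xs\<in>L. pivot_fit c K ds xs}) * f (nones ds) \<le> B" .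
  qed
  also have "... = card (pivot_lists r) * B" by simp
  also have "... \<le> 5 ^ (Suc r * r) * B"
  proof (intro mult_right_mono)
    show "real (card (pivot_lists r)) \<le> 5 ^ (Suc r * r)"
      using card_pivot_lists[of r] by (metis of_nat_le_iff of_nat_numeral of_nat_power)
    show "B \<ge> 0" by (rule order_trans[OF _ B[of 0]]) auto
  qed
  finally show ?thesis by (simp add: L_def)
qed

subsection \<open>The moment bound\<close>

text \<open>Orthogonality of characters over symmetric residues: multiplication by
  \<open>cis t\<close> shifts the range by one, and the two ends agree because they are
  \<open>q\<close> apart.\<close>

lemma sum_cis_full:
  fixes h :: nat and j :: int
  assumes q: "q = 2 * h + 1" and j: "\<bar>j\<bar> < int q"
  shows "(\<Sum>a\<in>{-int h..int h}. cis (2 * pi * j / q * a)) = (if j = 0 then of_nat q else 0)"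
proof (cases "j = 0")
  case True
  then show ?thesis using q by simp
next
  case False
  define t where "t = 2 * pi * j / q"
  define S where "S = (\<Sum>a\<in>{-int h..int h}. cis (t * a))"
  have q0: "q > 0" using q by simp
  have "cis t * S = (\<Sum>a\<in>{-int h..int h}. cis (t * (a + 1)))"
    unfolding S_def sum_distrib_left by (simp add: cis_mult algebra_simps)
  also have "... = (\<Sum>a\<in>{-int h+1..int h+1}. cis (t * a))"
    by (rule sum.reindex_bij_witness[of _ "\<lambda>a. a - 1" "\<lambda>a. a + 1"]) auto
  also have "... + cis (t * of_int (- int h)) = S + cis (t * of_int (int h + 1))"
  proof -
    have "{-int h..int h+1} = insert (-int h) {-int h+1..int h+1}"
      "{-int h..int h+1} = insert (int h + 1) {-int h..int h}" by auto
    then have "insert (-int h) {-int h+1..int h+1} = insert (int h + 1) {-int h..int h}" by simp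
    then have "(\<Sum>a\<in>insert (-int h) {-int h+1..int h+1}. cis (t * a)) = (\<Sum>a\<in>insert (int h + 1) {-int h..int h}. cis (t * a))"
      by simp
    then show ?thesis by (subst (asm) (1 2) sum.insert) (auto simp: S_def add.commute)
  qed
  finally have "cis t * S + cis (t * of_int (- int h)) = S + cis (t * of_int (int h + 1))" .
  moreover have "cis (t * of_int (int h + 1)) = cis (t * of_int (- int h))"
  proof -
    have "t * of_int (int h + 1) = t * of_int (- int h) + 2 * pi * of_int j"
      using q0 by (simp add: t_def q field_simps)
    then have "cis (t * of_int (int h + 1)) = cis (t * of_int (- int h)) * cis (2 * pi * of_int j)"
      by (simp only: cis_mult)
    then show ?thesis by simp
  qed
  ultimately have "(cis t - 1) * S = 0" by (simp add: algebra_simps)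
  moreover have "cis t \<noteq> 1"
  proof
    assume "cis t = 1"
    then have "cos t = 1" by (metis cis.sel(1) one_complex.sel(1))
    then obtain k :: int where "t = of_int k * 2 * pi" using cos_one_2pi_int by auto
    then have "2 * pi * (real_of_int j / q) = 2 * pi * of_int k" by (simp add: t_def mult_ac)
    then have "real_of_int j / q = of_int k" by (subst (asm) mult_left_cancel) auto
    then have "real_of_int j = of_int (k * int q)" using q0 by (simp add: field_simps)
    then have "j = k * int q" by linarith
    then have "\<bar>k\<bar> * int q < 1 * int q" using j by (simp add: abs_mult)
    then have "k = 0" using q0 by (simp add: mult_less_cancel_right)
    then show False using False \<open>j = k * int q\<close> by simp
  qed
  ultimately show ?thesis using False by (simp add: S_def t_def)
qed

text \<open>The Fejer kernel modulo \<open>q\<close>, scaled to 1 at 0. It is of order 1 for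
  \<open>\<bar>a\<bar>\<close> up to about \<open>q / H\<close>, and up to the period its Fourier
  coefficients live on frequencies below \<open>H\<close>: a smooth substitute for the indicator of
  a box.\<close>

definition fejer :: "nat \<Rightarrow> nat \<Rightarrow> int \<Rightarrow> real" where
  "fejer H q a = (norm (\<Sum>b<H. cis (of_nat b * (2 * pi * a / q))) / H)\<^sup>2"

lemma fejer_nonneg: "fejer H q a \<ge> 0"
  by (simp add: fejer_def)

lemma fejer_ge:
  assumes "H \<ge> 1" "\<bar>2 * pi * a / q\<bar> * H \<le> 1"
  shows "fejer H q a \<ge> 1 / 4"
proof -
  have "1 / 2 \<le> norm (\<Sum>b<H. cis (of_nat b * (2 * pi * a / q))) / H"
    using norm_sum_cis_ge[of "2 * pi * a / q" H] assms by (simp add: field_simps)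
  then have "(1/2)\<^sup>2 \<le> fejer H q a" unfolding fejer_def by (intro power_mono) auto
  then show ?thesis by (simp add: power2_eq_square)
qed

lemma sum_fejer_cos:
  fixes h :: nat and k :: int
  assumes q: "q = 2 * h + 1" and H: "H \<ge> 1" and k: "\<bar>k\<bar> + int H \<le> int q"
  shows "(\<Sum>a\<in>{-int h..int h}. fejer H q a * cos (2 * pi * k / q * a)) \<le> q / H * of_bool (\<bar>k\<bar> < int H)"
proof -
  let ?A = "{-int h..int h}"
  have c: "complex_of_real (fejer H q a * (real H)\<^sup>2) = (\<Sum>b<H. \<Sum>b'<H. cis (of_int (int b - int b') * (2 * pi * a / q)))" for a
    unfolding norm_sum_cis_square[symmetric] using H by (simp add: fejer_def power_divide)
  have "(\<Sum>a\<in>?A. fejer H q a * cos (2 * pi * k / q * a)) * (real H)\<^sup>2 =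
      Re (\<Sum>a\<in>?A. complex_of_real (fejer H q a * (real H)\<^sup>2) * cis (2 * pi * k / q * a))"
    by (simp add: sum_distrib_left sum_distrib_right mult_ac)
  also have "(\<Sum>a\<in>?A. complex_of_real (fejer H q a * (real H)\<^sup>2) * cis (2 * pi * k / q * a)) =
      (\<Sum>a\<in>?A. \<Sum>b<H. \<Sum>b'<H. cis (2 * pi * real_of_int (int b - int b' + k) / q * a))"
    unfolding c sum_distrib_right cis_mult
    by (intro sum.cong refl arg_cong[of _ _ cis]) (simp add: add_divide_distrib[symmetric] algebra_simps)
  also have "... = (\<Sum>b<H. \<Sum>b'<H. \<Sum>a\<in>?A. cis (2 * pi * real_of_int (int b - int b' + k) / q * a))"
    by (subst sum.swap, intro sum.cong refl, subst sum.swap) auto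
  also have "... = (\<Sum>b<H. \<Sum>b'<H. if int b - int b' + k = 0 then of_nat q else 0)"
  proof (intro sum.cong refl)
    fix b b' assume "b \<in> {..<H}" "b' \<in> {..<H}"
    \<comment> \<open>\<open>\<bar>k\<bar> + H \<le> q\<close> excludes wrapping around, so the sum
      over residues detects \<open>b - b' + k = 0\<close> exactly.\<close>
    then have "\<bar>int b - int b' + k\<bar> < int q" using k by auto
    then show "(\<Sum>a\<in>?A. cis (2 * pi * real_of_int (int b - int b' + k) / q * a)) =
        (if int b - int b' + k = 0 then of_nat q else 0)" by (rule sum_cis_full[OF q])
  qed
  also have "Re ... = (\<Sum>b<H. \<Sum>b'<H. if int b - int b' + k = 0 then real q else 0)"
    by (simp add: if_distrib cong: if_cong)
  also have "... \<le> (\<Sum>b<H. real q * of_bool (\<bar>k\<bar> < int H))"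
  proof (intro sum_mono)
    fix b assume b: "b \<in> {..<H}"
    have "(\<Sum>b'<H. if int b - int b' + k = 0 then real q else 0) = (\<Sum>b'\<in>{b'\<in>{..<H}. int b - int b' + k = 0}. real q)"
      by (rule sum.inter_filter[symmetric]) simp
    also have "... = real q * card {b'\<in>{..<H}. int b - int b' + k = 0}" by simp
    also have "... \<le> real q * of_bool (\<bar>k\<bar> < int H)"
    proof (intro mult_left_mono)
      show "real (card {b'\<in>{..<H}. int b - int b' + k = 0}) \<le> of_bool (\<bar>k\<bar> < int H)"
      proof (cases "\<bar>k\<bar> < int H")
        case True
        have "card {b'\<in>{..<H}. int b - int b' + k = 0} \<le> card {nat (int b + k)}"
          by (intro card_mono) auto
        then show ?thesis using True by simp
      next
        case False
        have e: "{b'\<in>{..<H}. int b - int b' + k = 0} = {}" using False b by auto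
        show ?thesis unfolding e by simp
      qed
    qed simp
    finally show "(\<Sum>b'<H. if int b - int b' + k = 0 then real q else 0) \<le> real q * of_bool (\<bar>k\<bar> < int H)" .
  qed
  finally have "(\<Sum>a\<in>?A. fejer H q a * cos (2 * pi * k / q * a)) * (real H)\<^sup>2 \<le> H * (real q * of_bool (\<bar>k\<bar> < int H))"
    by simp
  then have "(\<Sum>a\<in>?A. fejer H q a * cos (2 * pi * k / q * a)) \<le> H * (real q * of_bool (\<bar>k\<bar> < int H)) / (real H)\<^sup>2"
    using H by (subst pos_le_divide_eq) auto
  also have "... = q / H * of_bool (\<bar>k\<bar> < int H)" using H by (simp add: power2_eq_square)
  finally show ?thesis .
qed

text \<open>The constant \<open>1 / H\<close> keeps the weight of the few coordinates outside the bulk bounded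
  from below without enlarging the support of the Fourier transform.\<close>

definition box_wt :: "nat \<Rightarrow> nat \<Rightarrow> int \<Rightarrow> real" where
  "box_wt H q a = fejer H q a + 1 / H"

lemma box_wt_nonneg: "box_wt H q a \<ge> 0"
  by (simp add: box_wt_def fejer_nonneg)

lemma sum_box_wt_cos:
  fixes h :: nat and k :: int
  assumes q: "q = 2 * h + 1" and H: "H \<ge> 1" and k: "\<bar>k\<bar> + int H \<le> int q"
  shows "(\<Sum>a\<in>{-int h..int h}. box_wt H q a * cos (2 * pi * k / q * a)) \<le> 2 * real q / real H * of_bool (\<bar>k\<bar> < int H)"
proof -
  let ?A = "{-int h..int h}"
  have "(\<Sum>a\<in>?A. cos (2 * pi * k / q * a)) = Re (\<Sum>a\<in>?A. cis (2 * pi * k / q * a))" by simp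
  also have "... = (if k = 0 then real q else 0)" using k H by (subst sum_cis_full[OF q]) auto
  finally have e: "(\<Sum>a\<in>?A. cos (2 * pi * k / q * a)) = (if k = 0 then real q else 0)" .
  have "(\<Sum>a\<in>?A. box_wt H q a * cos (2 * pi * k / q * a)) =
      (\<Sum>a\<in>?A. fejer H q a * cos (2 * pi * k / q * a)) + (\<Sum>a\<in>?A. cos (2 * pi * k / q * a)) / H"
    by (simp add: box_wt_def distrib_right sum.distrib sum_divide_distrib)
  also have "... \<le> q / H * of_bool (\<bar>k\<bar> < int H) + q / H * of_bool (\<bar>k\<bar> < int H)"
    unfolding e using H by (intro add_mono sum_fejer_cos[OF assms]) auto
  finally show ?thesis by simp
qed

lemma abs_dot_le:
  assumes "set e \<subseteq> {-1,0,1}" "length e = length xs" "\<And>x. x \<in> set xs \<Longrightarrow> \<bar>x\<bar> \<le> M"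
  shows "\<bar>dot e xs\<bar> \<le> int (length xs) * M"
  using assms(2,1,3)
proof (induction e xs rule: list_induct2)
  case (Cons a e x xs)
  have "\<bar>a * x\<bar> \<le> M" using Cons(3) Cons(4)[of x] by (auto simp: abs_mult)
  then show ?case using Cons by (simp add: algebra_simps)
qed simp

text \<open>The \<open>r\<close>-th power is expanded over tuples of frequencies; for a fixed tuple
  the sum over \<open>w\<close> factorises into \<open>n\<close> equal sums over one coordinate.
  There the cosine product is the characteristic function of the lazy walk, and the short Fourier
  support of \<open>box_wt\<close> turns it into the probability that \<open>c * dot e xs\<close> is
  below \<open>H\<close> in modulus. The bound on \<open>c * (int r * M)\<close> keeps the walk
  clear of the period \<open>q\<close>.\<close>

lemma moment_bound:
  fixes h n r :: nat and c M :: int and X :: "int set"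
  assumes q: "q = 2 * h + 1" and H: "H \<ge> 1" and X: "finite X" "\<And>x. x \<in> X \<Longrightarrow> \<bar>x\<bar> \<le> M"
    and c: "c \<ge> 0" "c * (int r * M) + int H \<le> int q"
  shows "(\<Sum>w\<in>PiE {..<n} (\<lambda>_. {-int h..int h}). (\<Prod>i<n. box_wt H q (w i)) *
      (\<Sum>x\<in>X. \<Prod>i<n. 3/4 + 1/4 * cos (2 * pi * c / q * w i * x)) ^ r)
    \<le> (2 * real q / real H) ^ n * (\<Sum>xs\<in>{xs. set xs \<subseteq> X \<and> length xs = r}. lazy_exp r (\<lambda>e. of_bool (\<bar>c * dot e xs\<bar> < int H)) ^ n)"
proof -
  let ?A = "{-int h..int h}"
  define L where "L = {xs. set xs \<subseteq> X \<and> length xs = r}"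
  define g where "g = (\<lambda>(a::int) (x::int). 3/4 + 1/4 * cos (2 * pi * c / q * a * x))"
  have g0: "g a x \<ge> 0" for a x
    using cos_ge_minus_one[of "2 * pi * c / q * a * x"] unfolding g_def by linarith
  have prod_swap: "(\<Prod>x\<leftarrow>xs. \<Prod>i<n. g (w i) x) = (\<Prod>i<n. \<Prod>x\<leftarrow>xs. g (w i) x)" for w and xs :: "int list"
    by (induction xs) (auto simp: prod.distrib)
  have one: "(\<Sum>a\<in>?A. box_wt H q a * (\<Prod>x\<leftarrow>xs. g a x)) \<le>
      2 * real q / real H * lazy_exp r (\<lambda>e. of_bool (\<bar>c * dot e xs\<bar> < int H))" if xs: "xs \<in> L" for xs
  proof -
    have len: "length xs = r" using xs by (simp add: L_def)
    have "(\<Prod>x\<leftarrow>xs. g a x) = lazy_exp r (\<lambda>e. cos (0 + 2 * pi * c / q * a * dot e xs))" for a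
      using lazy_exp_cos[of xs 0 "2 * pi * c / q * a"] len by (simp add: g_def)
    then have "(\<Sum>a\<in>?A. box_wt H q a * (\<Prod>x\<leftarrow>xs. g a x)) =
        (\<Sum>a\<in>?A. box_wt H q a * lazy_exp r (\<lambda>e. cos (0 + 2 * pi * c / q * a * dot e xs)))"
      by simp
    also have "... = lazy_exp r (\<lambda>e. \<Sum>a\<in>?A. box_wt H q a * cos (0 + 2 * pi * c / q * a * dot e xs))"
      by (simp only: lazy_exp_sum lazy_exp_cmult)
    also have "... = lazy_exp r (\<lambda>e. \<Sum>a\<in>?A. box_wt H q a * cos (2 * pi * real_of_int (c * dot e xs) / q * a))"
      by (simp add: mult_ac)
    also have "... \<le> lazy_exp r (\<lambda>e. 2 * real q / real H * of_bool (\<bar>c * dot e xs\<bar> < int H))"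
    proof (rule lazy_exp_mono, rule sum_box_wt_cos[OF q H])
      fix e :: "int list" assume e: "length e = r" "set e \<subseteq> {-1,0,1}"
      have "\<bar>x\<bar> \<le> M" if "x \<in> set xs" for x using X(2) xs that by (auto simp: L_def)
      then have "\<bar>dot e xs\<bar> \<le> int (length xs) * M" using e len by (intro abs_dot_le) auto
      then have "\<bar>dot e xs\<bar> \<le> int r * M" by (simp add: len)
      then have "c * \<bar>dot e xs\<bar> \<le> c * (int r * M)" using c by (intro mult_left_mono)
      then show "\<bar>c * dot e xs\<bar> + int H \<le> int q" using c by (simp add: abs_mult)
    qed
    finally show ?thesis by (simp only: lazy_exp_cmult)
  qed
  have "(\<Sum>w\<in>PiE {..<n} (\<lambda>_. ?A). (\<Prod>i<n. box_wt H q (w i)) * (\<Sum>x\<in>X. \<Prod>i<n. g (w i) x) ^ r) =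
      (\<Sum>w\<in>PiE {..<n} (\<lambda>_. ?A). \<Sum>xs\<in>L. \<Prod>i<n. box_wt H q (w i) * (\<Prod>x\<leftarrow>xs. g (w i) x))"
    unfolding sum_power_lists[OF X(1)] L_def[symmetric] prod_swap
    by (simp add: sum_distrib_left prod.distrib)
  also have "... = (\<Sum>xs\<in>L. \<Sum>w\<in>PiE {..<n} (\<lambda>_. ?A). \<Prod>i<n. box_wt H q (w i) * (\<Prod>x\<leftarrow>xs. g (w i) x))"
    by (rule sum.swap)
  also have "... = (\<Sum>xs\<in>L. (\<Sum>a\<in>?A. box_wt H q a * (\<Prod>x\<leftarrow>xs. g a x)) ^ n)"
    by (subst prod_sum_PiE[symmetric]) auto
  also have "... \<le> (\<Sum>xs\<in>L. (2 * real q / real H * lazy_exp r (\<lambda>e. of_bool (\<bar>c * dot e xs\<bar> < int H))) ^ n)"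
    using g0 by (intro sum_mono power_mono one sum_nonneg mult_nonneg_nonneg box_wt_nonneg prod_list_nonneg) auto
  also have "... = (2 * real q / real H) ^ n * (\<Sum>xs\<in>L. lazy_exp r (\<lambda>e. of_bool (\<bar>c * dot e xs\<bar> < int H)) ^ n)"
    by (simp only: power_mult_distrib sum_distrib_left)
  finally show ?thesis by (simp only: g_def L_def)
qed

text \<open>Few coordinates beyond \<open>N G\<^sup>2\<close>, a fair share of coordinates between \<open>N / (2 G\<^sup>2)\<close> and \<open>N G\<^sup>2\<close> (they
  make low frequencies negligible), and concentration above the level \<open>G\<^sup>5 / N\<close>.\<close>

definition bad_vectors :: "nat \<Rightarrow> nat \<Rightarrow> nat \<Rightarrow> nat \<Rightarrow> (nat \<Rightarrow> int) set" where
  "bad_vectors n m G N = {w \<in> PiE {..<n} (\<lambda>_. {-int (2 * N * m)..int (2 * N * m)}).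
     card {i \<in> {..<n}. \<bar>w i\<bar> > int (N * G\<^sup>2)} * G ^ 4 \<le> 4 * n \<and>
     n \<le> 2 * G\<^sup>2 * card {i \<in> {..<n}. int N \<le> 2 * int (G\<^sup>2) * \<bar>w i\<bar> \<and> \<bar>w i\<bar> \<le> int (N * G\<^sup>2)} \<and>
     conc n (real (G * m)) w \<ge> 192 * real G ^ 5 / real N}"

text \<open>This is \<open>\<bar>cos x\<bar> \<le> (1 + (cos x)^2) / 2\<close>. The right-hand side
  is a trigonometric polynomial with nonnegative coefficients of sum 1, hence a characteristic
  function; its doubled argument turns the frequency step \<open>p\<close> into
  \<open>2 * p\<close>.\<close>

lemma abs_cos_le_lazy: "\<bar>cos x\<bar> \<le> 3/4 + 1/4 * cos (2 * x)" for x :: real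
proof -
  have "0 \<le> (1 - \<bar>cos x\<bar>)\<^sup>2" by simp
  also have "... = 1 - 2 * \<bar>cos x\<bar> + (cos x)\<^sup>2" by (simp add: power2_eq_square algebra_simps)
  finally have "0 \<le> 1 - 2 * \<bar>cos x\<bar> + (cos x)\<^sup>2" .
  moreover have "a \<le> 3/4 + 1/4 * (2 * b - 1)" if "0 \<le> 1 - 2 * a + b" for a b :: real
    using that by (simp add: field_simps)
  ultimately show ?thesis unfolding cos_double_cos by blast
qed

lemma sum_Un_le:
  fixes f :: "'a \<Rightarrow> real"
  assumes "finite A" "finite B" "\<And>x. f x \<ge> 0"
  shows "sum f (A \<union> B) \<le> sum f A + sum f B"
  using assms by (simp add: sum_Un sum_nonneg)

lemma div_ge_half:
  fixes a b :: nat assumes "b \<ge> 1" "b \<le> a" shows "real (a div b) \<ge> real a / (2 * b)"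
proof -
  have "a div b \<ge> 1" using assms by (simp add: div_greater_zero_iff Suc_le_eq)
  have "a = b * (a div b) + a mod b" by simp
  also have "... \<le> b * (a div b) + b * 1" using assms by (intro add_left_mono) (simp add: less_imp_le)
  also have "... \<le> b * (a div b) + b * (a div b)" using \<open>a div b \<ge> 1\<close> by (intro add_left_mono mult_left_mono) auto
  finally have "a \<le> 2 * b * (a div b)" by simp
  then have "real a \<le> 2 * real b * real (a div b)" by (metis of_nat_le_iff of_nat_mult of_nat_numeral)
  then show ?thesis using assms by (simp add: field_simps)
qed

text \<open>Zero and low frequencies cannot account for the concentration of a bad vector, so
  \<open>far w \<ge> 1\<close>; its weight is at least \<open>(1/12) ^ n\<close>, and the weighted
  \<open>r\<close>-th moment of \<open>far\<close> bounds the count. Frequencies are multiples of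
  \<open>p = G ^ 4\<close>, because with much smaller steps the first nonzero one would turn the
  bulk coordinates by too little to make \<open>Near\<close> negligible.\<close>

lemma card_bad_vectors_le:
  fixes n m G N r :: nat and B :: real
  assumes m: "m\<^sup>2 \<le> 4 * n" and G: "G \<ge> 1" "4 * G\<^sup>2 \<le> m" and r: "r \<le> m" and N: "2 * G ^ 5 \<le> N"
    and near: "m * exp (- (real G ^ 2 / 256)) \<le> 1" and exc: "4 * ln m \<le> real G ^ 4"
    and B: "\<And>k. k \<le> r \<Longrightarrow> real m ^ (r - k) * real N ^ k * min ((3/4) ^ k) (sqrt (8 / (real r + 8))) ^ n \<le> B"
  shows "card (bad_vectors n m G N) \<le> (480 * real N * G\<^sup>2) ^ n * (5 ^ (Suc r * r) * B)"
proof -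
  define h where "h = 2 * N * m"
  define q where "q = 2 * h + 1"
  define p where "p = G ^ 4"
  \<comment> \<open>\<open>H\<close> is chosen so that coordinates up to \<open>N * G^2\<close> stay
    on the flat top of the Fejer kernel (\<open>ang\<close>), and \<open>Q\<close> so that the
    frequencies resolve the scale \<open>G * m\<close> (\<open>aQ\<close>); in both cases the bound
    that results is pi / 4.\<close>
  define H where "H = m div (2 * G\<^sup>2)"
  define Q where "Q = N div (2 * G ^ 5)"
  define a where "a = 2 * pi * p / q"
  define X where "X = {k \<in> {-int Q<..<int Q}. int H \<le> int p * \<bar>k\<bar>}"
  define Near where "Near = {k \<in> {-int Q<..<int Q}. k \<noteq> 0 \<and> int p * \<bar>k\<bar> < int H}"
  define bulk where "bulk = (\<lambda>w. {i \<in> {..<n}. int N \<le> 2 * int (G\<^sup>2) * \<bar>w i\<bar> \<and> \<bar>w i\<bar> \<le> int (N * G\<^sup>2)})"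
  have m1: "m \<ge> 1" using G by (cases m) auto
  have N1: "N \<ge> 1" using N G by (cases N) auto
  have G5: "2 * G ^ 5 \<ge> 1" using G by simp
  have p1: "p \<ge> 1" using G by (simp add: p_def)
  have q: "real q \<ge> 4 * real N * m" "real q \<le> 5 * real N * m"
  proof -
    have "1 \<le> N * m" using m1 N1 by (simp add: Suc_le_eq)
    then have "q \<le> 5 * (N * m)" by (simp add: q_def h_def)
    then have "real q \<le> real (5 * (N * m))" by (simp only: of_nat_le_iff)
    then show "real q \<le> 5 * real N * m" by simp
  qed (simp add: q_def h_def)
  have q0: "real q > 0" by (simp add: q_def)
  have H: "real H \<ge> m / (4 * real G ^ 2)" "real H \<le> m / (2 * real G ^ 2)"
    using div_ge_half[of "2 * G\<^sup>2" m] G of_nat_div_le_of_nat[of m "2 * G\<^sup>2", where 'a = real]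
    by (simp_all add: H_def)
  have H1: "H \<ge> 1"
  proof -
    have "1 \<le> m / (4 * real G ^ 2)"
      using G by (simp add: field_simps) (metis of_nat_le_iff of_nat_mult of_nat_numeral of_nat_power)
    then show ?thesis using H by simp
  qed
  have Hm: "2 * H \<le> m"
  proof -
    have "H \<le> m div 2" unfolding H_def using G by (intro div_le_mono2) auto
    then show ?thesis by simp
  qed
  have Q: "real Q \<ge> N / (4 * real G ^ 5)" "real Q \<le> N / (2 * real G ^ 5)"
    using div_ge_half[of "2 * G ^ 5" N] N G of_nat_div_le_of_nat[of N "2 * G ^ 5", where 'a = real]
    by (simp_all add: Q_def)
  have Q1: "Q \<ge> 1" using N G5 by (simp add: Q_def div_greater_zero_iff Suc_le_eq)
  have Q2: "2 * Q \<le> N"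
  proof -
    have "Q \<le> N div 2" unfolding Q_def using G by (intro div_le_mono2) auto
    then show ?thesis by simp
  qed
  have aQ: "a * Q * (G * m) \<le> 1"
  proof -
    have "a \<le> 2 * pi * real G ^ 4 / (4 * real N * m)"
      unfolding a_def p_def using q N1 m1 by (intro frac_le) auto
    then have "a * Q * (G * m) \<le> 2 * pi * real G ^ 4 / (4 * real N * m) * (N / (2 * real G ^ 5)) * (G * m)"
      using Q by (intro mult_right_mono mult_mono) auto
    also have "... = pi / 4" using N1 m1 G by (simp add: field_simps power_numeral_reduce)
    also have "... \<le> 1" using pi_less_4 by simp
    finally show ?thesis by simp
  qed
  have ang: "\<bar>2 * pi * w / q\<bar> * H \<le> 1" if "\<bar>w\<bar> \<le> int (N * G\<^sup>2)" for w :: int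
  proof -
    have "\<bar>real_of_int w\<bar> \<le> real (N * G\<^sup>2)" using that by linarith
    then have "\<bar>2 * pi * w / q\<bar> * H \<le> 2 * pi * (real N * G\<^sup>2) / (4 * real N * m) * (m / (2 * real G ^ 2))"
      unfolding abs_divide abs_mult using q H N1 m1
      by (intro mult_mono frac_le) auto
    also have "... = pi / 4" using N1 m1 G by (simp add: field_simps)
    also have "... \<le> 1" using pi_less_4 by simp
    finally show ?thesis .
  qed
  have finX: "finite X" by (rule finite_subset[of _ "{-int Q<..<int Q}"]) (auto simp: X_def)
  have finNear: "finite Near" by (rule finite_subset[of _ "{-int Q<..<int Q}"]) (auto simp: Near_def)
  define far where "far = (\<lambda>w. \<Sum>x\<in>X. \<Prod>i<n. 3/4 + 1/4 * cos (2 * pi * (2 * int p) / q * w i * x))"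
  have far0: "far w \<ge> 0" for w :: "nat \<Rightarrow> int" unfolding far_def
  proof (intro sum_nonneg prod_nonneg)
    fix x :: int and i :: nat show "0 \<le> 3/4 + 1/4 * cos (2 * pi * (2 * int p) / q * w i * x)"
      using cos_ge_minus_one[of "2 * pi * (2 * int p) / q * w i * x"] by linarith
  qed
  have far: "far w \<ge> 1" if w: "w \<in> bad_vectors n m G N" for w
  proof -
    define f where "f = (\<lambda>k::int. \<Prod>i<n. \<bar>cos (a * k * w i)\<bar>)"
    have f0: "f k \<ge> 0" for k by (simp add: f_def prod_nonneg)
    have "192 * real G ^ 5 / N \<le> conc n (real (G * m)) w"
      using w by (simp add: bad_vectors_def)
    also have "... \<le> (16 / Q) * (\<Sum>k\<in>{-int Q<..<int Q}. f k)"
      unfolding f_def using aQ Q1 G m1 by (intro conc_fourier) (auto simp: a_def)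
    also have "... \<le> (64 * real G ^ 5 / N) * (\<Sum>k\<in>{-int Q<..<int Q}. f k)"
    proof (intro mult_right_mono sum_nonneg f0)
      have "16 / real Q \<le> 16 / (N / (4 * real G ^ 5))"
        using Q Q1 N1 G by (intro divide_left_mono) auto
      then show "16 / real Q \<le> 64 * real G ^ 5 / N" by simp
    qed
    finally have "192 * real G ^ 5 / N \<le> (64 * real G ^ 5 / N) * (\<Sum>k\<in>{-int Q<..<int Q}. f k)" .
    then have "64 * real G ^ 5 / N * 3 \<le> (64 * real G ^ 5 / N) * (\<Sum>k\<in>{-int Q<..<int Q}. f k)" by simp
    \<comment> \<open>192 is 3 * 64: of a total of at least 3, frequency 0 takes 1 and
      \<open>Near\<close> at most 1, which leaves 1 for \<open>X\<close>.\<close>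
    then have S3: "3 \<le> (\<Sum>k\<in>{-int Q<..<int Q}. f k)"
      using N1 G by (subst (asm) mult_le_cancel_left_pos) auto
    have "{-int Q<..<int Q} \<subseteq> {0} \<union> Near \<union> X" by (auto simp: Near_def X_def)
    then have "(\<Sum>k\<in>{-int Q<..<int Q}. f k) \<le> (\<Sum>k\<in>{0} \<union> Near \<union> X. f k)"
      using finX finNear f0 by (intro sum_mono2) auto
    also have "... \<le> (\<Sum>k\<in>{0} \<union> Near. f k) + (\<Sum>k\<in>X. f k)"
      using finX finNear f0 by (intro sum_Un_le) auto
    also have "(\<Sum>k\<in>{0} \<union> Near. f k) \<le> (\<Sum>k\<in>{0}. f k) + (\<Sum>k\<in>Near. f k)"
      using finX finNear f0 by (intro sum_Un_le) auto
    also have "(\<Sum>k\<in>{0}. f k) = 1" by (simp add: f_def)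
    also have "(\<Sum>k\<in>Near. f k) \<le> 1"
    proof -
      have "f k \<le> exp (- (real G ^ 2 / 256))" if k: "k \<in> Near" for k
      proof -
        \<comment> \<open>A lower bound for the angle of a bulk coordinate at a nonzero frequency.
          With at least \<open>n / (2 * G^2)\<close> bulk coordinates and
          \<open>m^2 \<le> 4 * n\<close> it yields the exponent \<open>G^2 / 256\<close>.\<close>
        define \<delta> where "\<delta> = real G ^ 2 / (2 * m)"
        have k': "1 \<le> \<bar>k\<bar>" "int p * \<bar>k\<bar> < int H" using k by (auto simp: Near_def)
        have d: "\<delta> \<le> \<bar>a * k * w i\<bar> \<and> \<bar>a * k * w i\<bar> \<le> 1" if i: "i \<in> bulk w" for i
        proof
          have wi: "int N \<le> 2 * int (G\<^sup>2) * \<bar>w i\<bar>" "\<bar>w i\<bar> \<le> int (N * G\<^sup>2)"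
            using i by (auto simp: bulk_def)
          have "real_of_int (int N) \<le> real_of_int (2 * int (G\<^sup>2) * \<bar>w i\<bar>)" using wi(1) of_int_le_iff by blast
          then have w1: "real N / (2 * real G ^ 2) \<le> \<bar>real_of_int (w i)\<bar>" using G by (simp add: field_simps)
          have "a * 1 * (real N / (2 * real G ^ 2)) \<le> a * \<bar>real_of_int k\<bar> * \<bar>real_of_int (w i)\<bar>"
          proof (intro mult_mono w1)
            show "1 \<le> \<bar>real_of_int k\<bar>" using k' by linarith
          qed (auto simp: a_def)
          moreover have "\<delta> \<le> a * 1 * (real N / (2 * real G ^ 2))"
          proof -
            have "\<delta> \<le> pi * real G ^ 2 / (5 * m)" unfolding \<delta>_def
              using m1 pi_gt3 mult_right_mono[of 5 "2 * pi" "(real G)\<^sup>2"] by (simp add: field_simps)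
            also have "... = 2 * pi * p / (5 * real N * m) * (real N / (2 * real G ^ 2))"
              using N1 G m1 by (simp add: p_def field_simps power_numeral_reduce)
            also have "... \<le> a * 1 * (real N / (2 * real G ^ 2))"
              unfolding a_def using q q0 N1 m1 by (intro mult_right_mono) (auto intro!: divide_left_mono)
            finally show ?thesis .
          qed
          moreover have "a \<ge> 0" by (simp add: a_def)
          ultimately show "\<delta> \<le> \<bar>a * k * w i\<bar>" by (simp add: abs_mult)
          have "real_of_int (int p * \<bar>k\<bar>) \<le> real_of_int (int H)" using k' of_int_le_iff by (metis less_imp_le)
          then have "\<bar>2 * pi * w i / q\<bar> * (real p * \<bar>real_of_int k\<bar>) \<le> \<bar>2 * pi * w i / q\<bar> * H"
            by (intro mult_left_mono) auto
          also have "... \<le> 1" by (rule ang[OF wi(2)])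
          finally show "\<bar>a * k * w i\<bar> \<le> 1" by (simp add: a_def abs_mult mult_ac)
        qed
        have "f k \<le> exp (- (card (bulk w) * \<delta>\<^sup>2 / 8))"
          unfolding f_def using d by (intro prod_cos_near) (auto simp: bulk_def \<delta>_def)
        also have "... \<le> exp (- (real G ^ 2 / 256))"
        proof -
          have "n \<le> 2 * G\<^sup>2 * card (bulk w)" using w by (simp add: bad_vectors_def bulk_def)
          then have "m\<^sup>2 \<le> 4 * (2 * G\<^sup>2 * card (bulk w))" using m by linarith
          then have "real (m\<^sup>2) \<le> real (4 * (2 * G\<^sup>2 * card (bulk w)))" by (simp only: of_nat_le_iff)
          then have "real G ^ 2 * real m ^ 2 \<le> real G ^ 2 * (8 * real G ^ 2 * card (bulk w))"
            by (intro mult_left_mono) auto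
          then have "real G ^ 2 / 256 \<le> card (bulk w) * \<delta>\<^sup>2 / 8"
            using m1 by (simp add: \<delta>_def power_divide power_mult_distrib field_simps power_numeral_reduce)
          then show ?thesis by simp
        qed
        finally show ?thesis .
      qed
      then have "(\<Sum>k\<in>Near. f k) \<le> card Near * exp (- (real G ^ 2 / 256))"
        using sum_bounded_above[of Near f "exp (- (real G ^ 2 / 256))"] by simp
      also have "... \<le> m * exp (- (real G ^ 2 / 256))"
      proof (intro mult_right_mono)
        have "Near \<subseteq> {-int H<..<int H}"
        proof
          fix k assume k: "k \<in> Near"
          have "1 * \<bar>k\<bar> \<le> int p * \<bar>k\<bar>" using p1 by (intro mult_right_mono) auto
          moreover have "int p * \<bar>k\<bar> < int H" using k by (simp add: Near_def)
          ultimately have "\<bar>k\<bar> < int H" by linarith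
          then show "k \<in> {-int H<..<int H}" by auto
        qed
        then have "card Near \<le> card {-int H<..<int H}" by (intro card_mono) auto
        then show "real (card Near) \<le> real m" using Hm by simp
      qed simp
      also have "... \<le> 1" by (rule near)
      finally show ?thesis .
    qed
    finally have "1 \<le> (\<Sum>k\<in>X. f k)" using S3 by simp
    also have "... \<le> far w" unfolding far_def f_def
    proof (intro sum_mono prod_mono conjI)
      fix x :: int and i :: nat
      show "\<bar>cos (a * x * w i)\<bar> \<le> 3/4 + 1/4 * cos (2 * pi * (2 * int p) / q * w i * x)"
        using abs_cos_le_lazy[of "a * x * w i"] by (simp add: a_def mult_ac)
    qed auto
    finally show ?thesis .
  qed
  have wt: "(\<Prod>i<n. box_wt H q (w i)) \<ge> (1/12) ^ n" if w: "w \<in> bad_vectors n m G N" for w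
  proof -
    define Ex where "Ex = {i \<in> {..<n}. \<bar>w i\<bar> > int (N * G\<^sup>2)}"
    have Ex: "Ex \<subseteq> {..<n}" "finite Ex" by (auto simp: Ex_def)
    have cEx: "card Ex * real G ^ 4 \<le> 4 * n"
    proof -
      have "card Ex * G ^ 4 \<le> 4 * n" using w by (simp add: bad_vectors_def Ex_def)
      then have "real (card Ex * G ^ 4) \<le> real (4 * n)" by (simp only: of_nat_le_iff)
      then show ?thesis by simp
    qed
    have lnm: "ln (real m) \<ge> 0" using m1 by simp
    \<comment> \<open>At most \<open>4 * n / G ^ 4\<close> coordinates are exceptional, each of
      weight at least \<open>1 / m\<close>; by \<open>exc\<close> they cost at most
      \<open>exp n \<le> 3 ^ n\<close> in all. The others cost 4 each, hence 12.\<close>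
    have "real (card Ex) * ln m \<le> n"
    proof -
      have "real (card Ex) * (4 * ln m) \<le> real (card Ex) * real G ^ 4" by (intro mult_left_mono exc) auto
      then show ?thesis using cEx by simp
    qed
    then have "exp (- real n) \<le> exp (- (real (card Ex) * ln m))" by simp
    also have "... = (1 / m) ^ card Ex"
      using m1 by (simp add: exp_minus exp_of_nat_mult power_one_over inverse_eq_divide)
    also have "... \<le> (1 / H) ^ card Ex"
      using H1 Hm by (intro power_mono divide_left_mono) auto
    finally have e1: "exp (- real n) \<le> (1 / H) ^ card Ex" .
    have e3: "(1/3::real) ^ n \<le> exp (- real n)"
    proof -
      have "exp (1::real) \<le> 3" by (rule exp_le)
      then have "1 / 3 \<le> exp (-1::real)" by (simp add: exp_minus field_simps)
      then have "(1 / 3) ^ n \<le> exp (-1::real) ^ n" by (intro power_mono) auto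
      then show ?thesis by (simp add: exp_of_nat_mult[symmetric])
    qed
    have "(1/12::real) ^ n = (1/4) ^ n * (1/3) ^ n" by (simp add: power_mult_distrib[symmetric])
    also have "... \<le> (1/4) ^ card ({..<n} - Ex) * (1 / H) ^ card Ex"
    proof (intro mult_mono)
      show "(1/4::real) ^ n \<le> (1/4) ^ card ({..<n} - Ex)"
        using card_mono[of "{..<n}" "{..<n} - Ex"] by (intro power_decreasing) auto
      show "(1/3) ^ n \<le> (1 / real H) ^ card Ex" using e1 e3 by linarith
    qed auto
    also have "... = (\<Prod>i\<in>{..<n} - Ex. 1/4) * (\<Prod>i\<in>Ex. 1 / real H)" by simp
    also have "... \<le> (\<Prod>i\<in>{..<n} - Ex. box_wt H q (w i)) * (\<Prod>i\<in>Ex. box_wt H q (w i))"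
    proof (intro mult_mono prod_mono conjI)
      fix i assume "i \<in> {..<n} - Ex"
      then have "\<bar>w i\<bar> \<le> int (N * G\<^sup>2)" by (auto simp: Ex_def)
      then have "fejer H q (w i) \<ge> 1/4" by (intro fejer_ge H1 ang)
      then show "1/4 \<le> box_wt H q (w i)" by (simp add: box_wt_def add_increasing2)
    next
      fix i show "1 / real H \<le> box_wt H q (w i)" by (simp add: box_wt_def fejer_nonneg)
    qed (auto intro: prod_nonneg box_wt_nonneg)
    also have "... = (\<Prod>i<n. box_wt H q (w i))"
      using prod.subset_diff[OF Ex(1), of "\<lambda>i. box_wt H q (w i)"] by simp
    finally show ?thesis .
  qed
  let ?P = "PiE {..<n} (\<lambda>_. {-int h..int h})"
  have sub: "bad_vectors n m G N \<subseteq> ?P" by (auto simp: bad_vectors_def h_def)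
  have finP: "finite ?P" by (intro finite_PiE) auto
  have "real (card (bad_vectors n m G N)) * (1/12) ^ n = (\<Sum>w\<in>bad_vectors n m G N. (1/12) ^ n * 1 ^ r)" by simp
  also have "... \<le> (\<Sum>w\<in>bad_vectors n m G N. (\<Prod>i<n. box_wt H q (w i)) * far w ^ r)"
    by (intro sum_mono mult_mono wt power_mono far) (auto intro: prod_nonneg box_wt_nonneg)
  also have "... \<le> (\<Sum>w\<in>?P. (\<Prod>i<n. box_wt H q (w i)) * far w ^ r)"
    using far0 by (intro sum_mono2 finP sub) (auto intro!: mult_nonneg_nonneg prod_nonneg box_wt_nonneg)
  also have "... \<le> (2 * real q / real H) ^ n * (\<Sum>xs\<in>{xs. set xs \<subseteq> X \<and> length xs = r}.
      lazy_exp r (\<lambda>e. of_bool (\<bar>2 * int p * dot e xs\<bar> < int H)) ^ n)"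
    unfolding far_def
  proof (rule moment_bound[OF q_def H1 finX])
    show "\<bar>x\<bar> \<le> int Q" if "x \<in> X" for x using that by (auto simp: X_def)
    \<comment> \<open>\<open>2 * p * Q \<le> N\<close> and \<open>r \<le> m\<close> keep the walk
      within \<open>N * m\<close>, while \<open>q\<close> exceeds \<open>4 * N * m\<close>.\<close>
    have "2 * p * (r * Q) + H \<le> q"
    proof -
      have "2 * p * Q \<le> N"
      proof -
        have "2 * p * Q \<le> 2 * G ^ 5 * Q" unfolding p_def using G by (intro mult_right_mono mult_left_mono power_increasing) auto
        also have "... \<le> N" unfolding Q_def by (rule times_div_less_eq_dividend)
        finally show ?thesis .
      qed
      then have "r * (2 * p * Q) \<le> m * N" using r by (intro mult_mono) auto
      moreover have "H \<le> m * N" using Hm N1 by (metis add_leD1 le_trans mult.right_neutral mult_2 mult_le_mono2)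
      ultimately show ?thesis by (simp add: q_def h_def mult_ac)
    qed
    then have "int (2 * p * (r * Q) + H) \<le> int q" by (simp only: of_nat_le_iff)
    then show "2 * int p * (int r * int Q) + int H \<le> int q" by simp
  qed simp
  also have "... \<le> (40 * real N * G\<^sup>2) ^ n * (5 ^ (Suc r * r) * B)"
  proof (intro mult_mono power_mono)
    have "2 * real q / H \<le> 2 * (5 * real N * m) / (m / (4 * real G ^ 2))"
      using q H m1 G by (intro frac_le) auto
    also have "... = 40 * real N * G\<^sup>2" using m1 by simp
    finally show "2 * real q / H \<le> 40 * real N * G\<^sup>2" .
    show "(\<Sum>xs\<in>{xs. set xs \<subseteq> X \<and> length xs = r}.
      lazy_exp r (\<lambda>e. of_bool (\<bar>2 * int p * dot e xs\<bar> < int H)) ^ n) \<le> 5 ^ (Suc r * r) * B"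
    proof (rule sum_lazy_power_le[OF finX])
      show "2 * int H \<le> 2 * int p * \<bar>x\<bar>" if "x \<in> X" for x using that by (auto simp: X_def)
      fix k assume k: "k \<le> r"
      have "card X \<le> card {-int Q<..<int Q}" unfolding X_def by (intro card_mono) auto
      then have cX: "card X \<le> N" using Q2 by simp
      have "real (nat (2 * int H)) ^ (r - k) * real (card X) ^ k * min ((3/4) ^ k) (sqrt (8 / (real r + 8))) ^ n \<le>
          real m ^ (r - k) * real N ^ k * min ((3/4) ^ k) (sqrt (8 / (real r + 8))) ^ n"
        using Hm cX by (intro mult_right_mono mult_mono power_mono) auto
      also have "... \<le> B" by (rule B[OF k])
      finally show "real (nat (2 * int H)) ^ (r - k) * real (card X) ^ k * min ((3/4) ^ k) (sqrt (8 / (real r + 8))) ^ n \<le> B" .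
    qed (use p1 H1 in auto)
    have "0 \<le> lazy_exp r (\<lambda>e. of_bool (\<bar>2 * int p * dot e xs\<bar> < int H))" for xs
      using lazy_exp_mono[of r "\<lambda>_. 0" "\<lambda>e. of_bool (\<bar>2 * int p * dot e xs\<bar> < int H)"] by (simp add: lazy_exp_const)
    then show "0 \<le> (\<Sum>xs\<in>{xs. set xs \<subseteq> X \<and> length xs = r}.
      lazy_exp r (\<lambda>e. of_bool (\<bar>2 * int p * dot e xs\<bar> < int H)) ^ n)" by (intro sum_nonneg) auto
  qed auto
  finally have "real (card (bad_vectors n m G N)) \<le> 12 ^ n * ((40 * real N * G\<^sup>2) ^ n * (5 ^ (Suc r * r) * B))"
    by (simp add: power_one_over field_simps)
  also have "... = (480 * real N * G\<^sup>2) ^ n * (5 ^ (Suc r * r) * B)"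
    by (simp only: mult.assoc[symmetric] power_mult_distrib[symmetric]) simp
  finally show ?thesis .
qed

subsection \<open>Compressible normal vectors\<close>

lemma sum_signs_Suc:
  "(\<Sum>x\<in>signs (Suc n). f (ip (Suc n) x v)) = (\<Sum>x\<in>signs n. f (ip n x v + v n) + f (ip n x v - v n))"
proof -
  have ipn: "ip (Suc n) (g(n := y)) v = ip n g v + y * v n" for g y
    by (simp add: ip_def)
  have "signs (Suc n) = (\<lambda>(y, g). g(n := y)) ` ({-1, 1} \<times> signs n)"
    by (simp add: signs_def lessThan_Suc PiE_insert_eq)
  moreover have "inj_on (\<lambda>(y, g). g(n := y)) ({-1, 1} \<times> signs n)"
    unfolding signs_def by (rule inj_combinator) simp
  ultimately have "(\<Sum>x\<in>signs (Suc n). f (ip (Suc n) x v)) =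
      (\<Sum>(y, g)\<in>{-1, 1} \<times> signs n. f (ip n g v + y * v n))"
    by (simp add: sum.reindex case_prod_unfold ipn)
  also have "... = (\<Sum>y\<in>{-1, 1}. \<Sum>g\<in>signs n. f (ip n g v + y * v n))"
    by (simp add: sum.cartesian_product)
  finally show ?thesis by (simp add: sum.distrib add.commute)
qed

lemma signs_0: "signs 0 = {\<lambda>_. undefined}"
  by (simp add: signs_def)

lemma second_moment: "(\<Sum>x\<in>signs n. (ip n x v)\<^sup>2) = 2 ^ n * (\<Sum>i<n. (v i)\<^sup>2)"
proof (induction n)
  case (Suc n)
  have "(\<Sum>x\<in>signs (Suc n). (ip (Suc n) x v)\<^sup>2) = (\<Sum>x\<in>signs n. 2 * (ip n x v)\<^sup>2 + 2 * (v n)\<^sup>2)"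
    by (subst sum_signs_Suc) (simp add: power2_eq_square algebra_simps)
  also have "... = 2 * (2 ^ n * (\<Sum>i<n. (v i)\<^sup>2)) + 2 * (2 ^ n * (v n)\<^sup>2)"
    by (simp only: sum.distrib sum_distrib_left[symmetric] Suc) (simp add: card_signs)
  finally show ?case by (simp add: algebra_simps)
qed (simp add: signs_0 ip_def)

lemma fourth_moment: "(\<Sum>x\<in>signs n. (ip n x v) ^ 4) \<le> 2 ^ n * (3 * (\<Sum>i<n. (v i)\<^sup>2)\<^sup>2)"
proof (induction n)
  case (Suc n)
  define S where "S = (\<Sum>i<n. (v i)\<^sup>2)"
  have e: "(a + b) ^ 4 + (a - b) ^ 4 = 2 * a ^ 4 + 12 * b\<^sup>2 * a\<^sup>2 + 2 * b ^ 4" for a b :: real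
    by (simp add: power2_eq_square power4_eq_xxxx algebra_simps)
  have "(\<Sum>x\<in>signs (Suc n). (ip (Suc n) x v) ^ 4) =
      (\<Sum>x\<in>signs n. 2 * (ip n x v) ^ 4 + 12 * (v n)\<^sup>2 * (ip n x v)\<^sup>2 + 2 * (v n) ^ 4)"
    by (subst sum_signs_Suc) (simp only: e)
  also have "... = 2 * (\<Sum>x\<in>signs n. (ip n x v) ^ 4) + 12 * (v n)\<^sup>2 * (2 ^ n * S) + 2 * (2 ^ n * (v n) ^ 4)"
    by (simp only: sum.distrib sum_distrib_left[symmetric] second_moment S_def) (simp add: card_signs)
  also have "... \<le> 2 * (2 ^ n * (3 * S\<^sup>2)) + 12 * (v n)\<^sup>2 * (2 ^ n * S) + 2 * (2 ^ n * (v n) ^ 4)"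
    using Suc by (simp add: S_def)
  also have "... = 2 ^ Suc n * (3 * S\<^sup>2 + 6 * (v n)\<^sup>2 * S + (v n) ^ 4)"
    by (simp add: algebra_simps)
  also have "... \<le> 2 ^ Suc n * (3 * S\<^sup>2 + 6 * (v n)\<^sup>2 * S + 3 * (v n) ^ 4)" by (intro mult_left_mono) auto
  also have "... = 2 ^ Suc n * (3 * (S + (v n)\<^sup>2)\<^sup>2)"
    by (simp add: power2_eq_square power4_eq_xxxx algebra_simps)
  finally show ?case by (simp add: S_def)
qed (simp add: signs_0 ip_def)

text \<open>By Cauchy-Schwarz and the fourth moment, \<open>(ip n x v)^2\<close> exceeds a sixteenth
  of its mean with probability at least \<open>(15/16)^2 / 3 > 0.29\<close>. The threshold is taken
  low enough for the remaining 71/100 to be below 3/4.\<close>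

lemma paley_zygmund_signs:
  assumes "(\<Sum>i<n. (v i)\<^sup>2) > 0"
  shows "card {x \<in> signs n. 16 * (ip n x v)\<^sup>2 \<le> (\<Sum>i<n. (v i)\<^sup>2)} \<le> 71/100 * 2 ^ n"
proof -
  define V where "V = (\<Sum>i<n. (v i)\<^sup>2)"
  define A where "A = {x \<in> signs n. 16 * (ip n x v)\<^sup>2 \<le> V}"
  define C where "C = signs n - A"
  have V: "V > 0" using assms by (simp add: V_def)
  have fin: "finite A" "finite C" by (auto simp: A_def C_def)
  have split: "A \<union> C = signs n" "A \<inter> C = {}" by (auto simp: A_def C_def)
  have cards: "card A + card C = 2 ^ n"
    using card_Un_disjoint[OF fin split(2)] split(1) by (simp add: card_signs)
  have "2 ^ n * V = (\<Sum>x\<in>A. (ip n x v)\<^sup>2) + (\<Sum>x\<in>C. (ip n x v)\<^sup>2)"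
    unfolding V_def second_moment[symmetric] split(1)[symmetric] by (rule sum.union_disjoint[OF fin split(2)])
  also have "(\<Sum>x\<in>A. (ip n x v)\<^sup>2) \<le> (\<Sum>x\<in>A. V / 16)" by (intro sum_mono) (auto simp: A_def)
  also have "... = card A * (V / 16)" by simp
  also have "... \<le> 2 ^ n * (V / 16)"
  proof (intro mult_right_mono)
    have "card A \<le> 2 ^ n" using cards by simp
    then show "real (card A) \<le> 2 ^ n" by (metis of_nat_le_iff of_nat_numeral of_nat_power)
  qed (use V in simp)
  finally have l: "15/16 * (2 ^ n * V) \<le> (\<Sum>x\<in>C. (ip n x v)\<^sup>2)" by simp
  then have "(15/16 * (2 ^ n * V))\<^sup>2 \<le> (\<Sum>x\<in>C. 1 * (ip n x v)\<^sup>2)\<^sup>2"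
    using V by (intro power_mono) auto
  also have "... \<le> (\<Sum>x\<in>C. 1\<^sup>2) * (\<Sum>x\<in>C. ((ip n x v)\<^sup>2)\<^sup>2)" by (rule Cauchy_Schwarz_ineq_sum)
  also have "... = card C * (\<Sum>x\<in>C. (ip n x v) ^ 4)" by simp
  also have "... \<le> card C * (\<Sum>x\<in>signs n. (ip n x v) ^ 4)"
    by (intro mult_left_mono sum_mono2) (auto simp: C_def)
  also have "... \<le> card C * (2 ^ n * (3 * V\<^sup>2))"
    unfolding V_def by (intro mult_left_mono fourth_moment) auto
  finally have "2 ^ n * V\<^sup>2 * (225/256 * 2 ^ n) \<le> 2 ^ n * V\<^sup>2 * (3 * card C)"
    by (simp add: power2_eq_square mult_ac)
  then have "225/256 * 2 ^ n \<le> 3 * real (card C)" using V by (subst (asm) mult_le_cancel_left_pos) auto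
  moreover have "real (card A) + real (card C) = 2 ^ n"
    using cards by (metis of_nat_add of_nat_numeral of_nat_power)
  ultimately have "real (card A) \<le> 71/100 * 2 ^ n" by simp
  then show ?thesis by (simp add: A_def V_def)
qed

lemma card_rows_le:
  fixes \<beta> :: real
  assumes I: "finite I" and W: "finite W" and S: "\<And>w. w \<in> W \<Longrightarrow> S w \<subseteq> signs n \<and> card (S w) \<le> \<beta> * 2 ^ n"
  shows "card {R \<in> sign_rows I n. \<exists>w\<in>W. \<forall>j\<in>I. R j \<in> S w} \<le> card W * (\<beta> * 2 ^ n) ^ card I"
proof -
  have "{R \<in> sign_rows I n. \<exists>w\<in>W. \<forall>j\<in>I. R j \<in> S w} \<subseteq> (\<Union>w\<in>W. PiE I (\<lambda>_. S w))"
  proof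
    fix R assume "R \<in> {R \<in> sign_rows I n. \<exists>w\<in>W. \<forall>j\<in>I. R j \<in> S w}"
    then obtain w where w: "w \<in> W" "\<forall>j\<in>I. R j \<in> S w" and R: "R \<in> sign_rows I n" by auto
    have "R \<in> PiE I (\<lambda>_. S w)" using w R by (simp add: PiE_iff)
    then show "R \<in> (\<Union>w\<in>W. PiE I (\<lambda>_. S w))" using w by blast
  qed
  moreover have fin: "finite (\<Union>w\<in>W. PiE I (\<lambda>_. S w))"
    using W I S by (intro finite_UN_I finite_PiE) (auto intro: finite_subset[OF _ finite_signs])
  ultimately have "card {R \<in> sign_rows I n. \<exists>w\<in>W. \<forall>j\<in>I. R j \<in> S w} \<le> card (\<Union>w\<in>W. PiE I (\<lambda>_. S w))"
    by (rule card_mono[rotated])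
  also have "... \<le> (\<Sum>w\<in>W. card (PiE I (\<lambda>_. S w)))" by (rule card_UN_le[OF W])
  also have "... = (\<Sum>w\<in>W. card (S w) ^ card I)" using I by (simp add: card_PiE)
  finally have "real (card {R \<in> sign_rows I n. \<exists>w\<in>W. \<forall>j\<in>I. R j \<in> S w}) \<le>
      real (\<Sum>w\<in>W. card (S w) ^ card I)" by (simp only: of_nat_le_iff)
  also have "... = (\<Sum>w\<in>W. real (card (S w)) ^ card I)" by simp
  also have "... \<le> (\<Sum>w\<in>W. (\<beta> * 2 ^ n) ^ card I)" using S by (intro sum_mono power_mono) auto
  finally show ?thesis by simp
qed

section \<open>Sparse integer vectors, the net for compressible directions\<close>

definition sparse_vectors :: "nat \<Rightarrow> nat \<Rightarrow> nat \<Rightarrow> (nat \<Rightarrow> int) set" where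
  "sparse_vectors n B D = {w \<in> PiE {..<n} (\<lambda>_. {-int B..int B}). card {i \<in> {..<n}. w i \<noteq> 0} \<le> D}"

lemma finite_sparse_vectors: "finite (sparse_vectors n B D)"
  unfolding sparse_vectors_def
  by (rule finite_subset[of _ "PiE {..<n} (\<lambda>_. {-int B..int B})"]) (auto intro: finite_PiE)

lemma card_sparse_vectors_le: "card (sparse_vectors n B D) \<le> ((n + 1) * (2 * B + 1)) ^ D"
proof -
  define L where "L = {xs. set xs \<subseteq> {..n} \<and> length xs = D}"
  define F where "F = (\<lambda>xs. PiE {..<n} (\<lambda>i. if i \<in> set xs then {-int B..int B} else {0::int}))"
  have finL: "finite L" unfolding L_def by (rule finite_lists_length_eq) simp
  have finF: "finite (F xs)" for xs unfolding F_def by (rule finite_PiE) auto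
  have "sparse_vectors n B D \<subseteq> (\<Union>xs\<in>L. F xs)"
  proof
    fix w assume w: "w \<in> sparse_vectors n B D"
    define xs where "xs = sorted_list_of_set {i \<in> {..<n}. w i \<noteq> 0}"
    \<comment> \<open>The support is listed and padded to length \<open>D\<close> with the dummy
      index \<open>n\<close>, hence \<open>n + 1\<close> choices per place.\<close>
    define ys where "ys = xs @ replicate (D - length xs) n"
    have wP: "w \<in> PiE {..<n} (\<lambda>_. {-int B..int B})" using w by (simp add: sparse_vectors_def)
    have xs: "set xs = {i \<in> {..<n}. w i \<noteq> 0}" "length xs \<le> D"
      using w by (simp_all add: xs_def sparse_vectors_def)
    have "set ys \<subseteq> set xs \<union> {n}" by (auto simp: ys_def set_replicate_conv_if)
    also have "... \<subseteq> {..n}" unfolding xs(1) by auto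
    finally have sub: "set ys \<subseteq> {..n}" .
    have len: "length ys = D" unfolding ys_def length_append length_replicate using xs(2) by linarith
    have "ys \<in> L" unfolding L_def using sub len by blast
    moreover have "w \<in> F ys" unfolding F_def
    proof (rule PiE_I)
      fix i assume i: "i \<in> {..<n}"
      then have "w i \<in> {-int B..int B}" by (rule PiE_mem[OF wP])
      moreover have "w i = 0" if "i \<notin> set ys"
      proof -
        have "i \<notin> set xs" using that by (simp add: ys_def)
        then show ?thesis using i unfolding xs(1) by simp
      qed
      ultimately show "w i \<in> (if i \<in> set ys then {-int B..int B} else {0})" by simp
    qed (rule PiE_arb[OF wP])
    ultimately show "w \<in> (\<Union>xs\<in>L. F xs)" by blast
  qed
  then have "card (sparse_vectors n B D) \<le> card (\<Union>xs\<in>L. F xs)"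
    using finL finF by (intro card_mono) auto
  also have "... \<le> (\<Sum>xs\<in>L. card (F xs))" by (rule card_UN_le[OF finL])
  also have "... \<le> (\<Sum>xs\<in>L. (2 * B + 1) ^ D)"
  proof (intro sum_mono)
    fix xs assume xs: "xs \<in> L"
    have "card (F xs) = (\<Prod>i<n. if i \<in> set xs then 2 * B + 1 else 1)"
      unfolding F_def by (subst card_PiE) (auto intro!: prod.cong)
    also have "... = (2 * B + 1) ^ card ({..<n} \<inter> set xs)" by (simp add: prod.If_cases)
    also have "... \<le> (2 * B + 1) ^ D"
    proof (intro power_increasing)
      have "card ({..<n} \<inter> set xs) \<le> card (set xs)" by (intro card_mono) auto
      also have "... \<le> D" using xs card_length[of xs] by (simp add: L_def)
      finally show "card ({..<n} \<inter> set xs) \<le> D" .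
    qed simp
    finally show "card (F xs) \<le> (2 * B + 1) ^ D" .
  qed
  also have "... = ((n + 1) * (2 * B + 1)) ^ D"
    by (simp only: sum_constant L_def card_lists_length_eq[OF finite_atMost] card_atMost power_mult_distrib) simp
  finally show ?thesis .
qed

lemma abs_le_of_sum_squares:
  fixes v :: "nat \<Rightarrow> real"
  assumes "(\<Sum>i<n. (v i)\<^sup>2) = real n" "n \<le> m\<^sup>2" "i < n"
  shows "\<bar>v i\<bar> \<le> real m"
proof -
  have "(v i)\<^sup>2 \<le> (\<Sum>i<n. (v i)\<^sup>2)" using assms by (intro member_le_sum) auto
  also have "... \<le> real (m\<^sup>2)" using assms by (simp only: of_nat_le_iff)
  finally have "(v i)\<^sup>2 \<le> (real m)\<^sup>2" by simp
  then show ?thesis by (rule abs_le_square_iff[THEN iffD2, of "v i" "real m", simplified])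
qed

text \<open>After scaling by \<open>9 * G\<close> the rounded vector is long enough compared with
  the row errors for \<open>paley_zygmund_signs\<close> to apply, while coordinates below
  \<open>1 / G^2\<close> become so small that most round to 0. The net has about
  \<open>38 * n / G\<close> free coordinates, a negligible entropy against
  \<open>(71/100) ^ n\<close> once \<open>G\<close> is well above log n.\<close>

lemma card_compressible_le:
  fixes n m G D :: nat
  assumes n: "n \<ge> 1" and m: "n \<le> m\<^sup>2" "m\<^sup>2 \<le> 4 * n" and G: "G \<ge> 1" "G \<le> n" and I: "finite I" "card I \<le> n"
    and small: "24 * n * exp (- real G) \<le> 1" and D: "38 * n \<le> D * G"
  shows "card {R \<in> sign_rows I n. \<exists>v :: nat \<Rightarrow> real. (\<Sum>i<n. (v i)\<^sup>2) = real n \<and>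
      card {i \<in> {..<n}. real G ^ 2 * \<bar>v i\<bar> \<ge> 1} * G\<^sup>2 \<le> n \<and> (\<forall>j\<in>I. ip n (R j) v = 0)}
    \<le> real ((n + 1) * (20 * G * m + 1)) ^ D * (71/100 * 2 ^ n) ^ card I"
proof -
  define W where "W = {w \<in> sparse_vectors n (10 * G * m) D. (\<Sum>i<n. (real_of_int (w i))\<^sup>2) > 0}"
  define S where "S = (\<lambda>w. {x \<in> signs n. 16 * (ip n x w)\<^sup>2 \<le> (\<Sum>i<n. (real_of_int (w i))\<^sup>2)})"
  have m1: "m \<ge> 1" using n m by (cases m) auto
  have finW: "finite W" by (simp add: W_def finite_sparse_vectors)
  let ?X = "{R \<in> sign_rows I n. \<exists>v :: nat \<Rightarrow> real. (\<Sum>i<n. (v i)\<^sup>2) = real n \<and>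
      card {i \<in> {..<n}. real G ^ 2 * \<bar>v i\<bar> \<ge> 1} * G\<^sup>2 \<le> n \<and> (\<forall>j\<in>I. ip n (R j) v = 0)}"
  have "?X \<subseteq> {R \<in> sign_rows I n. \<exists>w\<in>W. \<forall>j\<in>I. R j \<in> S w}"
  proof
    fix R assume "R \<in> ?X"
    then obtain v :: "nat \<Rightarrow> real" where R: "R \<in> sign_rows I n" and v: "(\<Sum>i<n. (v i)\<^sup>2) = real n"
      "card {i \<in> {..<n}. real G ^ 2 * \<bar>v i\<bar> \<ge> 1} * G\<^sup>2 \<le> n" "\<And>j. j \<in> I \<Longrightarrow> ip n (R j) v = 0" by blast
    define u where "u = (\<lambda>i. (9 * real G) * v i)"
    define T where "T = {i \<in> {..<n}. real G ^ 2 * \<bar>v i\<bar> < 1}"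
    have T: "T \<subseteq> {..<n}" "finite T" by (auto simp: T_def)
    have RI: "R ` I \<subseteq> signs n" using R by (auto simp: PiE_iff)
    have cR: "card (R ` I) \<le> n" using card_image_le[OF I(1), of R] I(2) by simp
    have c1: "real m \<le> real (G * m)"
    proof -
      have "1 * m \<le> G * m" using G by (intro mult_right_mono) auto
      then show ?thesis by (simp only: of_nat_le_iff mult_1)
    qed
    have c2: "real (card (R ` I)) * exp (- real (G * m) / real m) * 24 \<le> 1"
    proof -
      have e: "exp (- real (G * m) / real m) = exp (- real G)" using m1 by simp
      have "real (card (R ` I)) * exp (- real G) * 24 \<le> real n * exp (- real G) * 24"
        using cR by (intro mult_right_mono) auto
      then show ?thesis unfolding e using small by linarith
    qed
    have c3: "finite (R ` I)" using I by simp
    obtain w :: "nat \<Rightarrow> int" where w: "\<And>i. i < n \<Longrightarrow> \<bar>w i - u i\<bar> \<le> 1"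
      "\<And>x. x \<in> R ` I \<Longrightarrow> \<bar>ip n x (\<lambda>i. w i - u i)\<bar> \<le> real (G * m)"
      "conc n (real (G * m)) w \<le> 18 * conc n (real (G * m)) u"
      "conc n (real (G * m)) u \<le> 18 * conc n (real (G * m)) w"
      "(\<Sum>i\<in>T. \<bar>w i\<bar>) \<le> 4 * (\<Sum>i\<in>T. \<bar>u i\<bar>) + 1"
      by (rule rounding[OF m(1) m1 c1 c3 RI c2 T(1), of u]) blast
    define w' where "w' = restrict w {..<n}"
    have ipw': "ip n x w' = ip n x w" for x
      by (simp add: ip_def w'_def)
    have sq': "(\<Sum>i<n. (real_of_int (w' i))\<^sup>2) = (\<Sum>i<n. (real_of_int (w i))\<^sup>2)"
      by (simp add: w'_def)
    \<comment> \<open>Rounding moves the vector by at most \<open>sqrt n \<le> G * sqrt n\<close>,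
      so 8 of the 9 remain. Then \<open>16 * (G * m)^2 \<le> (8 * G)^2 * n\<close> is what the
      threshold 1/16 asks for.\<close>
    have big: "(8 * real G)\<^sup>2 * n \<le> (\<Sum>i<n. (real_of_int (w i))\<^sup>2)"
    proof -
      have "sqrt (\<Sum>i<n. (u i)\<^sup>2) \<le> sqrt (\<Sum>i<n. (real_of_int (w i))\<^sup>2) + sqrt (\<Sum>i<n. (u i - w i)\<^sup>2)"
        using L2_set_triangle_ineq[of "\<lambda>i. real_of_int (w i)" "\<lambda>i. u i - w i" "{..<n}"]
        by (simp add: L2_set_def)
      moreover have "sqrt (\<Sum>i<n. (u i)\<^sup>2) = 9 * real G * sqrt n"
        by (simp add: u_def power_mult_distrib sum_distrib_left[symmetric] v(1) real_sqrt_mult)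
      moreover have "sqrt (\<Sum>i<n. (u i - w i)\<^sup>2) \<le> sqrt n"
      proof -
        have "(\<Sum>i<n. (u i - w i)\<^sup>2) \<le> (\<Sum>i<n. 1)"
        proof (intro sum_mono)
          fix i assume "i \<in> {..<n}"
          then have "\<bar>u i - w i\<bar> \<le> 1" using w(1)[of i] by simp
          then show "(u i - w i)\<^sup>2 \<le> 1" by (simp add: abs_square_le_1)
        qed
        then show ?thesis by simp
      qed
      moreover have "1 * sqrt n \<le> real G * sqrt n" using G by (intro mult_right_mono) auto
      ultimately have l: "8 * real G * sqrt n \<le> sqrt (\<Sum>i<n. (real_of_int (w i))\<^sup>2)" by linarith
      have "(8 * real G * sqrt n)\<^sup>2 \<le> (sqrt (\<Sum>i<n. (real_of_int (w i))\<^sup>2))\<^sup>2" by (rule power_mono[OF l]) simp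
      then show ?thesis by (simp add: power_mult_distrib sum_nonneg)
    qed
    have "w' \<in> W"
    proof -
      have wle: "\<bar>w i\<bar> \<le> int (10 * G * m)" if i: "i < n" for i
      proof -
        have "\<bar>real_of_int (w i)\<bar> \<le> \<bar>u i\<bar> + 1" using w(1)[OF i] by linarith
        also have "... \<le> 9 * real G * m + 1 * 1"
          using abs_le_of_sum_squares[OF v(1) m(1) i] by (simp add: u_def abs_mult mult_left_mono)
        also have "... \<le> 9 * real G * m + real G * m"
          using G m1 by (intro add_left_mono mult_mono) auto
        finally have "real_of_int \<bar>w i\<bar> \<le> real_of_int (int (10 * G * m))" by simp
        then show ?thesis by (simp only: of_int_le_iff)
      qed
      have box: "w' \<in> PiE {..<n} (\<lambda>_. {-int (10 * G * m)..int (10 * G * m)})"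
      proof (intro PiE_I)
        fix i assume "i \<in> {..<n}"
        then have "\<bar>w' i\<bar> \<le> int (10 * G * m)"
          using wle[of i] by (simp add: w'_def)
        then show "w' i \<in> {-int (10 * G * m)..int (10 * G * m)}" by (simp only: atLeastAtMost_iff abs_le_iff minus_le_iff simp_thms)
      qed (simp add: w'_def)
      have "card {i \<in> {..<n}. w' i \<noteq> 0} \<le> D"
      proof -
        define A where "A = {i \<in> {..<n}. real G ^ 2 * \<bar>v i\<bar> \<ge> 1}"
        define Z where "Z = {i \<in> T. w i \<noteq> 0}"
        have "{i \<in> {..<n}. w' i \<noteq> 0} \<subseteq> A \<union> Z" by (auto simp: A_def Z_def T_def w'_def)
        then have "card {i \<in> {..<n}. w' i \<noteq> 0} \<le> card (A \<union> Z)"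
          using T by (intro card_mono) (auto simp: A_def Z_def)
        also have "... \<le> card A + card Z" by (rule card_Un_le)
        finally have 1: "card {i \<in> {..<n}. w' i \<noteq> 0} \<le> card A + card Z" .
        \<comment> \<open>Nonzero integers have modulus at least 1, so the l1 bound counts them: at
          most \<open>36 * n / G + 1\<close>. With at most \<open>n / G\<close> large coordinates
          this makes up the 38 in the hypothesis on \<open>D\<close>.\<close>
        have "real (card Z) = (\<Sum>i\<in>Z. 1)" by simp
        also have "... \<le> (\<Sum>i\<in>Z. \<bar>real_of_int (w i)\<bar>)"
        proof (intro sum_mono)
          fix i assume "i \<in> Z"
          then have "w i \<noteq> 0" by (simp add: Z_def)
          then show "1 \<le> \<bar>real_of_int (w i)\<bar>" by linarith
        qed
        also have "... \<le> (\<Sum>i\<in>T. \<bar>real_of_int (w i)\<bar>)" using T by (intro sum_mono2) (auto simp: Z_def)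
        also have "... \<le> 4 * (\<Sum>i\<in>T. \<bar>u i\<bar>) + 1" using w(5) by simp
        also have "(\<Sum>i\<in>T. \<bar>u i\<bar>) \<le> (\<Sum>i\<in>T. 9 / real G)"
        proof (intro sum_mono)
          fix i assume "i \<in> T"
          then have "real G * (real G * \<bar>v i\<bar>) \<le> 1" by (simp add: T_def power2_eq_square mult_ac)
          then have "real G * \<bar>v i\<bar> \<le> 1 / real G" using G by (simp add: field_simps)
          then show "\<bar>u i\<bar> \<le> 9 / real G" by (simp add: u_def abs_mult)
        qed
        also have "... \<le> n * (9 / real G)"
        proof -
          have "card T \<le> n" using card_mono[OF _ T(1)] by simp
          then show ?thesis using G by (simp add: divide_right_mono)
        qed
        finally have "real (card Z) \<le> 36 * n / G + 1" by simp
        then have "real (card Z) * G \<le> (36 * n / G + 1) * G" by (intro mult_right_mono) auto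
        also have "... = 36 * n + G" using G by (simp add: field_simps)
        finally have 2: "real (card Z) * G \<le> 37 * n" using G by simp
        have "card A * G * 1 \<le> card A * G * G" using G by (intro mult_left_mono) auto
        also have "... \<le> n" using v(2) by (simp add: A_def power2_eq_square mult_ac)
        finally have "real (card A * G) \<le> real n" by (simp only: of_nat_le_iff mult_1_right)
        then have "real (card A + card Z) * G \<le> 38 * n" using 2 by (simp add: distrib_right)
        also have "... \<le> real (D * G)" using D by (metis of_nat_le_iff of_nat_mult of_nat_numeral)
        finally have "real (card A + card Z) \<le> real D" using G by simp
        then show ?thesis using 1 by simp
      qed
      moreover have "(\<Sum>i<n. (real_of_int (w' i))\<^sup>2) > 0"
      proof -
        have "0 < (8 * real G)\<^sup>2 * n" using n G by simp
        then show ?thesis unfolding sq' using big by (rule less_le_trans)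
      qed
      ultimately show ?thesis using box by (simp add: W_def sparse_vectors_def)
    qed
    moreover have "R j \<in> S w'" if j: "j \<in> I" for j
    proof -
      have "\<bar>ip n (R j) w\<bar> \<le> real (G * m)"
        using w(2)[of "R j"] v(3)[OF j] j by (simp add: ip_diff_right u_def ip_scale_right)
      then have "(ip n (R j) w)\<^sup>2 \<le> (real (G * m))\<^sup>2"
        by (simp add: abs_le_square_iff[symmetric])
      then have "16 * (ip n (R j) w)\<^sup>2 \<le> 16 * (real (G * m))\<^sup>2" by simp
      also have "... = 16 * real G ^ 2 * real (m\<^sup>2)" by (simp add: power_mult_distrib)
      also have "... \<le> 16 * real G ^ 2 * real (4 * n)" using m by (intro mult_left_mono) (simp_all only: of_nat_le_iff, simp)
      also have "... = (8 * real G)\<^sup>2 * n" by (simp add: power_mult_distrib)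
      also note big
      finally show ?thesis using R j by (auto simp: S_def ipw' sq')
    qed
    ultimately show "R \<in> {R \<in> sign_rows I n. \<exists>w\<in>W. \<forall>j\<in>I. R j \<in> S w}" using R by blast
  qed
  moreover have "finite {R \<in> sign_rows I n. \<exists>w\<in>W. \<forall>j\<in>I. R j \<in> S w}"
    by (rule finite_subset[OF _ finite_PiE[OF I(1), of "\<lambda>_. signs n"]]) auto
  ultimately have "real (card ?X) \<le> real (card {R \<in> sign_rows I n. \<exists>w\<in>W. \<forall>j\<in>I. R j \<in> S w})"
    by (intro of_nat_mono card_mono)
  also have "... \<le> card W * (71/100 * 2 ^ n) ^ card I"
  proof (rule card_rows_le[OF I(1) finW])
    fix w assume "w \<in> W"
    then have pos: "(\<Sum>i<n. (real_of_int (w i))\<^sup>2) > 0" by (simp add: W_def)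
    have "S w \<subseteq> signs n" by (auto simp: S_def)
    moreover have "real (card (S w)) \<le> 71/100 * 2 ^ n"
      unfolding S_def by (rule paley_zygmund_signs[OF pos])
    ultimately show "S w \<subseteq> signs n \<and> real (card (S w)) \<le> 71/100 * 2 ^ n" ..
  qed
  also have "... \<le> real ((n + 1) * (20 * G * m + 1)) ^ D * (71/100 * 2 ^ n) ^ card I"
  proof (intro mult_right_mono)
    have "card W \<le> card (sparse_vectors n (10 * G * m) D)"
      unfolding W_def by (intro card_mono finite_sparse_vectors) auto
    also have "... \<le> ((n + 1) * (2 * (10 * G * m) + 1)) ^ D" by (rule card_sparse_vectors_le)
    finally have "card W \<le> ((n + 1) * (20 * G * m + 1)) ^ D" by (simp add: mult.assoc)
    then show "real (card W) \<le> real ((n + 1) * (20 * G * m + 1)) ^ D" by (metis of_nat_le_iff of_nat_power)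
  qed simp
  finally show ?thesis .
qed

subsection \<open>Structured normal vectors\<close>

lemma card_le_sum_squares:
  fixes v :: "nat \<Rightarrow> real" and c :: real
  assumes "(\<Sum>i<n. (v i)\<^sup>2) = real n" "c \<ge> 0"
  shows "card {i \<in> {..<n}. \<bar>v i\<bar> \<ge> c} * c\<^sup>2 \<le> n"
proof -
  have "card {i \<in> {..<n}. \<bar>v i\<bar> \<ge> c} * c\<^sup>2 = (\<Sum>i\<in>{i \<in> {..<n}. \<bar>v i\<bar> \<ge> c}. c\<^sup>2)" by simp
  also have "... \<le> (\<Sum>i\<in>{i \<in> {..<n}. \<bar>v i\<bar> \<ge> c}. \<bar>v i\<bar>\<^sup>2)"
    using assms by (intro sum_mono power_mono) auto
  also have "... = (\<Sum>i\<in>{i \<in> {..<n}. \<bar>v i\<bar> \<ge> c}. (v i)\<^sup>2)" by simp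
  also have "... \<le> (\<Sum>i<n. (v i)\<^sup>2)" by (intro sum_mono2) auto
  finally show ?thesis using assms by simp
qed

text \<open>For the multiple \<open>K\<close> the sign vectors orthogonal to \<open>v\<close> alone
  give enough concentration. At the least suitable \<open>N\<close>, failure at \<open>N - 1\<close>
  and \<open>conc_antimono_scale\<close> yield the upper bound, where 2 covers
  \<open>N / (N - 1)\<close>; and \<open>g \<le> N\<close> because \<open>conc\<close> never exceeds
  1.\<close>

lemma scale_exists:
  fixes v :: "nat \<Rightarrow> real" and K :: nat and \<tau> g s :: real
  assumes s: "s > 0" and \<tau>: "\<tau> > 0" "\<tau> * 2 ^ n \<le> card {x \<in> signs n. ip n x v = 0}"
    and g: "g \<ge> 2" "g \<le> \<tau> * K"
  obtains N :: nat where "N \<ge> 1" "N \<le> K" "g \<le> N"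
    "g / N \<le> conc n s (\<lambda>i. real N * v i)" "conc n s (\<lambda>i. real N * v i) \<le> 2 * g / N"
proof -
  define P where "P = (\<lambda>N::nat. g \<le> N * conc n s (\<lambda>i. real N * v i))"
  have "P K"
  proof -
    have "{x \<in> signs n. ip n x v = 0} \<subseteq> {x \<in> signs n. ip n x (\<lambda>i. real K * v i) = 0}"
      by (auto simp: ip_scale_right)
    then have "card {x \<in> signs n. ip n x v = 0} \<le> card {x \<in> signs n. ip n x (\<lambda>i. real K * v i) = 0}"
      by (intro card_mono) auto
    then have "real (card {x \<in> signs n. ip n x v = 0}) \<le> conc n s (\<lambda>i. real K * v i) * 2 ^ n"
      using card_signs_zero_le_conc[of n "\<lambda>i. real K * v i" s] by linarith
    then have "\<tau> * 2 ^ n \<le> conc n s (\<lambda>i. real K * v i) * 2 ^ n" using \<tau>(2) by linarith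
    then have "\<tau> \<le> conc n s (\<lambda>i. real K * v i)" by simp
    then have "K * \<tau> \<le> K * conc n s (\<lambda>i. real K * v i)" by (intro mult_left_mono) auto
    then show ?thesis using g by (simp add: P_def mult.commute)
  qed
  define N where "N = (LEAST N. P N)"
  have PN: "P N" unfolding N_def by (rule LeastI[of P]) fact
  have NK: "N \<le> K" unfolding N_def by (rule Least_le) fact
  have "real N * conc n s (\<lambda>i. real N * v i) \<le> real N * 1" by (intro mult_left_mono conc_le_1 s) auto
  then have gN: "g \<le> N" using PN by (simp add: P_def)
  then have N2: "N \<ge> 2" using g by linarith
  have "\<not> P (N - 1)" unfolding N_def by (rule not_less_Least) (use N2 in \<open>simp add: N_def\<close>)
  then have "(real N - 1) * conc n s (\<lambda>i. real (N - 1) * v i) < g" using N2 by (simp add: P_def of_nat_diff)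
  moreover have "(real N - 1) * conc n s (\<lambda>i. real N * v i) \<le> (real N - 1) * conc n s (\<lambda>i. real (N - 1) * v i)"
    using N2 s by (intro mult_left_mono conc_antimono_scale) auto
  ultimately have "(real N - 1) * conc n s (\<lambda>i. real N * v i) \<le> g" by linarith
  moreover have "real N / 2 * conc n s (\<lambda>i. real N * v i) \<le> (real N - 1) * conc n s (\<lambda>i. real N * v i)"
    using N2 conc_pos[of n s "\<lambda>i. real N * v i"] by (intro mult_right_mono) auto
  ultimately have up: "conc n s (\<lambda>i. real N * v i) \<le> 2 * g / N" using N2 by (simp add: field_simps)
  have lo: "g / N \<le> conc n s (\<lambda>i. real N * v i)" using PN N2 by (simp add: P_def field_simps)
  show thesis using that[of N] N2 NK gN lo up by simp
qed

text \<open>By Chebyshev at most \<open>4 * n / G ^ 4 \<le> n / (2 * G^2)\<close> coordinates reach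
  \<open>G^2 / 2\<close>, so of the at least \<open>n / G^2\<close> coordinates above
  \<open>1 / G^2\<close> half that number stay in the bulk. The rounding error is absorbed by
  \<open>N / G^2 - 1 \<ge> N / (2 * G^2)\<close>.\<close>

lemma rounding_mem_bad_vectors:
  fixes v :: "nat \<Rightarrow> real" and w :: "nat \<Rightarrow> int"
  assumes n: "n \<ge> 1" and m: "n \<le> m\<^sup>2" and G: "G \<ge> 3" and N: "2 * G\<^sup>2 \<le> N"
    and v: "(\<Sum>i<n. (v i)\<^sup>2) = real n" "n \<le> card {i \<in> {..<n}. real G ^ 2 * \<bar>v i\<bar> \<ge> 1} * G\<^sup>2"
    and w: "\<And>i. i < n \<Longrightarrow> \<bar>w i - real N * v i\<bar> \<le> 1"
    and conc: "conc n (real (G * m)) w \<ge> 192 * real G ^ 5 / real N"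
  shows "restrict w {..<n} \<in> bad_vectors n m G N"
proof -
  have m1: "m \<ge> 1" using n m by (cases m) auto
  have G1: "G \<ge> 1" using G by simp
  have G2: "9 \<le> real G ^ 2" using power_mono[of 3 "real G" 2] G by simp
  have N1: "N \<ge> 1" using N G by (cases N) auto
  have "real (2 * G\<^sup>2) \<le> real N" using N by (simp only: of_nat_le_iff)
  then have Nr: "2 * real G ^ 2 \<le> real N" by simp
  have Nv: "\<bar>real N * v i\<bar> = N * \<bar>v i\<bar>" for i by (simp add: abs_mult)
  have up: "\<bar>real_of_int (w i)\<bar> \<le> N * \<bar>v i\<bar> + 1" if "i < n" for i
    using w[OF that] Nv[of i] by linarith
  have lo: "N * \<bar>v i\<bar> - 1 \<le> \<bar>real_of_int (w i)\<bar>" if "i < n" for i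
    using w[OF that] Nv[of i] by linarith
  define A where "A = {i \<in> {..<n}. real G ^ 2 * \<bar>v i\<bar> \<ge> 1}"
  define Ex where "Ex = {i \<in> {..<n}. \<bar>w i\<bar> > int (N * G\<^sup>2)}"
  define Bk where "Bk = {i \<in> {..<n}. int N \<le> 2 * int (G\<^sup>2) * \<bar>w i\<bar> \<and> \<bar>w i\<bar> \<le> int (N * G\<^sup>2)}"
  have fin: "finite A" "finite Ex" "finite Bk" by (simp_all add: A_def Ex_def Bk_def)
  have box: "w i \<in> {-int (2 * N * m)..int (2 * N * m)}" if i: "i < n" for i
  proof -
    have "\<bar>real_of_int (w i)\<bar> \<le> N * \<bar>v i\<bar> + 1" by (rule up[OF i])
    also have "... \<le> real N * m + 1 * 1"
      using abs_le_of_sum_squares[OF v(1) m i] by (intro add_mono mult_left_mono) auto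
    also have "... \<le> real N * m + real N * m" using N1 m1 by (intro add_left_mono mult_mono) auto
    finally have "real_of_int \<bar>w i\<bar> \<le> real_of_int (int (2 * N * m))" by simp
    then have "\<bar>w i\<bar> \<le> int (2 * N * m)" by (simp only: of_int_le_iff)
    then show ?thesis by (simp only: atLeastAtMost_iff abs_le_iff minus_le_iff simp_thms)
  qed
  have Ex: "card Ex * G ^ 4 \<le> 4 * n"
  proof -
    have "Ex \<subseteq> {i \<in> {..<n}. \<bar>v i\<bar> \<ge> real G ^ 2 / 2}"
    proof
      fix i assume "i \<in> Ex"
      then have i: "i < n" "int (N * G\<^sup>2) < \<bar>w i\<bar>" by (auto simp: Ex_def)
      have "real_of_int (int (N * G\<^sup>2)) < real_of_int \<bar>w i\<bar>" using i(2) by (simp only: of_int_less_iff)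
      then have "real N * real G ^ 2 < N * \<bar>v i\<bar> + 1" using up[OF i(1)] by simp
      moreover have "1 * 1 \<le> real N * (real G ^ 2 / 2)" using N1 G2 by (intro mult_mono) auto
      ultimately have "real N * (real G ^ 2 / 2) \<le> real N * \<bar>v i\<bar>" by (simp add: field_simps)
      then have "real G ^ 2 / 2 \<le> \<bar>v i\<bar>" using N1 by (subst (asm) mult_le_cancel_left_pos) auto
      then show "i \<in> {i \<in> {..<n}. \<bar>v i\<bar> \<ge> real G ^ 2 / 2}" using i by simp
    qed
    then have "card Ex \<le> card {i \<in> {..<n}. \<bar>v i\<bar> \<ge> real G ^ 2 / 2}" by (intro card_mono) auto
    then have "real (card Ex) * (real G ^ 2 / 2)\<^sup>2 \<le> card {i \<in> {..<n}. \<bar>v i\<bar> \<ge> real G ^ 2 / 2} * (real G ^ 2 / 2)\<^sup>2"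
      by (intro mult_right_mono) auto
    also have "... \<le> n" by (rule card_le_sum_squares[OF v(1)]) simp
    finally have "real (card Ex * G ^ 4) \<le> real (4 * n)" by (simp add: power_divide flip: power_mult)
    then show ?thesis by (simp only: of_nat_le_iff)
  qed
  have Bk: "n \<le> 2 * G\<^sup>2 * card Bk"
  proof -
    have "A \<subseteq> Bk \<union> Ex"
    proof
      fix i assume "i \<in> A"
      then have i: "i < n" "1 \<le> real G ^ 2 * \<bar>v i\<bar>" by (auto simp: A_def)
      have "real N * 1 \<le> real N * (real G ^ 2 * \<bar>v i\<bar>)" using i by (intro mult_left_mono) auto
      moreover have "2 * real G ^ 2 * (N * \<bar>v i\<bar> - 1) \<le> 2 * real G ^ 2 * \<bar>real_of_int (w i)\<bar>"
        by (intro mult_left_mono lo i) auto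
      ultimately have "real N \<le> 2 * real G ^ 2 * \<bar>real_of_int (w i)\<bar>" using Nr by (simp add: algebra_simps)
      then have "real_of_int (int N) \<le> real_of_int (2 * int (G\<^sup>2) * \<bar>w i\<bar>)" by simp
      then have "int N \<le> 2 * int (G\<^sup>2) * \<bar>w i\<bar>" by (simp only: of_int_le_iff)
      then show "i \<in> Bk \<union> Ex" using i(1) by (auto simp: Bk_def Ex_def)
    qed
    then have "card A \<le> card (Bk \<union> Ex)" using fin by (intro card_mono) auto
    also have "... \<le> card Bk + card Ex" by (rule card_Un_le)
    finally have "card A * G\<^sup>2 \<le> (card Bk + card Ex) * G\<^sup>2" by (intro mult_right_mono) auto
    with v(2)[folded A_def] have "n \<le> (card Bk + card Ex) * G\<^sup>2" by (rule order_trans)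
    then have "real n \<le> real ((card Bk + card Ex) * G\<^sup>2)" by (simp only: of_nat_le_iff)
    then have 1: "real n \<le> card Bk * real G ^ 2 + card Ex * real G ^ 2" by (simp add: algebra_simps)
    have "real (card Ex * G ^ 4) \<le> real (4 * n)" using Ex by (simp only: of_nat_le_iff)
    then have "(card Ex * real G ^ 2) * real G ^ 2 \<le> 4 * n" by (simp add: mult.assoc flip: power_add)
    moreover have "(card Ex * real G ^ 2) * 8 \<le> (card Ex * real G ^ 2) * real G ^ 2"
      using G2 by (intro mult_left_mono) auto
    ultimately have "card Ex * real G ^ 2 \<le> n / 2" by simp
    then have "real n \<le> real (2 * G\<^sup>2 * card Bk)" using 1 by (simp add: mult_ac)
    then show ?thesis by (simp only: of_nat_le_iff)
  qed
  have "{i \<in> {..<n}. \<bar>restrict w {..<n} i\<bar> > int (N * G\<^sup>2)} = Ex" by (auto simp: Ex_def)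
  moreover have "{i \<in> {..<n}. int N \<le> 2 * int (G\<^sup>2) * \<bar>restrict w {..<n} i\<bar> \<and> \<bar>restrict w {..<n} i\<bar> \<le> int (N * G\<^sup>2)} = Bk"
    by (auto simp: Bk_def)
  moreover have "conc n (real (G * m)) (\<lambda>i. real_of_int (restrict w {..<n} i)) = conc n (real (G * m)) w"
    by (simp add: conc_def ip_def)
  moreover have "restrict w {..<n} \<in> PiE {..<n} (\<lambda>_. {-int (2 * N * m)..int (2 * N * m)})"
    using box by (intro restrict_PiE_iff[THEN iffD2]) auto
  ultimately show ?thesis unfolding bad_vectors_def using Ex Bk conc by simp
qed

text \<open>The constants: \<open>3456 = 18 * 192\<close> and \<open>124416 = 18 * 2 * 3456\<close>, with the loss \<open>18\<close> from rounding;
  \<open>373248 = 3 * 124416\<close>, with \<open>3 \<ge> exp 1\<close>; and \<open>179159040 = 480 * 373248\<close>.\<close>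

lemma card_structured_le:
  fixes n m G r K :: nat and \<tau> B :: real
  assumes n: "n \<ge> 1" and m: "n \<le> m\<^sup>2" "m\<^sup>2 \<le> 4 * n" and G: "G \<ge> 3" "4 * G\<^sup>2 \<le> m"
    and I: "finite I" "Suc (card I) = n"
    and small: "24 * n * exp (- real G) \<le> 1" and r: "r \<le> m"
    and near: "m * exp (- (real G ^ 2 / 256)) \<le> 1" and exc: "4 * ln m \<le> real G ^ 4"
    and \<tau>: "\<tau> > 0" and K: "3456 * real G ^ 5 \<le> \<tau> * K"
    and B: "\<And>k. k \<le> r \<Longrightarrow> real m ^ (r - k) * real K ^ k * min ((3/4) ^ k) (sqrt (8 / (real r + 8))) ^ n \<le> B"
  shows "card {R \<in> sign_rows I n. \<exists>v :: nat \<Rightarrow> real. (\<Sum>i<n. (v i)\<^sup>2) = real n \<and>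
      n \<le> card {i \<in> {..<n}. real G ^ 2 * \<bar>v i\<bar> \<ge> 1} * G\<^sup>2 \<and> (\<forall>j\<in>I. ip n (R j) v = 0) \<and>
      \<tau> * 2 ^ n \<le> card {x \<in> signs n. ip n x v = 0}}
    \<le> real K ^ 2 * (179159040 * real G ^ 7) ^ n * (5 ^ (Suc r * r) * B) * (2 ^ n) ^ card I" (is "real (card ?X) \<le> _")
proof -
  define s where "s = real (G * m)"
  \<comment> \<open>Both bounds on the concentration are kept: the lower one, inside
    \<open>bad_vectors\<close>, makes such \<open>w\<close> rare, and the upper one makes each row
    test restrictive.\<close>
  define W where "W = (\<lambda>N. {w \<in> bad_vectors n m G N. conc n s w \<le> 124416 * real G ^ 5 / N})"
  define S where "S = (\<lambda>w. {x \<in> signs n. \<bar>ip n x w\<bar> \<le> s})"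
  define Ns where "Ns = {N \<in> {1..K}. 2 * G ^ 5 \<le> N}"
  define Y where "Y = (\<lambda>N. {R \<in> sign_rows I n. \<exists>w\<in>W N. \<forall>j\<in>I. R j \<in> S w})"
  define E where "E = 5 ^ (Suc r * r) * B"
  have m1: "m \<ge> 1" using n m(1) by (cases m) auto
  have G1: "G \<ge> 1" using G by simp
  have s0: "s > 0" using G1 m1 by (simp add: s_def)
  have sm: "real m \<le> s"
  proof -
    have "1 * m \<le> G * m" using G1 by (intro mult_right_mono) auto
    then show ?thesis unfolding s_def by (simp only: of_nat_le_iff mult_1)
  qed
  have B0: "B \<ge> 0" by (rule order_trans[OF _ B[of 0]]) auto
  have E0: "E \<ge> 0" using B0 by (simp add: E_def)
  have finW: "finite (W N)" for N
    unfolding W_def bad_vectors_def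
    by (rule finite_subset[of _ "PiE {..<n} (\<lambda>_. {-int (2 * N * m)..int (2 * N * m)})"]) (auto intro: finite_PiE)
  have finY: "finite (Y N)" for N
    unfolding Y_def by (rule finite_subset[OF _ finite_PiE[OF I(1), of "\<lambda>_. signs n"]]) auto
  have finNs: "finite Ns" by (simp add: Ns_def)
  have sub: "?X \<subseteq> (\<Union>N\<in>Ns. Y N)"
  proof
    fix R assume "R \<in> ?X"
    then obtain v :: "nat \<Rightarrow> real" where R: "R \<in> sign_rows I n" and v: "(\<Sum>i<n. (v i)\<^sup>2) = real n"
      "n \<le> card {i \<in> {..<n}. real G ^ 2 * \<bar>v i\<bar> \<ge> 1} * G\<^sup>2" "\<And>j. j \<in> I \<Longrightarrow> ip n (R j) v = 0"
      "\<tau> * 2 ^ n \<le> card {x \<in> signs n. ip n x v = 0}" by blast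
    define g where "g = 3456 * real G ^ 5"
    have "1 \<le> real G ^ 5" using G1 by simp
    then have g2: "g \<ge> 2" by (simp add: g_def)
    have gK: "g \<le> \<tau> * K" using K by (simp add: g_def)
    obtain N :: nat where N: "N \<ge> 1" "N \<le> K" "g \<le> N"
      "g / N \<le> conc n s (\<lambda>i. real N * v i)" "conc n s (\<lambda>i. real N * v i) \<le> 2 * g / N"
      by (rule scale_exists[OF s0 \<tau> v(4) g2 gK])
    have NG: "2 * G ^ 5 \<le> N"
    proof -
      have "2 * real G ^ 5 \<le> g" using G1 by (simp add: g_def)
      then have "real (2 * G ^ 5) \<le> real N" using N(3) by simp
      then show ?thesis by (simp only: of_nat_le_iff)
    qed
    have RI: "R ` I \<subseteq> signs n" using R by (auto simp: PiE_iff)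
    have cR: "card (R ` I) \<le> n" using card_image_le[OF I(1), of R] I(2) by simp
    have c2: "real (card (R ` I)) * exp (- s / real m) * 24 \<le> 1"
    proof -
      have e: "exp (- s / real m) = exp (- real G)" using m1 by (simp add: s_def)
      have "real (card (R ` I)) * exp (- real G) * 24 \<le> real n * exp (- real G) * 24"
        using cR by (intro mult_right_mono) auto
      then show ?thesis unfolding e using small by linarith
    qed
    have c3: "finite (R ` I)" using I by simp
    obtain w :: "nat \<Rightarrow> int" where w: "\<And>i. i < n \<Longrightarrow> \<bar>w i - real N * v i\<bar> \<le> 1"
      "\<And>x. x \<in> R ` I \<Longrightarrow> \<bar>ip n x (\<lambda>i. w i - real N * v i)\<bar> \<le> s"
      "conc n s w \<le> 18 * conc n s (\<lambda>i. real N * v i)"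
      "conc n s (\<lambda>i. real N * v i) \<le> 18 * conc n s w"
      "(\<Sum>i\<in>{}. \<bar>w i\<bar>) \<le> 4 * (\<Sum>i\<in>{}. \<bar>real N * v i\<bar>) + 1"
      by (rule rounding[OF m(1) m1 sm c3 RI c2 empty_subsetI, of "\<lambda>i. real N * v i"]) blast
    define w' where "w' = restrict w {..<n}"
    have cw': "conc n s w' = conc n s w" by (simp add: w'_def conc_def ip_def)
    have "w' \<in> bad_vectors n m G N" unfolding w'_def
    proof (rule rounding_mem_bad_vectors[OF n m(1) G(1) _ v(1,2) w(1)])
      have "G\<^sup>2 \<le> G ^ 5" using G1 by (intro power_increasing) auto
      then show "2 * G\<^sup>2 \<le> N" using NG by linarith
      have "g / N \<le> 18 * conc n s w" using N(4) w(4) by linarith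
      then have "g / N / 18 \<le> conc n s w" by simp
      then show "192 * real G ^ 5 / real N \<le> conc n (real (G * m)) w"
        by (simp add: g_def s_def)
    qed
    moreover have "conc n s w' \<le> 124416 * real G ^ 5 / N"
    proof -
      have "conc n s w \<le> 18 * (2 * g / N)" using w(3) N(5) by linarith
      then show ?thesis unfolding cw' by (simp add: g_def)
    qed
    ultimately have "w' \<in> W N" by (simp add: W_def)
    moreover have "R j \<in> S w'" if j: "j \<in> I" for j
    proof -
      have "\<bar>ip n (R j) w\<bar> \<le> s"
        using w(2)[of "R j"] v(3)[OF j] j by (simp add: ip_diff_right ip_scale_right)
      moreover have "ip n (R j) w' = ip n (R j) w"
        by (simp add: ip_def w'_def)
      ultimately show ?thesis using RI j by (auto simp: S_def)
    qed
    ultimately have "R \<in> Y N" using R unfolding Y_def by blast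
    moreover have "N \<in> Ns" using N NG by (simp add: Ns_def)
    ultimately show "R \<in> (\<Union>N\<in>Ns. Y N)" by blast
  qed
  have one: "real (card (Y N)) \<le> K * ((179159040 * real G ^ 7) ^ n * E * (2 ^ n) ^ card I)" if N: "N \<in> Ns" for N
  proof -
    have N1: "N \<ge> 1" "N \<le> K" "2 * G ^ 5 \<le> N" using N by (auto simp: Ns_def)
    define \<beta> where "\<beta> = 373248 * real G ^ 5 / N"
    have "real (card (Y N)) \<le> card (W N) * (\<beta> * 2 ^ n) ^ card I"
      unfolding Y_def
    proof (rule card_rows_le[OF I(1) finW])
      fix w assume w: "w \<in> W N"
      have "real (card (S w)) \<le> exp 1 * conc n s w * 2 ^ n"
        unfolding S_def by (rule card_signs_le_conc[OF s0])
      also have "... \<le> 3 * (124416 * real G ^ 5 / N) * 2 ^ n"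
        using w exp_le by (intro mult_right_mono mult_mono) (auto simp: W_def less_imp_le[OF conc_pos])
      also have "... = \<beta> * 2 ^ n" by (simp add: \<beta>_def)
      finally show "S w \<subseteq> signs n \<and> real (card (S w)) \<le> \<beta> * 2 ^ n" by (auto simp: S_def)
    qed
    also have "... \<le> (480 * real N * G\<^sup>2) ^ n * E * (\<beta> * 2 ^ n) ^ card I"
    proof (intro mult_right_mono)
      have "finite (bad_vectors n m G N)" unfolding bad_vectors_def
        by (rule finite_subset[of _ "PiE {..<n} (\<lambda>_. {-int (2 * N * m)..int (2 * N * m)})"]) (auto intro: finite_PiE)
      then have "card (W N) \<le> card (bad_vectors n m G N)" by (intro card_mono) (auto simp: W_def)
      then have "real (card (W N)) \<le> real (card (bad_vectors n m G N))" by simp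
      also have "... \<le> (480 * real N * G\<^sup>2) ^ n * E" unfolding E_def
      proof (rule card_bad_vectors_le[OF m(2) G1 G(2) r N1(3) near exc])
        fix k assume k: "k \<le> r"
        have "real m ^ (r - k) * real N ^ k * min ((3/4) ^ k) (sqrt (8 / (real r + 8))) ^ n \<le>
            real m ^ (r - k) * real K ^ k * min ((3/4) ^ k) (sqrt (8 / (real r + 8))) ^ n"
          using N1 by (intro mult_right_mono mult_left_mono power_mono) auto
        also have "... \<le> B" by (rule B[OF k])
        finally show "real m ^ (r - k) * real N ^ k * min ((3/4) ^ k) (sqrt (8 / (real r + 8))) ^ n \<le> B" .
      qed
      finally show "real (card (W N)) \<le> (480 * real N * G\<^sup>2) ^ n * E" .
    qed (simp add: \<beta>_def)
    \<comment> \<open>The factors \<open>N\<close> cancel except for one, as there are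
      \<open>n\<close> coordinates but only \<open>n - 1\<close> rows. That one is at most
      \<open>K\<close>, and summing over \<open>N\<close> costs another \<open>K\<close>.\<close>
    also have "... = N * (480 * real G ^ 2) ^ n * (373248 * real G ^ 5) ^ card I * (E * (2 ^ n) ^ card I)"
    proof -
      have "real N ^ n = N * real N ^ card I" using I(2) by (metis power_Suc)
      then show ?thesis using N1 by (simp add: \<beta>_def power_mult_distrib power_divide)
    qed
    also have "... \<le> K * (480 * real G ^ 2) ^ n * (373248 * real G ^ 5) ^ n * (E * (2 ^ n) ^ card I)"
    proof (intro mult_right_mono mult_mono)
      have "1 \<le> real G ^ 5" using G1 by simp
      then show "(373248 * real G ^ 5) ^ card I \<le> (373248 * real G ^ 5) ^ n"
        using I(2) by (intro power_increasing) auto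
    qed (use N1 E0 in auto)
    also have "... = K * ((480 * real G ^ 2 * (373248 * real G ^ 5)) ^ n * E * (2 ^ n) ^ card I)"
      by (simp only: power_mult_distrib mult_ac)
    also have "480 * real G ^ 2 * (373248 * real G ^ 5) = 179159040 * real G ^ 7"
      by (simp add: power_numeral_reduce)
    finally show ?thesis .
  qed
  have "real (card ?X) \<le> real (card (\<Union>N\<in>Ns. Y N))"
    using finNs finY by (intro of_nat_mono card_mono sub) auto
  also have "... \<le> real (\<Sum>N\<in>Ns. card (Y N))" by (intro of_nat_mono card_UN_le finNs)
  also have "... = (\<Sum>N\<in>Ns. real (card (Y N)))" by simp
  also have "... \<le> (\<Sum>N\<in>Ns. K * ((179159040 * real G ^ 7) ^ n * E * (2 ^ n) ^ card I))"
    by (intro sum_mono one)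
  also have "... = card Ns * (K * ((179159040 * real G ^ 7) ^ n * E * (2 ^ n) ^ card I))" by simp
  also have "... \<le> K * (K * ((179159040 * real G ^ 7) ^ n * E * (2 ^ n) ^ card I))"
  proof (intro mult_right_mono)
    have "card Ns \<le> card {1..K}" by (intro card_mono) (auto simp: Ns_def)
    then show "real (card Ns) \<le> real K" by simp
  qed (use E0 in auto)
  finally show ?thesis by (simp add: E_def power2_eq_square mult_ac)
qed

subsection \<open>Singular sign matrices\<close>

definition rows_mat :: "nat \<Rightarrow> (nat \<Rightarrow> nat \<Rightarrow> real) \<Rightarrow> real mat" where
  "rows_mat n R = Matrix.mat n n (\<lambda>(i, j). R i j)"

lemma rows_mat_carrier: "rows_mat n R \<in> carrier_mat n n"
  by (simp add: rows_mat_def)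

lemma det_rows_mat_0_iff:
  "Determinant.det (rows_mat n R) = 0 \<longleftrightarrow> (\<exists>v. (\<exists>i<n. v i \<noteq> 0) \<and> (\<forall>i<n. ip n (R i) v = 0))"
proof -
  have mult: "rows_mat n R *\<^sub>v c = 0\<^sub>v n \<longleftrightarrow> (\<forall>i<n. ip n (R i) (\<lambda>k. c $ k) = 0)"
    if "c \<in> carrier_vec n" for c
    using that by (auto simp: vec_eq_iff rows_mat_def scalar_prod_def ip_def lessThan_atLeast0)
  have nz: "c \<noteq> 0\<^sub>v n \<longleftrightarrow> (\<exists>i<n. c $ i \<noteq> 0)" if "c \<in> carrier_vec n" for c :: "real Matrix.vec"
    using that by (auto simp: vec_eq_iff)
  have "Determinant.det (rows_mat n R) = 0 \<longleftrightarrow>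
      (\<exists>c. c \<in> carrier_vec n \<and> c \<noteq> 0\<^sub>v n \<and> rows_mat n R *\<^sub>v c = 0\<^sub>v n)"
    by (rule det_0_iff_vec_prod_zero_field[OF rows_mat_carrier])
  also have "... \<longleftrightarrow> (\<exists>v. (\<exists>i<n. v i \<noteq> 0) \<and> (\<forall>i<n. ip n (R i) v = 0))"
  proof
    assume "\<exists>c. c \<in> carrier_vec n \<and> c \<noteq> 0\<^sub>v n \<and> rows_mat n R *\<^sub>v c = 0\<^sub>v n"
    then obtain c where c: "c \<in> carrier_vec n" "c \<noteq> 0\<^sub>v n" "rows_mat n R *\<^sub>v c = 0\<^sub>v n" by blast
    then show "\<exists>v. (\<exists>i<n. v i \<noteq> 0) \<and> (\<forall>i<n. ip n (R i) v = 0)"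
      using mult nz by (intro exI[of _ "\<lambda>k. c $ k"]) auto
  next
    assume "\<exists>v. (\<exists>i<n. v i \<noteq> 0) \<and> (\<forall>i<n. ip n (R i) v = 0)"
    then obtain v where v: "\<exists>i<n. v i \<noteq> 0" "\<forall>i<n. ip n (R i) v = 0" by blast
    define c where "c = Matrix.vec n v"
    have c: "c \<in> carrier_vec n" by (simp add: c_def)
    have "ip n (R i) (\<lambda>k. c $ k) = ip n (R i) v" for i by (simp add: ip_def c_def)
    then have "rows_mat n R *\<^sub>v c = 0\<^sub>v n" using v mult[OF c] by simp
    moreover have "c \<noteq> 0\<^sub>v n" unfolding nz[OF c] using v(1) by (auto simp: c_def)
    ultimately show "\<exists>c. c \<in> carrier_vec n \<and> c \<noteq> 0\<^sub>v n \<and> rows_mat n R *\<^sub>v c = 0\<^sub>v n" using c by blast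
  qed
  finally show ?thesis .
qed

lemma det_rows_mat_transpose: "Determinant.det (rows_mat n (\<lambda>i j. R j i)) = Determinant.det (rows_mat n R)"
proof -
  have "rows_mat n (\<lambda>i j. R j i) = transpose_mat (rows_mat n R)"
    by (auto simp: rows_mat_def mat_eq_iff)
  then show ?thesis using det_transpose[OF rows_mat_carrier, of n R] by simp
qed

text \<open>With row \<open>i\<close> replaced by zero the matrix is singular, as its transpose
  annihilates the \<open>i\<close>-th unit vector; a kernel vector is normal to the other
  rows.\<close>

lemma normal_vector_exists:
  assumes "i < n"
  shows "\<exists>v. (\<exists>k<n. v k \<noteq> 0) \<and> (\<forall>j\<in>{..<n} - {i}. ip n (R j) v = 0)"
proof -
  define R' where "R' = (\<lambda>j. if j = i then (\<lambda>_. 0) else R j)"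
  have "\<exists>v. (\<exists>k<n. v k \<noteq> 0) \<and> (\<forall>j<n. ip n (\<lambda>k. R' k j) v = 0)"
  proof (intro exI[of _ "\<lambda>k. if k = i then 1 else 0"] conjI)
    show "\<exists>k<n. (if k = i then 1 else 0 :: real) \<noteq> 0" using assms by auto
    show "\<forall>j<n. ip n (\<lambda>k. R' k j) (\<lambda>k. if k = i then 1 else 0) = 0"
      by (auto simp: ip_def R'_def intro!: sum.neutral)
  qed
  then have "Determinant.det (rows_mat n (\<lambda>i j. R' j i)) = 0" by (subst det_rows_mat_0_iff)
  then have "Determinant.det (rows_mat n R') = 0" using det_rows_mat_transpose[of n R'] by simp
  then obtain v where v: "\<exists>k<n. v k \<noteq> 0" "\<forall>j<n. ip n (R' j) v = 0"
    unfolding det_rows_mat_0_iff by blast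
  have "ip n (R j) v = 0" if "j \<in> {..<n} - {i}" for j
  proof -
    have "ip n (R' j) v = 0" using v(2) that by auto
    then show ?thesis using that by (simp add: R'_def)
  qed
  then show ?thesis using v(1) by blast
qed

text \<open>A linear relation among the rows has a nonzero coefficient at some \<open>i\<close>,
  which puts row \<open>i\<close> into the span of the others.\<close>

lemma dependent_row:
  assumes "Determinant.det (rows_mat n R) = 0"
  shows "\<exists>i<n. \<forall>v. (\<forall>j\<in>{..<n} - {i}. ip n (R j) v = 0) \<longrightarrow> ip n (R i) v = 0"
proof -
  have "Determinant.det (rows_mat n (\<lambda>i j. R j i)) = 0" using assms det_rows_mat_transpose[of n R] by simp
  then obtain c where c: "\<exists>i<n. c i \<noteq> 0" "\<forall>k<n. ip n (\<lambda>j. R j k) c = 0"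
    unfolding det_rows_mat_0_iff by blast
  then obtain i where i: "i < n" "c i \<noteq> 0" by blast
  show ?thesis
  proof (intro exI[of _ i] conjI allI impI)
    fix v assume v: "\<forall>j\<in>{..<n} - {i}. ip n (R j) v = 0"
    have "(\<Sum>j<n. c j * ip n (R j) v) = (\<Sum>k<n. v k * ip n (\<lambda>j. R j k) c)"
      unfolding ip_def sum_distrib_left by (subst sum.swap) (simp add: mult_ac)
    also have "... = 0" using c(2) by simp
    also have "(\<Sum>j<n. c j * ip n (R j) v) = c i * ip n (R i) v + (\<Sum>j\<in>{..<n} - {i}. c j * ip n (R j) v)"
      using i by (subst sum.remove[of _ i]) auto
    also have "(\<Sum>j\<in>{..<n} - {i}. c j * ip n (R j) v) = 0" using v by (intro sum.neutral) auto
    finally show "ip n (R i) v = 0" using i by simp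
  qed fact
qed

text \<open>A union bound over the row \<open>i\<close> that depends on the others. The normal
  vector \<open>nv\<close> is a function of the other rows alone, so row \<open>i\<close> is
  independent of it: either these rows are bad, or at most a proportion \<open>\<tau>\<close> of the
  choices of row \<open>i\<close> is orthogonal to it.\<close>

lemma card_singular_le:
  fixes n :: nat and \<tau> b :: real
  assumes \<tau>: "\<tau> \<ge> 0"
    and bad: "\<And>i. i < n \<Longrightarrow> card {R \<in> sign_rows ({..<n} - {i}) n. \<exists>v. (\<exists>k<n. v k \<noteq> 0) \<and>
      (\<forall>j\<in>{..<n} - {i}. ip n (R j) v = 0) \<and> \<tau> * 2 ^ n \<le> card {x \<in> signs n. ip n x v = 0}} \<le> b * (2 ^ n) ^ (n - 1)"
  shows "card {R \<in> sign_rows {..<n} n. Determinant.det (rows_mat n R) = 0} \<le> n * (b + \<tau>) * (2 ^ n) ^ n"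
proof -
  define M where "M = sign_rows {..<n} n"
  define A where "A = (\<lambda>i. {R \<in> M. \<forall>v. (\<forall>j\<in>{..<n} - {i}. ip n (R j) v = 0) \<longrightarrow> ip n (R i) v = 0})"
  have finM: "finite M" unfolding M_def by (intro finite_PiE) auto
  have A: "card (A i) \<le> (b + \<tau>) * (2 ^ n) ^ n" if i: "i < n" for i
  proof -
    define I where "I = {..<n} - {i}"
    define P where "P = sign_rows I n"
    define nv where "nv = (\<lambda>R. SOME v. (\<exists>k<n. v k \<noteq> 0) \<and> (\<forall>j\<in>I. ip n (R j) v = 0))"
    define Z where "Z = (\<lambda>v. {x \<in> signs n. ip n x v = 0})"
    define Bad where "Bad = {R \<in> P. \<exists>v. (\<exists>k<n. v k \<noteq> 0) \<and> (\<forall>j\<in>I. ip n (R j) v = 0) \<and> \<tau> * 2 ^ n \<le> card (Z v)}"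
    have I: "finite I" "card I = n - 1" using i by (auto simp: I_def)
    have finP: "finite P" unfolding P_def using I by (intro finite_PiE) auto
    have cP: "card P = (2 ^ n) ^ (n - 1)" unfolding P_def using I by (simp add: card_PiE card_signs)
    have nv: "(\<exists>k<n. nv R k \<noteq> 0) \<and> (\<forall>j\<in>I. ip n (R j) (nv R) = 0)" for R
      using someI_ex[OF normal_vector_exists[OF i, of R]] unfolding nv_def I_def .
    define T where "T = Sigma Bad (\<lambda>_. signs n) \<union> Sigma (P - Bad) (\<lambda>R. Z (nv R))"
    have "card (A i) \<le> card T"
    proof (rule card_inj_on_le)
      show "inj_on (\<lambda>R. (restrict R I, R i)) (A i)"
      proof (rule inj_onI)
        fix R R' assume R: "R \<in> A i" "R' \<in> A i" "(restrict R I, R i) = (restrict R' I, R' i)"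
        have "R j = R' j" if "j < n" for j
        proof (cases "j = i")
          case False
          then have "restrict R I j = restrict R' I j" "j \<in> I" using R that by (auto simp: I_def)
          then show ?thesis by simp
        qed (use R in simp)
        then show "R = R'" using R by (intro PiE_ext[of R "{..<n}" "\<lambda>_. signs n" R']) (auto simp: A_def M_def)
      qed
      show "(\<lambda>R. (restrict R I, R i)) ` A i \<subseteq> T"
      proof
        fix y assume "y \<in> (\<lambda>R. (restrict R I, R i)) ` A i"
        then obtain R where R: "R \<in> A i" and y: "y = (restrict R I, R i)" by blast
        have RM: "R j \<in> signs n" if "j < n" for j using R that by (auto simp: A_def M_def)
        have rP: "restrict R I \<in> P" using RM by (auto simp: P_def I_def)
        have "ip n (R j) (nv (restrict R I)) = 0" if "j \<in> I" for j
          using nv[of "restrict R I"] that by auto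
        then have "ip n (R i) (nv (restrict R I)) = 0" using R by (auto simp: A_def I_def)
        then have "R i \<in> Z (nv (restrict R I))" using RM[OF i] by (simp add: Z_def)
        then show "y \<in> T" using rP RM[OF i] by (auto simp: T_def y)
      qed
      show "finite T" unfolding T_def Bad_def Z_def using finP by auto
    qed
    also have "... \<le> card (Sigma Bad (\<lambda>_. signs n)) + card (Sigma (P - Bad) (\<lambda>R. Z (nv R)))"
      unfolding T_def by (rule card_Un_le)
    finally have "real (card (A i)) \<le> real (card (Sigma Bad (\<lambda>_. signs n))) + real (card (Sigma (P - Bad) (\<lambda>R. Z (nv R))))"
      by linarith
    also have "real (card (Sigma Bad (\<lambda>_. signs n))) = real (card Bad) * 2 ^ n"
      using finP by (subst card_SigmaI) (auto simp: Bad_def card_signs)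
    also have "real (card (Sigma (P - Bad) (\<lambda>R. Z (nv R)))) = (\<Sum>R\<in>P - Bad. real (card (Z (nv R))))"
      using finP by (subst card_SigmaI) (auto simp: Z_def)
    also have "... \<le> (\<Sum>R\<in>P - Bad. \<tau> * 2 ^ n)"
    proof (intro sum_mono)
      fix R assume "R \<in> P - Bad"
      then show "real (card (Z (nv R))) \<le> \<tau> * 2 ^ n" using nv[of R] unfolding Bad_def by force
    qed
    also have "... \<le> real (card P) * (\<tau> * 2 ^ n)"
      using \<tau> card_mono[OF finP, of "P - Bad"] by (simp add: mult_right_mono)
    also have "real (card Bad) * 2 ^ n + real (card P) * (\<tau> * 2 ^ n) \<le>
        b * (2 ^ n) ^ (n - 1) * 2 ^ n + (2 ^ n) ^ (n - 1) * (\<tau> * 2 ^ n)"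
    proof (intro add_mono mult_right_mono)
      show "real (card Bad) \<le> b * (2 ^ n) ^ (n - 1)"
        using bad[OF i] unfolding Bad_def P_def I_def Z_def .
    qed (use cP \<tau> in auto)
    also have "... = (b + \<tau>) * ((2 ^ n) ^ (n - 1) * 2 ^ n)" by (simp add: algebra_simps)
    also have "(2 ^ n) ^ (n - 1) * 2 ^ n = ((2::real) ^ n) ^ n" using i by (cases n) (auto simp: mult.commute)
    finally show ?thesis by simp
  qed
  have "{R \<in> M. Determinant.det (rows_mat n R) = 0} \<subseteq> (\<Union>i<n. A i)"
    using dependent_row by (fastforce simp: A_def)
  then have "card {R \<in> M. Determinant.det (rows_mat n R) = 0} \<le> card (\<Union>i<n. A i)"
    using finM by (intro card_mono) (auto simp: A_def)
  also have "... \<le> (\<Sum>i<n. card (A i))" by (rule card_UN_le) simp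
  finally have "real (card {R \<in> M. Determinant.det (rows_mat n R) = 0}) \<le> real (\<Sum>i<n. card (A i))"
    by (simp only: of_nat_le_iff)
  also have "... = (\<Sum>i<n. real (card (A i)))" by simp
  also have "... \<le> (\<Sum>i<n. (b + \<tau>) * (2 ^ n) ^ n)" by (intro sum_mono A) simp
  finally show ?thesis by (simp add: M_def)
qed

text \<open>Orthogonality survives scaling, so the normal vector may be given squared norm
  \<open>n\<close>; the number of its coordinates above \<open>1 / G^2\<close> then decides between
  the compressible and the structured count.\<close>

lemma card_bad_normal_le:
  fixes n m G r K D :: nat and \<tau> B :: real
  assumes n: "n \<ge> 1" and m: "n \<le> m\<^sup>2" "m\<^sup>2 \<le> 4 * n" and G: "G \<ge> 3" "4 * G\<^sup>2 \<le> m" "G \<le> n"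
    and I: "finite I" "Suc (card I) = n"
    and small: "24 * n * exp (- real G) \<le> 1" and r: "r \<le> m"
    and near: "m * exp (- (real G ^ 2 / 256)) \<le> 1" and exc: "4 * ln m \<le> real G ^ 4"
    and D: "38 * n \<le> D * G"
    and \<tau>: "\<tau> > 0" and K: "3456 * real G ^ 5 \<le> \<tau> * K"
    and B: "\<And>k. k \<le> r \<Longrightarrow> real m ^ (r - k) * real K ^ k * min ((3/4) ^ k) (sqrt (8 / (real r + 8))) ^ n \<le> B"
  shows "card {R \<in> sign_rows I n. \<exists>v. (\<exists>k<n. v k \<noteq> 0) \<and> (\<forall>j\<in>I. ip n (R j) v = 0) \<and>
      \<tau> * 2 ^ n \<le> card {x \<in> signs n. ip n x v = 0}}
    \<le> (real ((n + 1) * (20 * G * m + 1)) ^ D * (71/100) ^ (n - 1) +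
        real K ^ 2 * (179159040 * real G ^ 7) ^ n * (5 ^ (Suc r * r) * B)) * (2 ^ n) ^ (n - 1)"
    (is "real (card ?X) \<le> _")
proof -
  define C where "C = {R \<in> sign_rows I n. \<exists>v :: nat \<Rightarrow> real. (\<Sum>i<n. (v i)\<^sup>2) = real n \<and>
      card {i \<in> {..<n}. real G ^ 2 * \<bar>v i\<bar> \<ge> 1} * G\<^sup>2 \<le> n \<and> (\<forall>j\<in>I. ip n (R j) v = 0)}"
  define S where "S = {R \<in> sign_rows I n. \<exists>v :: nat \<Rightarrow> real. (\<Sum>i<n. (v i)\<^sup>2) = real n \<and>
      n \<le> card {i \<in> {..<n}. real G ^ 2 * \<bar>v i\<bar> \<ge> 1} * G\<^sup>2 \<and> (\<forall>j\<in>I. ip n (R j) v = 0) \<and>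
      \<tau> * 2 ^ n \<le> card {x \<in> signs n. ip n x v = 0}}"
  have fin: "finite (sign_rows I n)" using I by (intro finite_PiE) auto
  have "?X \<subseteq> C \<union> S"
  proof
    fix R assume "R \<in> ?X"
    then obtain v where R: "R \<in> sign_rows I n" and v: "\<exists>k<n. v k \<noteq> 0" "\<forall>j\<in>I. ip n (R j) v = 0"
      "\<tau> * 2 ^ n \<le> card {x \<in> signs n. ip n x v = 0}" by blast
    define V where "V = (\<Sum>i<n. (v i)\<^sup>2)"
    obtain k where k: "k < n" "v k \<noteq> 0" using v(1) by blast
    have "(v k)\<^sup>2 \<le> V" unfolding V_def using k by (intro member_le_sum) auto
    then have V0: "V > 0" using k by (smt (verit) zero_less_power2)
    define c where "c = sqrt (n / V)"
    have c0: "c \<noteq> 0" using V0 n by (simp add: c_def)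
    define u where "u = (\<lambda>i. c * v i)"
    have "(\<Sum>i<n. (u i)\<^sup>2) = c\<^sup>2 * V" by (simp add: u_def V_def power_mult_distrib sum_distrib_left)
    then have u1: "(\<Sum>i<n. (u i)\<^sup>2) = real n" using V0 by (simp add: c_def)
    have ipu: "ip n x u = 0 \<longleftrightarrow> ip n x v = 0" for x using c0 by (simp add: u_def ip_scale_right)
    have u2: "\<forall>j\<in>I. ip n (R j) u = 0" using v(2) ipu by simp
    have u3: "\<tau> * 2 ^ n \<le> card {x \<in> signs n. ip n x u = 0}" using v(3) ipu by simp
    show "R \<in> C \<union> S"
    proof (cases "card {i \<in> {..<n}. real G ^ 2 * \<bar>u i\<bar> \<ge> 1} * G\<^sup>2 \<le> n")
      case True
      then have "R \<in> C" unfolding C_def using R u1 u2 by blast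
      then show ?thesis ..
    next
      case False
      then have "n \<le> card {i \<in> {..<n}. real G ^ 2 * \<bar>u i\<bar> \<ge> 1} * G\<^sup>2" by linarith
      then have "R \<in> S" unfolding S_def using R u1 u2 u3 by blast
      then show ?thesis ..
    qed
  qed
  then have "card ?X \<le> card (C \<union> S)"
    using fin by (intro card_mono) (auto simp: C_def S_def)
  also have "... \<le> card C + card S" by (rule card_Un_le)
  finally have "real (card ?X) \<le> real (card C) + real (card S)" by linarith
  also have "real (card C) \<le> real ((n + 1) * (20 * G * m + 1)) ^ D * (71/100 * 2 ^ n) ^ card I"
    unfolding C_def using G I by (intro card_compressible_le n m small D) auto
  also have "real (card S) \<le> real K ^ 2 * (179159040 * real G ^ 7) ^ n * (5 ^ (Suc r * r) * B) * (2 ^ n) ^ card I"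
    unfolding S_def by (rule card_structured_le[OF n m G(1,2) I small r near exc \<tau> K B])
  also have "card I = n - 1" using I by simp
  finally show ?thesis by (simp only: distrib_right power_mult_distrib mult.assoc)
qed

definition singular_count :: "nat \<Rightarrow> nat" where
  "singular_count n = card {R \<in> sign_rows {..<n} n. Determinant.det (rows_mat n R) = 0}"

text \<open>The bound for \<open>k\<close> free frequencies is split at \<open>k0\<close>: from
  there on \<open>K * (3/4) ^ n \<le> 1\<close> makes higher powers smaller, below it
  \<open>K ^ k \<le> K ^ k0\<close> is used with the Littlewood-Offord factor.\<close>

lemma singular_count_le:
  fixes n m G r K D k0 :: nat and \<tau> :: real
  assumes n: "n \<ge> 1" and m: "n \<le> m\<^sup>2" "m\<^sup>2 \<le> 4 * n" and G: "G \<ge> 3" "4 * G\<^sup>2 \<le> m" "G \<le> n"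
    and small: "24 * n * exp (- real G) \<le> 1" and r: "r \<le> m"
    and near: "m * exp (- (real G ^ 2 / 256)) \<le> 1" and exc: "4 * ln m \<le> real G ^ 4"
    and D: "38 * n \<le> D * G"
    and \<tau>: "\<tau> > 0" and K: "3456 * real G ^ 5 \<le> \<tau> * K" "K \<ge> 1" "K * (3/4) ^ n \<le> (1 :: real)"
  shows "singular_count n / (2 ^ n) ^ n \<le> n * (real ((n + 1) * (20 * G * m + 1)) ^ D * (71/100) ^ (n - 1) +
      real K ^ 2 * (179159040 * real G ^ 7) ^ n * 5 ^ (Suc r * r) * real m ^ r *
        ((K * (3/4) ^ n) ^ k0 + real K ^ k0 * sqrt (8 / (real r + 8)) ^ n) + \<tau>)"
proof -
  define B where "B = real m ^ r * ((K * (3/4) ^ n) ^ k0 + real K ^ k0 * sqrt (8 / (real r + 8)) ^ n)"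
  have m1: "m \<ge> 1" using n m(1) by (cases m) auto
  have B: "real m ^ (r - k) * real K ^ k * min ((3/4) ^ k) (sqrt (8 / (real r + 8))) ^ n \<le> B" for k
  proof -
    have "real K ^ k * min ((3/4) ^ k) (sqrt (8 / (real r + 8))) ^ n \<le>
        (K * (3/4) ^ n) ^ k0 + real K ^ k0 * sqrt (8 / (real r + 8)) ^ n"
    proof (cases "k \<ge> k0")
      case True
      have "real K ^ k * min ((3/4) ^ k) (sqrt (8 / (real r + 8))) ^ n \<le> real K ^ k * ((3/4) ^ k) ^ n"
        by (intro mult_left_mono power_mono) auto
      also have "... = (K * (3/4) ^ n) ^ k" by (simp add: power_mult_distrib mult.commute flip: power_mult)
      also have "... \<le> (K * (3/4) ^ n) ^ k0" using K True by (intro power_decreasing) auto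
      finally show ?thesis by (simp add: add_increasing2)
    next
      case False
      have "real K ^ k * min ((3/4) ^ k) (sqrt (8 / (real r + 8))) ^ n \<le> real K ^ k0 * sqrt (8 / (real r + 8)) ^ n"
        using K False by (intro mult_mono power_mono power_increasing) auto
      then show ?thesis by (simp add: add_increasing)
    qed
    moreover have "real m ^ (r - k) \<le> real m ^ r" using m1 by (intro power_increasing) auto
    ultimately show ?thesis unfolding B_def mult.assoc by (intro mult_mono) auto
  qed
  have "real (singular_count n) \<le> n * (real ((n + 1) * (20 * G * m + 1)) ^ D * (71/100) ^ (n - 1) +
        real K ^ 2 * (179159040 * real G ^ 7) ^ n * (5 ^ (Suc r * r) * B) + \<tau>) * (2 ^ n) ^ n"
    unfolding singular_count_def
  proof (rule card_singular_le)
    fix i assume i: "i < n"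
    show "real (card {R \<in> sign_rows ({..<n} - {i}) n. \<exists>v. (\<exists>k<n. v k \<noteq> 0) \<and>
      (\<forall>j\<in>{..<n} - {i}. ip n (R j) v = 0) \<and> \<tau> * 2 ^ n \<le> card {x \<in> signs n. ip n x v = 0}})
      \<le> (real ((n + 1) * (20 * G * m + 1)) ^ D * (71/100) ^ (n - 1) +
        real K ^ 2 * (179159040 * real G ^ 7) ^ n * (5 ^ (Suc r * r) * B)) * (2 ^ n) ^ (n - 1)"
    proof (rule card_bad_normal_le[OF n m G _ _ small r near exc D \<tau> K(1)])
      show "Suc (card ({..<n} - {i})) = n" using i by simp
    qed (use B in auto)
  qed (use \<tau> in simp)
  then have "real (singular_count n) / (2 ^ n) ^ n \<le> n * (real ((n + 1) * (20 * G * m + 1)) ^ D * (71/100) ^ (n - 1) +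
        real K ^ 2 * (179159040 * real G ^ 7) ^ n * (5 ^ (Suc r * r) * B) + \<tau>)"
    by (simp add: pos_divide_le_eq)
  then show ?thesis by (simp add: B_def mult.assoc)
qed

subsection \<open>Asymptotics\<close>

lemma power_le_exp:
  fixes x y t :: real
  assumes "0 \<le> x" "x \<le> exp y" "0 \<le> y" "real k \<le> t"
  shows "x ^ k \<le> exp (t * y)"
proof -
  have "x ^ k \<le> exp y ^ k" using assms by (intro power_mono)
  also have "... = exp (real k * y)" by (simp add: exp_of_nat_mult)
  also have "... \<le> exp (t * y)" using assms by (simp add: mult_right_mono)
  finally show ?thesis .
qed

text \<open>All parameters become functions of \<open>n\<close>, and what remains for asymptotics is
  collected in the growth conditions. \<open>A / \<tau>\<close> bounds \<open>K\<close>: 110624 is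
  3457 * 2 ^ 5, from \<open>G \<le> 2 * l^2\<close> and 3456 plus 1 for rounding up.
  \<open>F\<close> is the exponent of the prefactor; there 128 is 2 ^ 7, and
  \<open>4 * sqrt n\<close> comes from \<open>5 \<le> exp 2\<close> and
  \<open>Suc r * r \<le> 2 * sqrt n\<close>.\<close>

lemma singular_count_le_exp:
  fixes n :: nat and e l A F c :: real
  assumes e: "e > 0" "e < 1/8" and n1: "n \<ge> 1"
  defines "l \<equiv> ln (real n)"
  defines "A \<equiv> 110624 * l ^ 10"
  defines "F \<equiv> 2 * (ln A + n) + n * ln (179159040 * (128 * l ^ 14)) + 4 * sqrt n + n powr (1/4) * ln (2 * sqrt n)"
  defines "c \<equiv> ln ((3/4 + e) / (3/4))"
  assumes l: "l\<^sup>2 \<ge> 3" "l \<ge> 1" "2 * l\<^sup>2 \<le> n"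
    and a1: "4 * (2 * l\<^sup>2)\<^sup>2 \<le> sqrt n"
    and a2: "24 * real n * exp (- l\<^sup>2) \<le> 1"
    and a3: "2 * sqrt n * exp (- (l ^ 4 / 256)) \<le> 1"
    and a4: "4 * ln (2 * sqrt n) \<le> l ^ 8"
    and a5: "ln A \<le> c * n"
    and a6: "(38 * real n / l\<^sup>2 + 1) * ln ((real n + 1) * (80 * l\<^sup>2 * sqrt n + 1)) - 4 * real n / 75 \<le> -1"
    and a7: "F + (sqrt l + 1) * ln A - c * (sqrt l * n) \<le> - real n - 1"
    and a8: "F + (sqrt l + 1) * (ln A + n) - n / 2 * ln ((n powr (1/4) + 7) / 8) \<le> - real n - 1"
  shows "singular_count n / (2 ^ n) ^ n \<le> 3 * real n * (3/4 + e) ^ n"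
proof -
  define G where "G = nat \<lceil>l\<^sup>2\<rceil>"
  define m where "m = nat \<lceil>sqrt n\<rceil>"
  define r where "r = nat \<lfloor>real n powr (1/4)\<rfloor>"
  define D where "D = nat \<lceil>38 * n / G\<rceil>"
  define k0 where "k0 = nat \<lceil>sqrt l\<rceil>"
  define \<tau> where "\<tau> = (3/4 + e) ^ n"
  define K where "K = nat \<lceil>3456 * real G ^ 5 / \<tau>\<rceil>"
  have sn: "sqrt n \<ge> 1" using n1 by simp
  have l2: "l\<^sup>2 > 0" using l by simp
  have G: "l\<^sup>2 \<le> G" "real G \<le> 2 * l\<^sup>2" unfolding G_def using l by linarith+
  have G1: "real G \<ge> 1" using G l by linarith
  have G3: "G \<ge> 3"
  proof -
    have "real 3 \<le> real G" using G l by simp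
    then show ?thesis by (simp only: of_nat_le_iff)
  qed
  have m: "sqrt n \<le> m" "real m \<le> 2 * sqrt n" unfolding m_def using sn by linarith+
  have m1: "real m \<ge> 1" using m sn by linarith
  have np: "real n powr (1/4) \<ge> 1" using n1 by (simp add: ge_one_powr_ge_zero)
  have r: "real n powr (1/4) - 1 \<le> r" "real r \<le> real n powr (1/4)" unfolding r_def using np by linarith+
  have "sqrt l \<ge> 0" using l by simp
  then have k0: "sqrt l \<le> k0" "real k0 \<le> sqrt l + 1" unfolding k0_def by linarith+
  have \<tau>: "\<tau> > 0" "\<tau> \<le> 1" unfolding \<tau>_def using e by (auto intro!: power_le_one)
  have G5: "real G ^ 5 \<ge> 1" using G1 by simp
  have K: "3456 * real G ^ 5 / \<tau> \<le> K" "real K \<le> 3456 * real G ^ 5 / \<tau> + 1"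
  proof -
    have "3456 * real G ^ 5 / \<tau> > 0" using \<tau> G1 by (intro divide_pos_pos) auto
    then show "3456 * real G ^ 5 / \<tau> \<le> K" "real K \<le> 3456 * real G ^ 5 / \<tau> + 1" unfolding K_def by linarith+
  qed
  have l10: "l ^ 10 \<ge> 1" using l by simp
  have A1: "A \<ge> 1" using l10 by (simp add: A_def)
  then have lnA: "ln A \<ge> 0" by simp
  have KA: "real K \<le> A / \<tau>"
  proof -
    have "1 \<le> real G ^ 5 / \<tau>" using \<tau> G5 by simp
    then have "real K \<le> 3457 * (real G ^ 5 / \<tau>)" using K(2) by simp
    also have "... \<le> 3457 * ((2 * l\<^sup>2) ^ 5 / \<tau>)"
      using G \<tau> by (intro mult_left_mono divide_right_mono power_mono) auto
    also have "... = A / \<tau>" by (simp add: A_def power_mult_distrib flip: power_mult)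
    finally show ?thesis .
  qed
  have c0: "c \<ge> 0" using e by (simp add: c_def)
  \<comment> \<open>Here the excess \<open>e\<close> over 3/4 is used: \<open>K\<close> is
    \<open>1 / \<tau>\<close> up to powers of \<open>l\<close>, so this product decays exponentially
    at rate \<open>c\<close>.\<close>
  have K34: "real K * (3/4) ^ n \<le> exp (ln A - c * n)"
  proof -
    have "real K * (3/4) ^ n \<le> A / \<tau> * (3/4) ^ n" by (intro mult_right_mono KA) auto
    also have "... = A * ((3/4) / (3/4 + e)) ^ n"
      unfolding \<tau>_def power_divide[of "3/4" "3/4 + e"] by simp
    also have "(3/4) / (3/4 + e) = exp (- c)" using e by (simp add: c_def exp_minus)
    also have "A * exp (- c) ^ n = exp (ln A - c * n)"
      using A1 by (simp add: exp_diff exp_of_nat_mult[symmetric] exp_minus mult.commute field_simps)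
    finally show ?thesis .
  qed
  have Ke: "real K \<le> exp (ln A + n)"
  proof -
    have "1 / \<tau> \<le> (4/3) ^ n"
    proof -
      have "(3/4) ^ n \<le> \<tau>" unfolding \<tau>_def using e by (intro power_mono) auto
      then have "1 / \<tau> \<le> 1 / (3/4) ^ n" using \<tau> by (intro divide_left_mono) auto
      then show ?thesis by (simp add: power_divide)
    qed
    also have "(4/3::real) ^ n \<le> exp 1 ^ n"
    proof (rule power_mono)
      show "4/3 \<le> exp (1::real)" using exp_ge_add_one_self[of 1] by linarith
    qed simp
    also have "... = exp n" by (simp add: exp_of_nat_mult[symmetric])
    finally have "A * (1 / \<tau>) \<le> A * exp n" using A1 by (intro mult_left_mono) auto
    then show ?thesis using KA A1 by (simp add: exp_add)
  qed
  have K1: "K \<ge> 1"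
  proof -
    have "1 \<le> 3456 * real G ^ 5 / \<tau>" using \<tau> G5 by simp
    then show ?thesis using K(1) by linarith
  qed
  have mn: "n \<le> m\<^sup>2" "m\<^sup>2 \<le> 4 * n"
  proof -
    have "(sqrt n)\<^sup>2 \<le> (real m)\<^sup>2" using m by (intro power_mono) auto
    then have "real n \<le> real (m\<^sup>2)" by simp
    then show "n \<le> m\<^sup>2" by (simp only: of_nat_le_iff)
    have "(real m)\<^sup>2 \<le> (2 * sqrt n)\<^sup>2" using m by (intro power_mono) auto
    then have "real (m\<^sup>2) \<le> real (4 * n)" by (simp add: power_mult_distrib)
    then show "m\<^sup>2 \<le> 4 * n" by (simp only: of_nat_le_iff)
  qed
  have Gm: "4 * G\<^sup>2 \<le> m"
  proof -
    have "(real G)\<^sup>2 \<le> (2 * l\<^sup>2)\<^sup>2" using G by (intro power_mono) auto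
    moreover have "real (4 * G\<^sup>2) = 4 * (real G)\<^sup>2" by simp
    ultimately have "real (4 * G\<^sup>2) \<le> 4 * (2 * l\<^sup>2)\<^sup>2" by linarith
    then have "real (4 * G\<^sup>2) \<le> real m" using a1 m by linarith
    then show ?thesis by (simp only: of_nat_le_iff)
  qed
  have Gn: "G \<le> n"
  proof -
    have "real G \<le> real n" using G l by linarith
    then show ?thesis by (simp only: of_nat_le_iff)
  qed
  have small: "24 * n * exp (- real G) \<le> 1"
  proof -
    have "24 * n * exp (- real G) \<le> 24 * n * exp (- l\<^sup>2)" using G by (intro mult_left_mono) auto
    then show ?thesis using a2 by linarith
  qed
  have rm: "r \<le> m"
  proof -
    have "real n powr (1/4) \<le> real n powr (1/2)" using n1 by (intro powr_mono) auto
    then have "real r \<le> real m" using r m by (simp add: powr_half_sqrt)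
    then show ?thesis by (simp only: of_nat_le_iff)
  qed
  have l4: "l ^ 4 \<le> real G ^ 2"
  proof -
    have "(l\<^sup>2) ^ 2 \<le> real G ^ 2" using G by (intro power_mono) auto
    then show ?thesis by (simp flip: power_mult)
  qed
  have near: "m * exp (- (real G ^ 2 / 256)) \<le> 1"
  proof -
    have "m * exp (- (real G ^ 2 / 256)) \<le> 2 * sqrt n * exp (- (l ^ 4 / 256))"
      using m l4 by (intro mult_mono) auto
    then show ?thesis using a3 by linarith
  qed
  have exc: "4 * ln m \<le> real G ^ 4"
  proof -
    have "0 < 2 * sqrt n" using sn by linarith
    then have "ln m \<le> ln (2 * sqrt n)" using m m1 by (subst ln_le_cancel_iff) auto
    then have "4 * ln m \<le> 4 * ln (2 * sqrt n)" by simp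
    also have "... \<le> (l\<^sup>2) ^ 4" using a4 by (simp flip: power_mult)
    also have "... \<le> real G ^ 4" using G by (intro power_mono) auto
    finally show ?thesis .
  qed
  have D: "38 * n \<le> D * G"
  proof -
    have "38 * n / G \<le> D" unfolding D_def by linarith
    then have "real (38 * n) \<le> real (D * G)" using G1 by (simp add: field_simps)
    then show ?thesis by (simp only: of_nat_le_iff)
  qed
  have KG: "3456 * real G ^ 5 \<le> \<tau> * K" using K(1) \<tau> by (simp add: field_simps)
  have K341: "real K * (3/4) ^ n \<le> 1" using K34 a5 by (simp add: order_trans[of _ "exp (ln A - c * n)"])
  have q34: "(3/4) ^ n \<le> \<tau>" unfolding \<tau>_def using e by (intro power_mono) auto
  have P1: "real ((n + 1) * (20 * G * m + 1)) ^ D * (71/100) ^ (n - 1) \<le> \<tau>"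
  proof -
    define y where "y = ln ((real n + 1) * (80 * l\<^sup>2 * sqrt n + 1))"
    define t where "t = 38 * real n / l\<^sup>2 + 1"
    have b1: "(real n + 1) * (80 * l\<^sup>2 * sqrt n + 1) \<ge> 1 * 1" using l2 by (intro mult_mono) auto
    have "real G * real m \<le> (2 * l\<^sup>2) * (2 * sqrt n)" using G m l2 by (intro mult_mono) auto
    moreover have "real (20 * G * m) = 20 * (real G * real m)" by simp
    ultimately have Gm': "real (20 * G * m) + 1 \<le> 80 * l\<^sup>2 * sqrt n + 1" by linarith
    have "real ((n + 1) * (20 * G * m + 1)) = (real n + 1) * (real (20 * G * m) + 1)"
      by (simp only: of_nat_mult of_nat_add of_nat_1)
    also have "... \<le> (real n + 1) * (80 * l\<^sup>2 * sqrt n + 1)" by (rule mult_left_mono[OF Gm']) simp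
    also have "... = exp y" using b1 by (simp add: y_def)
    finally have bs: "real ((n + 1) * (20 * G * m + 1)) \<le> exp y" .
    have "38 * n / G \<le> 38 * n / l\<^sup>2" using G G1 l2 by (intro divide_left_mono mult_pos_pos) linarith+
    then have Dt: "real D \<le> t" unfolding D_def t_def using G1 by (simp add: of_nat_nat) linarith
    have "real ((n + 1) * (20 * G * m + 1)) ^ D \<le> exp (t * y)"
      using bs b1 Dt by (intro power_le_exp) (auto simp: y_def)
    \<comment> \<open>71/75 is the quotient of 71/100 and 3/4 and is at most
      \<open>exp (- 4/75)\<close>; this surplus pays for the net. The factor \<open>exp 1\<close>
      covers 100/71, since there are only \<open>n - 1\<close> rows.\<close>
    moreover have "(71/100::real) ^ (n - 1) \<le> exp 1 * (exp (- (4 * real n / 75)) * (3/4) ^ n)"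
    proof -
      have "(71/100::real) ^ (n - 1) * (71/100) = (71/75) ^ n * (3/4) ^ n"
        using n1 by (cases n) (auto simp: power_mult_distrib[symmetric] mult.commute)
      moreover have "(71/75::real) ^ n \<le> exp (- (4/75)) ^ n"
        using exp_ge_add_one_self[of "- (4/75)"] by (intro power_mono) auto
      then have "(71/75::real) ^ n * (3/4) ^ n \<le> exp (- (4 * real n / 75)) * (3/4) ^ n"
        by (intro mult_right_mono) (auto simp: exp_of_nat_mult[symmetric] mult.commute)
      ultimately have "(71/100::real) ^ (n - 1) * (71/100) \<le> exp (- (4 * real n / 75)) * (3/4) ^ n" by simp
      then have "(71/100::real) ^ (n - 1) \<le> 100/71 * (exp (- (4 * real n / 75)) * (3/4) ^ n)" by simp
      also have "... \<le> exp 1 * (exp (- (4 * real n / 75)) * (3/4) ^ n)"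
        using exp_ge_add_one_self[of 1] by (intro mult_right_mono) auto
      finally show ?thesis .
    qed
    ultimately have "real ((n + 1) * (20 * G * m + 1)) ^ D * (71/100) ^ (n - 1) \<le>
        exp (t * y) * (exp 1 * (exp (- (4 * real n / 75)) * (3/4) ^ n))" by (intro mult_mono) auto
    also have "... = exp (t * y + (1 + - (4 * real n / 75))) * (3/4) ^ n"
      by (simp only: exp_add mult.assoc)
    also have "... \<le> 1 * (3/4) ^ n"
    proof (intro mult_right_mono)
      have "t * y - 4 * real n / 75 \<le> -1" using a6 by (simp add: t_def y_def)
      then show "exp (t * y + (1 + - (4 * real n / 75))) \<le> 1" by simp
    qed simp
    finally show ?thesis using q34 by linarith
  qed
  have pre: "real K ^ 2 * (179159040 * real G ^ 7) ^ n * 5 ^ (Suc r * r) * real m ^ r \<le> exp F"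
  proof -
    have 1: "real K ^ 2 \<le> exp (2 * (ln A + n))" using Ke lnA by (intro power_le_exp) auto
    have "l ^ 14 \<ge> 1" using l by simp
    then have l14: "179159040 * (128 * l ^ 14) \<ge> 1" by simp
    have "real G ^ 7 \<le> (2 * l\<^sup>2) ^ 7" using G by (intro power_mono) auto
    also have "... = 128 * l ^ 14" by (simp add: power_mult_distrib flip: power_mult)
    finally have "179159040 * real G ^ 7 \<le> 179159040 * (128 * l ^ 14)" by simp
    also have "... = exp (ln (179159040 * (128 * l ^ 14)))" using l14 by (intro exp_ln[symmetric]) linarith
    finally have "179159040 * real G ^ 7 \<le> exp (ln (179159040 * (128 * l ^ 14)))" .
    then have 2: "(179159040 * real G ^ 7) ^ n \<le> exp (n * ln (179159040 * (128 * l ^ 14)))"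
      using l14 by (intro power_le_exp) auto
    have 3: "(5::real) ^ (Suc r * r) \<le> exp (2 * sqrt n * 2)"
    proof (rule power_le_exp)
      show "5 \<le> exp (2::real)" using exp_lower_Taylor_quadratic[of 2] by simp
      have "real (Suc r * r) \<le> (2 * real n powr (1/4)) * real n powr (1/4)"
        using r np by (simp only: of_nat_mult, intro mult_mono) auto
      also have "... = 2 * sqrt n" using n1 by (simp add: powr_half_sqrt flip: powr_add)
      finally show "real (Suc r * r) \<le> 2 * sqrt n" .
    qed auto
    have 4: "real m ^ r \<le> exp (n powr (1/4) * ln (2 * sqrt n))"
    proof (rule power_le_exp)
      have s2: "1 \<le> 2 * sqrt n" using sn by linarith
      then have "exp (ln (2 * sqrt n)) = 2 * sqrt n" by (intro exp_ln) linarith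
      then show "real m \<le> exp (ln (2 * sqrt n))" using m(2) by linarith
      show "0 \<le> ln (2 * sqrt n)" using s2 by (rule ln_ge_zero)
    qed (use r in auto)
    have "real K ^ 2 * (179159040 * real G ^ 7) ^ n * 5 ^ (Suc r * r) * real m ^ r \<le>
        exp (2 * (ln A + n)) * exp (n * ln (179159040 * (128 * l ^ 14))) * exp (2 * sqrt n * 2) *
        exp (n powr (1/4) * ln (2 * sqrt n))"
      by (intro mult_mono 1 2 3 4) auto
    also have "... = exp F" unfolding F_def exp_add[symmetric] by (simp add: algebra_simps)
    finally show ?thesis .
  qed
  have Q1: "(real K * (3/4) ^ n) ^ k0 \<le> exp ((sqrt l + 1) * ln A - c * (sqrt l * n))"
  proof -
    have "(real K * (3/4) ^ n) ^ k0 \<le> exp (ln A - c * n) ^ k0" using K34 by (intro power_mono) auto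
    also have "... = exp (k0 * ln A - k0 * (c * n))" by (simp add: exp_of_nat_mult[symmetric] algebra_simps)
    also have "... \<le> exp ((sqrt l + 1) * ln A - sqrt l * (c * n))"
    proof -
      have "k0 * ln A \<le> (sqrt l + 1) * ln A" using k0 lnA by (intro mult_right_mono) auto
      moreover have "sqrt l * (c * n) \<le> k0 * (c * n)" using k0 c0 by (intro mult_right_mono) auto
      ultimately show ?thesis by simp
    qed
    finally show ?thesis by (simp add: mult_ac)
  qed
  have Q2: "real K ^ k0 * sqrt (8 / (real r + 8)) ^ n \<le> exp ((sqrt l + 1) * (ln A + n) - n / 2 * ln ((n powr (1/4) + 7) / 8))"
  proof -
    define z where "z = (n powr (1/4) + 7) / 8"
    have z: "z \<ge> 1" using np by (simp add: z_def)
    have "8 / (real r + 8) \<le> 1 / z" using r np by (simp add: z_def frac_le)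
    also have "... = exp (- ln z)" using z by (simp add: exp_minus inverse_eq_divide)
    also have "... = (exp (- ln z / 2))\<^sup>2" by (simp add: power2_eq_square flip: exp_add)
    finally have "sqrt (8 / (real r + 8)) \<le> sqrt ((exp (- ln z / 2))\<^sup>2)" by (simp only: real_sqrt_le_mono)
    then have "sqrt (8 / (real r + 8)) \<le> exp (- ln z / 2)" by simp
    then have "sqrt (8 / (real r + 8)) ^ n \<le> exp (- ln z / 2) ^ n" by (intro power_mono) auto
    also have "... = exp (- (n / 2 * ln z))" by (simp add: exp_of_nat_mult[symmetric])
    finally have "sqrt (8 / (real r + 8)) ^ n \<le> exp (- (n / 2 * ln z))" .
    moreover have "real K ^ k0 \<le> exp ((sqrt l + 1) * (ln A + n))"
      using Ke lnA k0 by (intro power_le_exp) auto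
    ultimately have "real K ^ k0 * sqrt (8 / (real r + 8)) ^ n \<le> exp ((sqrt l + 1) * (ln A + n)) * exp (- (n / 2 * ln z))"
      by (intro mult_mono) auto
    then show ?thesis by (simp add: z_def flip: exp_add)
  qed
  have P2: "real K ^ 2 * (179159040 * real G ^ 7) ^ n * 5 ^ (Suc r * r) * real m ^ r *
      ((real K * (3/4) ^ n) ^ k0 + real K ^ k0 * sqrt (8 / (real r + 8)) ^ n) \<le> \<tau>"
  proof -
    have "real K ^ 2 * (179159040 * real G ^ 7) ^ n * 5 ^ (Suc r * r) * real m ^ r *
      ((real K * (3/4) ^ n) ^ k0 + real K ^ k0 * sqrt (8 / (real r + 8)) ^ n) \<le>
      exp F * (exp ((sqrt l + 1) * ln A - c * (sqrt l * n)) + exp ((sqrt l + 1) * (ln A + n) - n / 2 * ln ((n powr (1/4) + 7) / 8)))"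
      by (intro mult_mono add_mono pre Q1 Q2) auto
    also have "... = exp (F + (sqrt l + 1) * ln A - c * (sqrt l * n)) +
        exp (F + (sqrt l + 1) * (ln A + n) - n / 2 * ln ((n powr (1/4) + 7) / 8))"
      by (simp only: distrib_left[of "exp F"] exp_add[symmetric] add_diff_eq)
    \<comment> \<open>The extra -1 in \<open>a7\<close> and \<open>a8\<close> absorbs the factor 2,
      as \<open>2 \<le> exp 1\<close>.\<close>
    also have "... \<le> exp (- real n - 1) + exp (- real n - 1)" using a7 a8 by (intro add_mono) auto
    also have "... = (2 / exp 1) * exp (- real n)" by (simp add: exp_diff)
    also have "... \<le> 1 * exp (- real n)" using exp_ge_add_one_self[of 1] by (intro mult_right_mono) auto
    also have "exp (- real n) = exp (-1) ^ n" by (simp add: exp_of_nat_mult[symmetric])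
    also have "1 * exp (-1::real) ^ n \<le> (3/4) ^ n"
    proof -
      have "exp (-1::real) \<le> 3/4" using exp_ge_add_one_self[of 1] by (simp add: exp_minus field_simps)
      then show ?thesis by (simp add: power_mono)
    qed
    finally show ?thesis using q34 by linarith
  qed
  have "singular_count n / (2 ^ n) ^ n \<le> n * (real ((n + 1) * (20 * G * m + 1)) ^ D * (71/100) ^ (n - 1) +
      real K ^ 2 * (179159040 * real G ^ 7) ^ n * 5 ^ (Suc r * r) * real m ^ r *
        ((real K * (3/4) ^ n) ^ k0 + real K ^ k0 * sqrt (8 / (real r + 8)) ^ n) + \<tau>)"
    by (rule singular_count_le[OF n1 mn G3 Gm Gn small rm near exc D \<tau>(1) KG K1 K341])
  also have "... \<le> n * (\<tau> + \<tau> + \<tau>)" using P1 P2 by (intro mult_left_mono add_mono) auto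
  finally show ?thesis by (simp add: \<tau>_def)
qed

lemma singular_count_eventually:
  fixes e :: real
  assumes e: "e > 0" "e < 1/8"
  shows "eventually (\<lambda>n. singular_count n / (2 ^ n) ^ n \<le> (3/4 + 2 * e) ^ n) sequentially"
proof -
  define c where "c = ln ((3/4 + e) / (3/4))"
  define c' where "c' = ln ((3/4 + 2 * e) / (3/4 + e))"
  have c: "c > 0" "c' > 0" using e by (simp_all add: c_def c'_def)
  define A where "A = (\<lambda>n::nat. 110624 * ln (real n) ^ 10)"
  define F where "F = (\<lambda>n::nat. 2 * (ln (A n) + n) + n * ln (179159040 * (128 * ln (real n) ^ 14)) +
    4 * sqrt n + n powr (1/4) * ln (2 * sqrt n))"
  \<comment> \<open>The constant \<open>c\<close> has no fixed numerical value. Inequalities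
    containing it are divided by their leading term, so that a limit 0 and \<open>c > 0\<close>
    suffice.\<close>
  have t1: "((\<lambda>n. ln (A n) / n) \<longlongrightarrow> 0) sequentially" unfolding A_def by real_asymp
  have t2: "((\<lambda>n. (F n + (sqrt (ln (real n)) + 1) * ln (A n) + n + 1) / (sqrt (ln (real n)) * n)) \<longlongrightarrow> 0) sequentially"
    unfolding F_def A_def by real_asymp
  have t3: "((\<lambda>n. ln (3 * real n) / n) \<longlongrightarrow> 0) sequentially" by real_asymp
  have e1: "eventually (\<lambda>n. ln (A n) / n < c) sequentially" using t1 c(1) by (rule order_tendstoD)
  have e2: "eventually (\<lambda>n. (F n + (sqrt (ln (real n)) + 1) * ln (A n) + n + 1) / (sqrt (ln (real n)) * n) < c) sequentially"
    using t2 c(1) by (rule order_tendstoD)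
  have e3: "eventually (\<lambda>n. ln (3 * real n) / n < c') sequentially" using t3 c(2) by (rule order_tendstoD)
  have e4: "eventually (\<lambda>n. F n + (sqrt (ln (real n)) + 1) * (ln (A n) + n) - n / 2 * ln ((n powr (1/4) + 7) / 8) \<le> - real n - 1) sequentially"
    unfolding F_def A_def by real_asymp
  have e5: "eventually (\<lambda>n. (38 * real n / (ln (real n))\<^sup>2 + 1) * ln ((real n + 1) * (80 * (ln (real n))\<^sup>2 * sqrt n + 1)) - 4 * real n / 75 \<le> -1) sequentially"
    by real_asymp
  have e6: "eventually (\<lambda>n. 4 * ln (2 * sqrt (real n)) \<le> ln (real n) ^ 8) sequentially" by real_asymp
  have e7: "eventually (\<lambda>n. 2 * sqrt (real n) * exp (- (ln (real n) ^ 4 / 256)) \<le> 1) sequentially" by real_asymp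
  have e8: "eventually (\<lambda>n. 24 * real n * exp (- (ln (real n))\<^sup>2) \<le> 1) sequentially" by real_asymp
  have e9: "eventually (\<lambda>n. 4 * (2 * (ln (real n))\<^sup>2)\<^sup>2 \<le> sqrt (real n)) sequentially" by real_asymp
  have e10: "eventually (\<lambda>n. (ln (real n))\<^sup>2 \<ge> 3) sequentially" by real_asymp
  have e11: "eventually (\<lambda>n. ln (real n) \<ge> 1) sequentially" by real_asymp
  have e12: "eventually (\<lambda>n. 2 * (ln (real n))\<^sup>2 \<le> real n) sequentially" by real_asymp
  show ?thesis
    using eventually_ge_at_top[of 1] e1 e2 e3 e4 e5 e6 e7 e8 e9 e10 e11 e12
  proof eventually_elim
    case (elim n)
    have n: "real n > 0" using elim(1) by simp
    have sl: "sqrt (ln (real n)) * n > 0" using elim(12) n by (intro mult_pos_pos real_sqrt_gt_zero) linarith+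
    have "singular_count n / (2 ^ n) ^ n \<le> 3 * real n * (3/4 + e) ^ n"
    proof (rule singular_count_le_exp[OF e elim(1)])
      show "ln (110624 * ln (real n) ^ 10) \<le> ln ((3/4 + e) / (3/4)) * n"
        using elim(2) n by (simp add: A_def c_def pos_divide_less_eq)
      have "F n + (sqrt (ln (real n)) + 1) * ln (A n) + n + 1 < c * (sqrt (ln (real n)) * n)"
        using elim(3) sl by (simp add: pos_divide_less_eq)
      then show "2 * (ln (110624 * ln (real n) ^ 10) + n) + n * ln (179159040 * (128 * ln (real n) ^ 14)) +
          4 * sqrt n + n powr (1/4) * ln (2 * sqrt n) + (sqrt (ln (real n)) + 1) * ln (110624 * ln (real n) ^ 10) -
          ln ((3/4 + e) / (3/4)) * (sqrt (ln (real n)) * n) \<le> - real n - 1"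
        unfolding F_def A_def c_def by linarith
      show "2 * (ln (110624 * ln (real n) ^ 10) + n) + n * ln (179159040 * (128 * ln (real n) ^ 14)) +
          4 * sqrt n + n powr (1/4) * ln (2 * sqrt n) + (sqrt (ln (real n)) + 1) * (ln (110624 * ln (real n) ^ 10) + n) -
          n / 2 * ln ((n powr (1/4) + 7) / 8) \<le> - real n - 1"
        using elim(5) unfolding F_def A_def .
    qed (use elim in auto)
    \<comment> \<open>The factor \<open>3 * n\<close> is absorbed in the room between
      \<open>e\<close> and \<open>2 * e\<close>, which is exponential with rate
      \<open>c'\<close>.\<close>
    also have "3 * real n * (3/4 + e) ^ n \<le> (3/4 + 2 * e) ^ n"
    proof -
      have "ln (3 * real n) \<le> c' * n" using elim(4) n by (simp add: pos_divide_less_eq)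
      then have "exp (ln (3 * real n)) \<le> exp (c' * n)" by simp
      also have "... = exp c' ^ n" by (simp add: exp_of_nat_mult[symmetric] mult.commute)
      also have "exp c' = (3/4 + 2 * e) / (3/4 + e)" using e by (simp add: c'_def)
      finally have "3 * real n \<le> (3/4 + 2 * e) ^ n / (3/4 + e) ^ n" using n by (simp add: power_divide)
      moreover have "(3/4 + e) ^ n > 0" using e by simp
      ultimately show ?thesis by (simp add: pos_le_divide_eq)
    qed
    finally show ?case .
  qed
qed

subsection \<open>The random matrix\<close>

text \<open>The entries are signs almost surely, so up to a null set the singular event is covered
  by the finitely many events \<open>A R\<close> that the entries agree with a fixed singular sign
  matrix; by independence each has probability \<open>1 / (2 ^ n) ^ n\<close>.\<close>

lemma singular_prob_le:
  assumes "random_sign_matrix \<Omega> n M" and n: "n \<ge> 1"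
  shows "\<P>(\<omega> in \<Omega>. Determinant.det (M \<omega>) = 0) \<le> singular_count n / (2 ^ n) ^ n"
proof -
  interpret prob_space \<Omega> using assms by (simp add: random_sign_matrix_def)
  define J where "J = {..<n} \<times> {..<n}"
  define X where "X = (\<lambda>(i, j) \<omega>. M \<omega> $$ (i, j))"
  have carrier: "M \<omega> \<in> carrier_mat n n" if "\<omega> \<in> space \<Omega>" for \<omega>
    using assms that by (simp add: random_sign_matrix_def)
  have indep: "indep_vars (\<lambda>_. borel) X J"
    using assms by (simp add: random_sign_matrix_def X_def J_def)
  have half: "prob {\<omega> \<in> space \<Omega>. X p \<omega> = 1} = 1/2" "prob {\<omega> \<in> space \<Omega>. X p \<omega> = -1} = 1/2" if "p \<in> J" for p
    using assms that by (auto simp: random_sign_matrix_def X_def J_def split: prod.splits)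
  have meas: "X p \<in> borel_measurable \<Omega>" if "p \<in> J" for p
    using indep that by (simp add: indep_vars_def)
  have ev: "{\<omega> \<in> space \<Omega>. X p \<omega> = c} \<in> events" if "p \<in> J" for p c
    using meas[OF that] by measurable
  have ae1: "AE \<omega> in \<Omega>. X p \<omega> = 1 \<or> X p \<omega> = -1" if p: "p \<in> J" for p
  proof -
    let ?A = "{\<omega> \<in> space \<Omega>. X p \<omega> = 1}" and ?B = "{\<omega> \<in> space \<Omega>. X p \<omega> = -1}"
    have "prob (?A \<union> ?B) = prob ?A + prob ?B"
      using ev[OF p] by (intro finite_measure_Union) auto
    then have "prob (?A \<union> ?B) = 1" using half[OF p] by simp
    then have "AE \<omega> in \<Omega>. \<omega> \<in> ?A \<union> ?B"
      by (subst (asm) prob_eq_1) (use ev[OF p] in auto)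
    then show ?thesis by eventually_elim auto
  qed
  have finJ: "finite J" by (simp add: J_def)
  have ae: "AE \<omega> in \<Omega>. \<forall>p\<in>J. X p \<omega> = 1 \<or> X p \<omega> = -1"
    using ae1 finJ by (simp add: AE_finite_all)
  define S where "S = {R \<in> sign_rows {..<n} n. Determinant.det (rows_mat n R) = 0}"
  have finS: "finite S" unfolding S_def
    by (rule finite_subset[of _ "sign_rows {..<n} n"]) (auto intro: finite_PiE)
  define A where "A = (\<lambda>R. (\<Inter>p\<in>J. X p -` {R (fst p) (snd p)} \<inter> space \<Omega>))"
  have J0: "J \<noteq> {}" using n by (auto simp: J_def lessThan_empty_iff)
  have vim: "X p -` {c} \<inter> space \<Omega> = {\<omega> \<in> space \<Omega>. X p \<omega> = c}" for p c by auto
  have Aev: "A R \<in> events" for R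
    unfolding A_def vim using J0 finJ ev by (intro sets.finite_INT) auto
  have PA: "prob (A R) = 1 / (2 ^ n) ^ n" if R: "R \<in> S" for R
  proof -
    have "prob (A R) = (\<Prod>p\<in>J. prob (X p -` {R (fst p) (snd p)} \<inter> space \<Omega>))"
      unfolding A_def by (rule indep_varsD[OF indep J0 finJ subset_refl]) simp
    also have "... = (\<Prod>p\<in>J. 1/2)"
    proof (intro prod.cong refl)
      fix p assume p: "p \<in> J"
      have RP: "R \<in> sign_rows {..<n} n" using R by (simp add: S_def)
      have "fst p \<in> {..<n}" "snd p < n" using p by (auto simp: J_def)
      then have "R (fst p) (snd p) = -1 \<or> R (fst p) (snd p) = 1" using PiE_mem[OF RP] by (intro signsD[of _ n]) auto
      then show "prob (X p -` {R (fst p) (snd p)} \<inter> space \<Omega>) = 1/2" unfolding vim using half[OF p] by auto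
    qed
    also have "... = 1 / (2 ^ n) ^ n" by (simp add: J_def power_one_over power_mult card_cartesian_product)
    finally show ?thesis .
  qed
  have "prob {\<omega> \<in> space \<Omega>. Determinant.det (M \<omega>) = 0} \<le> prob (\<Union>R\<in>S. A R)"
  proof (rule finite_measure_mono_AE)
    show "AE \<omega> in \<Omega>. \<omega> \<in> {\<omega> \<in> space \<Omega>. Determinant.det (M \<omega>) = 0} \<longrightarrow> \<omega> \<in> (\<Union>R\<in>S. A R)"
      using ae
    proof eventually_elim
      case (elim \<omega>)
      show ?case
      proof
        assume "\<omega> \<in> {\<omega> \<in> space \<Omega>. Determinant.det (M \<omega>) = 0}"
        then have w: "\<omega> \<in> space \<Omega>" "Determinant.det (M \<omega>) = 0" by auto
        define R where "R = (\<lambda>i\<in>{..<n}. \<lambda>j\<in>{..<n}. M \<omega> $$ (i, j))"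
        have "rows_mat n R = M \<omega>"
          using carrier[OF w(1)] by (intro eq_matI) (auto simp: rows_mat_def R_def)
        moreover have "R \<in> sign_rows {..<n} n"
        proof -
          have "M \<omega> $$ (i, j) \<in> {-1, 1}" if "i < n" "j < n" for i j
            using elim[rule_format, of "(i, j)"] that by (auto simp: J_def X_def)
          then have "(\<lambda>j\<in>{..<n}. M \<omega> $$ (i, j)) \<in> signs n" if "i < n" for i
            unfolding signs_def using that by (intro restrict_PiE_iff[THEN iffD2]) simp
          then show ?thesis unfolding R_def by (intro restrict_PiE_iff[THEN iffD2]) simp
        qed
        ultimately have "R \<in> S" using w(2) by (simp add: S_def)
        moreover have "\<omega> \<in> A R" using w(1) by (simp add: A_def J_def X_def R_def)
        ultimately show "\<omega> \<in> (\<Union>R\<in>S. A R)" by blast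
      qed
    qed
    show "(\<Union>R\<in>S. A R) \<in> events" using finS Aev by (intro sets.finite_UN) auto
  qed
  also have "... \<le> (\<Sum>R\<in>S. prob (A R))"
    using finS Aev by (intro finite_measure_subadditive_finite) auto
  also have "... = card S * (1 / (2 ^ n) ^ n)" using PA by simp
  finally show ?thesis by (simp add: S_def singular_count_def)
qed

theorem theorem1p2:
  fixes \<Omega> :: "nat \<Rightarrow> 'a measure" and M :: "nat \<Rightarrow> 'a \<Rightarrow> real mat"
  assumes "\<And>n. n \<ge> 1 \<Longrightarrow> random_sign_matrix (\<Omega> n) n (M n)"
  shows "\<exists>\<epsilon> :: nat \<Rightarrow> real. \<epsilon> \<longlonglongrightarrow> 0 \<and>
           (\<forall>n\<ge>1. \<P>(\<omega> in \<Omega> n. Determinant.det (M n \<omega>) = 0) \<le> (3 / 4 + \<epsilon> n) ^ n)"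
proof -
  define P where "P = (\<lambda>n. \<P>(\<omega> in \<Omega> n. Determinant.det (M n \<omega>) = 0))"
  \<comment> \<open>The smallest nonnegative error for which the bound holds at \<open>n\<close>;
    what has to be shown is that it tends to 0.\<close>
  define \<epsilon> where "\<epsilon> = (\<lambda>n. max 0 (root n (P n) - 3/4))"
  have P0: "P n \<ge> 0" for n by (simp add: P_def)
  have P: "P n \<le> singular_count n / (2 ^ n) ^ n" if "n \<ge> 1" for n
    unfolding P_def by (rule singular_prob_le[OF assms[OF that] that])
  have "\<epsilon> \<longlonglongrightarrow> 0"
  proof (rule tendstoI)
    fix d :: real assume d: "d > 0"
    define e where "e = min (d / 4) (1 / 16)"
    have e: "e > 0" "e < 1/8" "2 * e < d" using d by (auto simp: e_def min_def)
    show "eventually (\<lambda>n. dist (\<epsilon> n) 0 < d) sequentially"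
      using singular_count_eventually[OF e(1,2)] eventually_ge_at_top[of 1]
    proof eventually_elim
      case (elim n)
      have "P n \<le> (3/4 + 2 * e) ^ n" using P[OF elim(2)] elim(1) by linarith
      then have "root n (P n) \<le> root n ((3/4 + 2 * e) ^ n)" using elim(2) by (intro real_root_le_mono) auto
      also have "... = 3/4 + 2 * e" using elim(2) e by (intro real_root_power_cancel) auto
      finally show ?case using e d by (simp add: \<epsilon>_def)
    qed
  qed
  moreover have "P n \<le> (3/4 + \<epsilon> n) ^ n" if "n \<ge> 1" for n
  proof -
    have "P n = root n (P n) ^ n" using P0 that by (simp add: real_root_pow_pos2)
    also have "... \<le> (3/4 + \<epsilon> n) ^ n"
      using P0 that by (intro power_mono) (auto simp: \<epsilon>_def)
    finally show ?thesis .
  qed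
  ultimately show ?thesis unfolding P_def by blast
qed

end
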